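(* The space $\mathcal B_T^r(H)$ of $T$-regular operators is a vector lattice for the order inherited from $\mathcal L_b^A(H)$ and a subalgebra of $\mathcal B_T(H)$. More precisely, if $S=P-N$ with $P,N\in\mathcal B_T(H)_+$, then $|S|_{\rm ord}\in\mathcal B_T(H)_+$ and $$0\le |S|_{\rm ord}\le P+N.$$ Consequently $S^+,S^-\in\mathcal B_T(H)_+$. If $k_P,k_N\in A_+$ satisfy $\|Px\|_{T,2}\le k_P\|x\|_{T,2}$ and $\|Nx\|_{T,2}\le k_N\|x\|_{T,2}$ for all $x\in H$, then $$\bigl\||S|_{\rm ord}x\bigr\|_{T,2}\le (k_P+k_N)\|x\|_{T,2},\qquad x\in H.$$
   Context: Setting. All spaces are real. $E$ is a Dedekind complete Riesz space with weak order unit $e$. $T:E\to E$ is a conditional expectation operator, i.e. a positive order-continuous linear projection whose range is a Dedekind complete Riesz subspace and which maps weak order units to weak order units; it satisfies $Te=e$ and is strictly positive ($x\ge 0$ and $Tx=0$ imply $x=0$). $E^u$ is the universal completion of $E$, with its $f$-algebra multiplication having unit $e$. $L^1(T)\subseteq E^u$ is the natural domain of $T$: the set of differences $f_1-f_2$ with $f_i\in E^u_+$ such that there is a net $(f_\alpha)$ in $E_+$ with $f_\alpha\uparrow f_i$ in $E^u$ and $(Tf_\alpha)$ bounded above in $E^u$; $T$ is extended to $L^1(T)$ by $Tf_i=\sup_\alpha Tf_\alpha$, and the extension, still denoted $T$, is again a strictly positive conditional expectation on $L^1(T)$ with $Te=e$. $A:=R(T)$ is the range of the (extended) $T$; it is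 a Dedekind complete unital Archimedean $f$-algebra with unit $e$, and $T(az)=aT(z)$ for $a\in A$ whenever the products are defined. $H:=L^2(T)=\{x\in L^1(T):x^2\in L^1(T)\}$ with the inherited order is a Dedekind complete Riesz space and an $A$-module. For $x,y\in H$, $\langle x,y\rangle_T:=T(xy)\in A$ and $\|x\|_{T,2}:=(T(x^2))^{1/2}\in A_+$ (the positive square root in $A$). Definitions. $\mathcal B_T(H)$ is the set of $A$-linear (additive and $A$-homogeneous) maps $S:H\to H$ that are $T$-strongly bounded: there is $k\in A_+$ with $\|Sx\|_{T,2}\le k\|x\|_{T,2}$ for all $x\in H$; it is a unital algebra under composition. An operator $S$ on $H$ is order positive if $x\ge0$ implies $Sx\ge0$; $R\le Q$ means that $Q-R$ is order positive. $\mathcal B_T(H)_+$ is the set of order-positive operators in $\mathcal B_T(H)$, and $\mathcal B_T^r(H):=\mathcal B_T(H)_+-\mathcal B_T(H)_+$ (the $T$-regular operators). $\mathcal L_b^A(H)$ is the set of $A$-linear order-bounded operators $R:H\to H$; with the order in which $R\le Q$ means that $Q-R$ is order positive, it is a Dedekind complete vector lattice whose lattice operations are the Riesz--Kantorovich ones: $|R|_{\rm ord}x=\sup\{|Ru|:|u|\le x\}$ for $x\in H_+$, $R^+=\tfrac12(|R|_{\rm ord}+R)$, $R^-=\tfrac12(|R|_{\rm ord}-R)$. *)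

theory Defs
  imports "HOL-Analysis.Analysis" "HOL-Library.Lattice_Algebras" "HOL-Library.Function_Algebras"
begin

section \<open>Universally complete f-algebras and Riesz subspaces\<close>

text \<open>
  The universal completion \<open>E\<^sup>u\<close> of \<open>E\<close> is a universally complete Riesz space in which \<open>E\<close> is an
  order dense Riesz subspace. Here \<open>E\<^sup>u\<close> is a type of the class below, its multiplicative unit \<open>1\<close>
  is the element written \<open>e\<close> in the mathematical text, and \<open>E\<close> is a set of elements of that type.
  \<^class>\<open>monoid_mult\<close> is used for the unit because the ring classes with unit would exclude the
  space \<open>{0}\<close>. Since the order is already Dedekind complete, boundedness of a nonempty set is the
  same as existence of its supremum; this is how lateral completeness is stated.
\<close>

class universally_complete_f_algebra =
  lattice_ring + real_algebra + monoid_mult + ordered_real_vector + conditionally_complete_lattice +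
  assumes f_algebra_left: "inf x y = 0 \<Longrightarrow> 0 \<le> z \<Longrightarrow> inf (z * x) y = 0"
    and f_algebra_right: "inf x y = 0 \<Longrightarrow> 0 \<le> z \<Longrightarrow> inf (x * z) y = 0"
    and laterally_complete:
      "\<forall>x\<in>D. 0 \<le> x \<Longrightarrow> \<forall>x\<in>D. \<forall>y\<in>D. x \<noteq> y \<longrightarrow> inf x y = 0 \<Longrightarrow> bdd_above D"

text \<open>Suprema and infima relative to a carrier set \<open>C\<close> and an order relation \<open>le\<close>.\<close>

definition lub_in :: "('b \<Rightarrow> 'b \<Rightarrow> bool) \<Rightarrow> 'b set \<Rightarrow> 'b set \<Rightarrow> 'b \<Rightarrow> bool" where
  "lub_in le C D s \<longleftrightarrow>
     s \<in> C \<and> (\<forall>d\<in>D. le d s) \<and> (\<forall>u\<in>C. (\<forall>d\<in>D. le d u) \<longrightarrow> le s u)"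

definition glb_in :: "('b \<Rightarrow> 'b \<Rightarrow> bool) \<Rightarrow> 'b set \<Rightarrow> 'b set \<Rightarrow> 'b \<Rightarrow> bool" where
  "glb_in le C D s \<longleftrightarrow> lub_in (\<lambda>x y. le y x) C D s"

definition riesz_subspace :: "'a::universally_complete_f_algebra set \<Rightarrow> bool" where
  "riesz_subspace C \<longleftrightarrow> subspace C \<and> (\<forall>x\<in>C. \<forall>y\<in>C. sup x y \<in> C \<and> inf x y \<in> C)"

definition dedekind_complete :: "'a::order set \<Rightarrow> bool" where
  "dedekind_complete C \<longleftrightarrow>
     (\<forall>D. D \<subseteq> C \<and> D \<noteq> {} \<and> (\<exists>u\<in>C. \<forall>d\<in>D. d \<le> u) \<longrightarrow> (\<exists>s. lub_in (\<le>) C D s))"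

definition order_dense :: "'a::universally_complete_f_algebra set \<Rightarrow> bool" where
  "order_dense C \<longleftrightarrow> (\<forall>x>0. \<exists>y\<in>C. 0 < y \<and> y \<le> x)"

definition weak_order_unit :: "'a::universally_complete_f_algebra set \<Rightarrow> 'a \<Rightarrow> bool" where
  "weak_order_unit C w \<longleftrightarrow> w \<in> C \<and> 0 \<le> w \<and> (\<forall>x\<in>C. inf \<bar>x\<bar> w = 0 \<longrightarrow> x = 0)"

text \<open>
  Monotone nets are represented by their ranges: an increasing net has an upward directed range, a
  directed set is a monotone net indexed by itself, and suprema, infima and bounds see the range
  only.
\<close>

definition up_directed :: "'a::order set \<Rightarrow> bool" where
  "up_directed D \<longleftrightarrow> D \<noteq> {} \<and> (\<forall>x\<in>D. \<forall>y\<in>D. \<exists>z\<in>D. x \<le> z \<and> y \<le> z)"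

definition down_directed :: "'a::order set \<Rightarrow> bool" where
  "down_directed D \<longleftrightarrow> D \<noteq> {} \<and> (\<forall>x\<in>D. \<forall>y\<in>D. \<exists>z\<in>D. z \<le> x \<and> z \<le> y)"


section \<open>Conditional expectations\<close>

definition positive_linear_on ::
    "'a::universally_complete_f_algebra set \<Rightarrow> ('a \<Rightarrow> 'a) \<Rightarrow> bool" where
  "positive_linear_on E T \<longleftrightarrow>
     T ` E \<subseteq> E \<and>
     (\<forall>x\<in>E. \<forall>y\<in>E. T (x + y) = T x + T y) \<and>
     (\<forall>c. \<forall>x\<in>E. T (c *\<^sub>R x) = c *\<^sub>R T x) \<and>
     (\<forall>x\<in>E. 0 \<le> x \<longrightarrow> 0 \<le> T x)"

text \<open>Order continuity of a positive operator: \<open>x\<^sub>\<alpha> \<down> 0\<close> in \<open>E\<close> implies \<open>T x\<^sub>\<alpha> \<down> 0\<close> in \<open>E\<close>.\<close>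

definition order_continuous_on ::
    "'a::universally_complete_f_algebra set \<Rightarrow> ('a \<Rightarrow> 'a) \<Rightarrow> bool" where
  "order_continuous_on E T \<longleftrightarrow>
     (\<forall>D\<subseteq>E. down_directed D \<and> glb_in (\<le>) E D 0 \<longrightarrow> glb_in (\<le>) E (T ` D) 0)"

definition conditional_expectation_on ::
    "'a::universally_complete_f_algebra set \<Rightarrow> ('a \<Rightarrow> 'a) \<Rightarrow> bool" where
  "conditional_expectation_on E T \<longleftrightarrow>
     positive_linear_on E T \<and>
     order_continuous_on E T \<and>
     (\<forall>x\<in>E. T (T x) = T x) \<and>
     riesz_subspace (T ` E) \<and> dedekind_complete (T ` E) \<and>
     (\<forall>w. weak_order_unit E w \<longrightarrow> weak_order_unit E (T w))"

locale riesz_conditional_expectation =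
  fixes E :: "'a::universally_complete_f_algebra set" and T :: "'a \<Rightarrow> 'a"
  assumes E_riesz: "riesz_subspace E"
    and E_dedekind: "dedekind_complete E"
    and E_dense: "order_dense E"
    and E_unit: "weak_order_unit E 1"
    and T_cond_exp: "conditional_expectation_on E T"
    and T_one: "T 1 = 1"
    and T_strict: "\<And>x. x \<in> E \<Longrightarrow> 0 \<le> x \<Longrightarrow> T x = 0 \<Longrightarrow> x = 0"


section \<open>The natural domain, the extension of \<open>T\<close>, and the space \<open>L\<^sup>2(T)\<close>\<close>

text \<open>
  \<open>ext_value E T f y\<close>: there is a net in \<open>E\<^sub>+\<close> increasing to \<open>f\<close> in \<open>E\<^sup>u\<close> whose image under \<open>T\<close> is
  bounded above in \<open>E\<^sup>u\<close> and has supremum \<open>y\<close> there.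
\<close>

definition ext_value ::
    "'a::universally_complete_f_algebra set \<Rightarrow> ('a \<Rightarrow> 'a) \<Rightarrow> 'a \<Rightarrow> 'a \<Rightarrow> bool" where
  "ext_value E T f y \<longleftrightarrow>
     (\<exists>D. D \<subseteq> {x\<in>E. 0 \<le> x} \<and> up_directed D \<and> lub_in (\<le>) UNIV D f \<and>
          bdd_above (T ` D) \<and> y = Sup (T ` D))"

definition L1 :: "'a::universally_complete_f_algebra set \<Rightarrow> ('a \<Rightarrow> 'a) \<Rightarrow> 'a set" where
  "L1 E T = {f1 - f2 | f1 f2. (\<exists>y1. ext_value E T f1 y1) \<and> (\<exists>y2. ext_value E T f2 y2)}"

text \<open>The extension of \<open>T\<close>; only its values on \<^term>\<open>L1 E T\<close> are meaningful.\<close>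

definition Text :: "'a::universally_complete_f_algebra set \<Rightarrow> ('a \<Rightarrow> 'a) \<Rightarrow> 'a \<Rightarrow> 'a" where
  "Text E T x =
     (THE y. \<exists>f1 f2 y1 y2. ext_value E T f1 y1 \<and> ext_value E T f2 y2 \<and> x = f1 - f2 \<and> y = y1 - y2)"

definition rangeT :: "'a::universally_complete_f_algebra set \<Rightarrow> ('a \<Rightarrow> 'a) \<Rightarrow> 'a set" where
  "rangeT E T = Text E T ` L1 E T"

definition L2 :: "'a::universally_complete_f_algebra set \<Rightarrow> ('a \<Rightarrow> 'a) \<Rightarrow> 'a set" where
  "L2 E T = {x \<in> L1 E T. x * x \<in> L1 E T}"

definition normT2 :: "'a::universally_complete_f_algebra set \<Rightarrow> ('a \<Rightarrow> 'a) \<Rightarrow> 'a \<Rightarrow> 'a" where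
  "normT2 E T x = (THE r. r \<in> rangeT E T \<and> 0 \<le> r \<and> r * r = Text E T (x * x))"


section \<open>Operators on \<open>H = L\<^sup>2(T)\<close>\<close>

text \<open>
  An operator \<open>H \<rightarrow> H\<close> is represented by the function on the whole type that vanishes outside \<open>H\<close>, so
  that equality of operators is equality of functions; sums, differences and composition are those
  of functions, and only the identity needs an explicit restriction.
\<close>

definition A_linear_ops ::
    "'a::universally_complete_f_algebra set \<Rightarrow> ('a \<Rightarrow> 'a) \<Rightarrow> ('a \<Rightarrow> 'a) set" where
  "A_linear_ops E T = {S.
     (\<forall>x\<in>L2 E T. S x \<in> L2 E T) \<and> (\<forall>x. x \<notin> L2 E T \<longrightarrow> S x = 0) \<and>
     (\<forall>x\<in>L2 E T. \<forall>y\<in>L2 E T. S (x + y) = S x + S y) \<and>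
     (\<forall>a\<in>rangeT E T. \<forall>x\<in>L2 E T. S (a * x) = a * S x)}"

definition op_id :: "'a::zero set \<Rightarrow> 'a \<Rightarrow> 'a" where
  "op_id H x = (if x \<in> H then x else 0)"

definition order_positive :: "'a::{ord,zero} set \<Rightarrow> ('a \<Rightarrow> 'a) \<Rightarrow> bool" where
  "order_positive H S \<longleftrightarrow> (\<forall>x\<in>H. 0 \<le> x \<longrightarrow> 0 \<le> S x)"

definition op_le :: "'a::{ord,zero,minus} set \<Rightarrow> ('a \<Rightarrow> 'a) \<Rightarrow> ('a \<Rightarrow> 'a) \<Rightarrow> bool" where
  "op_le H R Q \<longleftrightarrow> order_positive H (Q - R)"

definition strong_bound ::
    "'a::universally_complete_f_algebra set \<Rightarrow> ('a \<Rightarrow> 'a) \<Rightarrow> ('a \<Rightarrow> 'a) \<Rightarrow> 'a \<Rightarrow> bool" where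
  "strong_bound E T S k \<longleftrightarrow> (\<forall>x\<in>L2 E T. normT2 E T (S x) \<le> k * normT2 E T x)"

definition BT :: "'a::universally_complete_f_algebra set \<Rightarrow> ('a \<Rightarrow> 'a) \<Rightarrow> ('a \<Rightarrow> 'a) set" where
  "BT E T = {S \<in> A_linear_ops E T. \<exists>k\<in>rangeT E T. 0 \<le> k \<and> strong_bound E T S k}"

definition BT_pos :: "'a::universally_complete_f_algebra set \<Rightarrow> ('a \<Rightarrow> 'a) \<Rightarrow> ('a \<Rightarrow> 'a) set" where
  "BT_pos E T = {S \<in> BT E T. order_positive (L2 E T) S}"

definition BT_reg :: "'a::universally_complete_f_algebra set \<Rightarrow> ('a \<Rightarrow> 'a) \<Rightarrow> ('a \<Rightarrow> 'a) set" where
  "BT_reg E T = {P - N | P N. P \<in> BT_pos E T \<and> N \<in> BT_pos E T}"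

definition LbA :: "'a::universally_complete_f_algebra set \<Rightarrow> ('a \<Rightarrow> 'a) \<Rightarrow> ('a \<Rightarrow> 'a) set" where
  "LbA E T = {R \<in> A_linear_ops E T.
     \<forall>u\<in>L2 E T. \<forall>v\<in>L2 E T. \<exists>a\<in>L2 E T. \<exists>b\<in>L2 E T.
       \<forall>x\<in>L2 E T. u \<le> x \<and> x \<le> v \<longrightarrow> a \<le> R x \<and> R x \<le> b}"

text \<open>
  The Riesz--Kantorovich formula gives \<open>|R|\<^sub>o\<^sub>r\<^sub>d\<close> on \<open>H\<^sub>+\<close>, the supremum being taken in \<open>H\<close>; its
  linear extension to \<open>H\<close> is obtained from \<open>x = x\<^sup>+ - x\<^sup>-\<close>.
\<close>

definition RK_abs :: "'a::universally_complete_f_algebra set \<Rightarrow> ('a \<Rightarrow> 'a) \<Rightarrow> 'a \<Rightarrow> 'a" where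
  "RK_abs H R x = (THE s. lub_in (\<le>) H {\<bar>R u\<bar> | u. u \<in> H \<and> \<bar>u\<bar> \<le> x} s)"

definition ord_abs :: "'a::universally_complete_f_algebra set \<Rightarrow> ('a \<Rightarrow> 'a) \<Rightarrow> 'a \<Rightarrow> 'a" where
  "ord_abs H R x = (if x \<in> H then RK_abs H R (sup x 0) - RK_abs H R (sup (- x) 0) else 0)"

definition ord_pos :: "'a::universally_complete_f_algebra set \<Rightarrow> ('a \<Rightarrow> 'a) \<Rightarrow> 'a \<Rightarrow> 'a" where
  "ord_pos H R x = (1/2) *\<^sub>R (ord_abs H R x + R x)"

definition ord_neg :: "'a::universally_complete_f_algebra set \<Rightarrow> ('a \<Rightarrow> 'a) \<Rightarrow> 'a \<Rightarrow> 'a" where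
  "ord_neg H R x = (1/2) *\<^sub>R (ord_abs H R x - R x)"


section \<open>Vector lattices and algebras of operators\<close>

definition op_subspace :: "('b \<Rightarrow> 'a::real_vector) set \<Rightarrow> bool" where
  "op_subspace V \<longleftrightarrow>
     0 \<in> V \<and> (\<forall>R\<in>V. \<forall>Q\<in>V. R + Q \<in> V) \<and> (\<forall>c. \<forall>R\<in>V. (\<lambda>x. c *\<^sub>R R x) \<in> V)"

definition op_vector_lattice ::
    "('b \<Rightarrow> 'a::real_vector) set \<Rightarrow> (('b \<Rightarrow> 'a) \<Rightarrow> ('b \<Rightarrow> 'a) \<Rightarrow> bool) \<Rightarrow> bool" where
  "op_vector_lattice V le \<longleftrightarrow>
     op_subspace V \<and>
     (\<forall>R\<in>V. le R R) \<and>
     (\<forall>R\<in>V. \<forall>Q\<in>V. le R Q \<and> le Q R \<longrightarrow> R = Q) \<and>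
     (\<forall>R\<in>V. \<forall>Q\<in>V. \<forall>M\<in>V. le R Q \<and> le Q M \<longrightarrow> le R M) \<and>
     (\<forall>R\<in>V. \<forall>Q\<in>V. \<forall>M\<in>V. le R Q \<longrightarrow> le (R + M) (Q + M)) \<and>
     (\<forall>c\<ge>0. \<forall>R\<in>V. \<forall>Q\<in>V. le R Q \<longrightarrow> le (\<lambda>x. c *\<^sub>R R x) (\<lambda>x. c *\<^sub>R Q x)) \<and>
     (\<forall>R\<in>V. \<forall>Q\<in>V. (\<exists>M. lub_in le V {R, Q} M) \<and> (\<exists>M. glb_in le V {R, Q} M))"

definition op_subalgebra ::
    "('a::real_vector \<Rightarrow> 'a) \<Rightarrow> ('a \<Rightarrow> 'a) set \<Rightarrow> ('a \<Rightarrow> 'a) set \<Rightarrow> bool" where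
  "op_subalgebra I V B \<longleftrightarrow>
     V \<subseteq> B \<and> op_subspace V \<and> I \<in> V \<and> (\<forall>R\<in>V. \<forall>Q\<in>V. R \<circ> Q \<in> V)"

end

theory Submission
  imports Defs
begin

text \<open>
  The square of an element \<open>c\<close> of the f-algebra is the supremum of \<open>2tc - t\<^sup>2\<close> over the real
  numbers \<open>t\<close>, a formula made of operations that \<open>T\<close> respects. It replaces representation by
  functions and approximation by band projections: it shows that the range \<open>A\<close> of the
  extended \<open>T\<close> is closed under products and square roots, and that \<open>(T x)\<^sup>2 \<le> T (x\<^sup>2)\<close>. So
  \<open>T (x y) - T x T y\<close> is a positive semidefinite form which vanishes at \<open>(a, a)\<close> for \<open>a\<close> in \<open>A\<close>,
  whence \<open>T (a z) = a T z\<close>, and the Cauchy--Schwarz and triangle inequalities follow.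

  For \<open>S = P - N\<close> and \<open>\<bar>u\<bar> \<le> x\<close> one has \<open>\<bar>S u\<bar> \<le> (P + N) x\<close>, so the Riesz--Kantorovich suprema exist
  in the Dedekind complete \<open>H\<close> and \<open>\<bar>S\<bar>\<close> is dominated by \<open>P + N\<close>, which gives the bounds in norm.
\<close>

section \<open>Archimedean f-algebras\<close>

text \<open>The obstacle throughout is that elements of A, and of E^u in general, may be unbounded
  relative to 1 and have no inverses, so one can neither divide by them nor bound them by a real
  number. Two devices stand in. Division is replaced by disjointness: a positive element vanishes as
  soon as it is disjoint from 1, or as soon as its square is 0. Boundedness is replaced by
  truncation at n, whose error \<open>z - inf z (real n *\<^sub>R 1)\<close> is at most z^2 / n.
  This one estimate makes multiplication pass through suprema, carries the averaging identity from
  L^2 to L^1, and makes |S| homogeneous over A. Commutativity of the product is not an axiom of the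
  class; it is derived from the Archimedean property. The extension of T is handled without nets: E,
  being order dense and Dedekind complete, is an ideal of E^u, and the elements of E between 0 and f
  form one canonical net for f.\<close>

lemma inf_sup_distrib_group:
  fixes x y z :: "'a::lattice_ab_group_add"
  shows "inf x (sup y z) = sup (inf x y) (inf x z)"
proof (rule order.antisym)
  let ?d = "sup y z" and ?m = "sup (inf x y) (inf x z)"
  \<comment> \<open>Translation by \<open>inf x ?d - ?d\<close>, which is at most 0, carries
    \<open>?d\<close> to \<open>inf x ?d\<close>; hence it carries any t below \<open>?d\<close> to
    a common lower bound of x and t.\<close>
  have *: "t + (inf x ?d - ?d) \<le> inf x t" if "t \<le> ?d" for t
  proof (rule inf_greatest)
    have "t + (inf x ?d - ?d) \<le> ?d + (inf x ?d - ?d)"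
      using that by (rule add_right_mono)
    also have "\<dots> = inf x ?d" by (simp only: add_diff_eq add_diff_cancel_left')
    also have "\<dots> \<le> x" by (rule inf_le1)
    finally show "t + (inf x ?d - ?d) \<le> x" .
    have "t + (inf x ?d - ?d) \<le> t + 0"
      by (rule add_left_mono) (simp only: diff_le_0_iff_le inf_le2)
    then show "t + (inf x ?d - ?d) \<le> t" by (simp only: add_0_right)
  qed
  have "y + (inf x ?d - ?d) \<le> ?m" "z + (inf x ?d - ?d) \<le> ?m"
    using *[of y] *[of z] by (simp_all add: le_supI1 le_supI2 del: diff_sup_eq_inf)
  then have "y \<le> ?m - (inf x ?d - ?d)" "z \<le> ?m - (inf x ?d - ?d)"
    by (simp_all only: le_diff_eq)
  then have "?d \<le> ?m - (inf x ?d - ?d)" by (rule sup_least)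
  then show "inf x ?d \<le> ?m" by (simp add: le_diff_eq del: diff_sup_eq_inf)
qed (auto intro: le_infI2)

lemma inf_add_le:
  fixes u p q :: "'a::lattice_ab_group_add"
  assumes "0 \<le> u" "0 \<le> p" "0 \<le> q"
  shows "inf u (p + q) \<le> inf u p + inf u q"
proof -
  have "inf u p + inf u q = inf (inf (u + u) (p + u)) (inf (u + q) (p + q))"
    by (simp add: add_sup_inf_distribs)
  moreover have "u \<le> u + u" "u \<le> p + u" "u \<le> u + q"
    using assms by simp_all
  ultimately show ?thesis by (auto intro: le_infI1)
qed

lemma disjoint_add:
  fixes u p q :: "'a::lattice_ab_group_add"
  assumes "inf u p = 0" "inf u q = 0"
  shows "inf u (p + q) = 0"
proof (rule order.antisym)
  have nn: "0 \<le> u" "0 \<le> p" "0 \<le> q"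
    using assms by (metis inf_le1, metis inf_le2, metis inf_le2)
  show "inf u (p + q) \<le> 0" using inf_add_le[OF nn] assms by simp
  show "0 \<le> inf u (p + q)" using nn by simp
qed

lemma disjoint_mono:
  fixes u p :: "'a::lattice_ab_group_add"
  assumes "inf u p = 0" "0 \<le> v" "v \<le> u" "0 \<le> q" "q \<le> p"
  shows "inf v q = 0"
  using assms by (metis inf.mono le_inf_iff order.antisym)

lemma pprt_minus_pprt: "pprt x - pprt (- x) = (x::'a::lattice_ab_group_add)"
  by (simp add: pprt_neg flip: prts)

lemma inf_pprt_pprt_minus:
  fixes x :: "'a::lattice_ab_group_add"
  shows "inf (pprt x) (pprt (- x)) = 0"
proof -
  have "pprt x = pprt (- x) + x"
    using pprt_minus_pprt[of x] by (simp add: algebra_simps)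
  then have "inf (pprt x) (pprt (- x)) = inf (pprt (- x) + x) (pprt (- x) + 0)"
    by (simp only: add_0_right)
  also have "\<dots> = pprt (- x) + nprt x"
    by (simp only: nprt_def add_inf_distrib_left)
  also have "\<dots> = 0"
    by (simp add: pprt_neg)
  finally show ?thesis .
qed

lemma pprt_diff_le:
  fixes x d :: "'a::lattice_ab_group_add"
  assumes "0 \<le> d"
  shows "pprt x - d \<le> pprt (x - d)"
proof -
  have "x - d \<le> pprt (x - d)" by (simp add: pprt_def)
  then have "x \<le> pprt (x - d) + d" by (simp add: diff_le_eq)
  moreover have "0 \<le> pprt (x - d) + d" using assms by simp
  ultimately have "pprt x \<le> pprt (x - d) + d" by (simp add: pprt_def)
  then show ?thesis by (simp add: diff_le_eq)
qed

lemma abs_eq_pprt_add: "\<bar>x\<bar> = pprt x + pprt (- x :: 'a::lattice_ab_group_add_abs)"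
  by (simp add: abs_prts pprt_neg)

text \<open>By distributivity the right side is a supremum of four infima, each of the form
  \<open>inf (t + s) (t - s)\<close>, that is t - |s|. The identity combines bounds by |c - t| and
  |c + t| into one by ||c| - t|, so that c may be replaced by the positive element |c|.\<close>

lemma abs_diff_abs_eq_inf:
  fixes x y :: "'a::lattice_ab_group_add_abs"
  shows "\<bar>\<bar>x\<bar> - \<bar>y\<bar>\<bar> = inf \<bar>x + y\<bar> \<bar>x - y\<bar>"
proof (rule order.antisym)
  show "\<bar>\<bar>x\<bar> - \<bar>y\<bar>\<bar> \<le> inf \<bar>x + y\<bar> \<bar>x - y\<bar>"
    using abs_triangle_ineq3[of x "- y"] abs_triangle_ineq3[of x y] by simp
  let ?r = "\<bar>\<bar>x\<bar> - \<bar>y\<bar>\<bar>"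
  have *: "t - \<bar>s\<bar> \<le> \<bar>\<bar>t\<bar> - \<bar>s\<bar>\<bar>" for t s :: 'a
    by (rule order_trans[OF diff_right_mono[OF abs_ge_self] abs_ge_self])
  have y: "x - \<bar>y\<bar> \<le> ?r" "- x - \<bar>y\<bar> \<le> ?r" "y - \<bar>x\<bar> \<le> ?r" "- y - \<bar>x\<bar> \<le> ?r"
    using *[of x y] *[of "- x" y] *[of y x] *[of "- y" x] by (simp_all add: abs_minus_commute)
  have inf_eq: "inf (t + s) (t - s) = t - \<bar>s\<bar>" for t s :: 'a
  proof -
    have "t - \<bar>s\<bar> = t + inf (- s) s"
      by (simp only: abs_lattice diff_conv_add_uminus neg_sup_eq_inf minus_minus)
    also have "\<dots> = inf (t - s) (t + s)"
      by (simp only: add_inf_distrib_left diff_conv_add_uminus)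
    finally show ?thesis by (simp only: inf_commute)
  qed
  have "inf (x + y) (x - y) \<le> ?r" using y(1) inf_eq[of x y] by simp
  moreover have "inf (- x - y) (y - x) \<le> ?r"
    using y(2) inf_eq[of "- x" y] by (simp add: inf_commute add.commute)
  moreover have "inf (x + y) (y - x) \<le> ?r"
    using y(3) inf_eq[of y x] by (simp add: add.commute)
  moreover have "inf (- x - y) (x - y) \<le> ?r"
  proof -
    have "- y + x = x - y" "- y - x = - x - y" by (simp_all add: algebra_simps)
    then show ?thesis using y(4) inf_eq[of "- y" x] by (simp only: inf_commute)
  qed
  moreover have "inf \<bar>x + y\<bar> \<bar>x - y\<bar> =
     sup (sup (inf (x + y) (x - y)) (inf (x + y) (y - x)))
         (sup (inf (- x - y) (x - y)) (inf (- x - y) (y - x)))"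
  proof -
    have *: "inf (sup a b) (sup c d) = sup (sup (inf a c) (inf a d)) (sup (inf b c) (inf b d))"
      for a b c d :: 'a
      by (metis inf_sup_distrib_group inf_commute)
    show ?thesis using *[of "x + y" "- x - y" "x - y" "y - x"]
      by (simp add: abs_lattice del: neg_inf_eq_sup neg_sup_eq_inf diff_inf_eq_sup diff_sup_eq_inf)
  qed
  ultimately show "inf \<bar>x + y\<bar> \<bar>x - y\<bar> \<le> ?r"
    by (simp only: le_sup_iff simp_thms)
qed

section \<open>The Archimedean property and disjoint elements of the f-algebra\<close>

lemma lub_in_cSup:
  fixes D :: "'a::conditionally_complete_lattice set"
  assumes "D \<noteq> {}" "bdd_above D"
  shows "lub_in (\<le>) UNIV D (Sup D)"
  using assms by (auto simp: lub_in_def intro: cSup_upper cSup_least)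

text \<open>The positive multiples of x are bounded above by y, and adding x to one of them gives
  another; so their supremum s satisfies s + x \<le> s.\<close>

lemma archimedean:
  fixes x y :: "'a::universally_complete_f_algebra"
  assumes "\<And>\<epsilon>::real. 0 < \<epsilon> \<Longrightarrow> x \<le> \<epsilon> *\<^sub>R y"
  shows "x \<le> 0"
proof -
  let ?X = "(\<lambda>r::real. r *\<^sub>R x) ` {0<..}"
  have le: "r *\<^sub>R x \<le> y" if "0 < r" for r :: real
  proof -
    have "r *\<^sub>R x \<le> r *\<^sub>R ((1 / r) *\<^sub>R y)"
      using assms[of "1 / r"] that by (intro scaleR_left_mono) auto
    then show ?thesis using that by simp
  qed
  have bdd: "bdd_above ?X"
    using le by (intro bdd_aboveI[of _ y]) auto
  have "Sup ?X \<le> Sup ?X - x"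
  proof (rule cSup_least)
    fix v assume "v \<in> ?X"
    then obtain r where r: "0 < r" "v = r *\<^sub>R x" by auto
    have "(r + 1) *\<^sub>R x \<le> Sup ?X"
      by (rule cSup_upper[OF _ bdd]) (use r in auto)
    then show "v \<le> Sup ?X - x" using r by (simp add: algebra_simps)
  qed auto
  then show ?thesis by simp
qed

lemma archimedean_nat:
  fixes x y :: "'a::universally_complete_f_algebra"
  assumes "\<And>n::nat. 0 < n \<Longrightarrow> x \<le> (1 / real n) *\<^sub>R y" and "0 \<le> y"
  shows "x \<le> 0"
proof (rule archimedean)
  fix \<epsilon> :: real assume "0 < \<epsilon>"
  then obtain n where n: "0 < n" "1 / real n < \<epsilon>"
    by (metis nat_approx_posE zero_less_Suc)
  then have "(1 / real n) *\<^sub>R y \<le> \<epsilon> *\<^sub>R y"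
    using assms(2) by (intro scaleR_right_mono) auto
  then show "x \<le> \<epsilon> *\<^sub>R y" using assms(1)[OF n(1)] by simp
qed

text \<open>One factor of the disjoint pair is multiplied at a time: x * y becomes disjoint from x,
  and then from itself.\<close>

lemma disjoint_mult_eq_0:
  fixes x y :: "'a::universally_complete_f_algebra"
  assumes "inf x y = 0"
  shows "x * y = 0"
proof -
  have nn: "0 \<le> x" "0 \<le> y" using assms by (metis inf_le1, metis inf_le2)
  have "inf (x * y) x = 0"
    using f_algebra_left[of y x x] assms nn by (simp add: inf_commute)
  then have "inf x (x * y) = 0" by (simp add: inf_commute)
  then have "inf (x * y) (x * y) = 0"
    using f_algebra_right[of x "x * y" y] nn by simp
  then show ?thesis by simp
qed

lemma abs_mult_abs_self: "\<bar>x\<bar> * \<bar>x\<bar> = x * (x::'a::universally_complete_f_algebra)"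
proof -
  have 0: "pprt x * pprt (- x) = 0" "pprt (- x) * pprt x = 0"
    using inf_pprt_pprt_minus[of x] by (auto intro!: disjoint_mult_eq_0 simp: inf_commute)
  have "\<bar>x\<bar> * \<bar>x\<bar> = pprt x * pprt x + pprt (- x) * pprt (- x)"
    using 0 by (simp add: abs_eq_pprt_add algebra_simps)
  also have "\<dots> = (pprt x - pprt (- x)) * (pprt x - pprt (- x))"
    using 0 by (simp add: algebra_simps)
  finally show ?thesis by (simp only: pprt_minus_pprt)
qed

lemma square_nonneg: "0 \<le> x * (x::'a::universally_complete_f_algebra)"
  using mult_nonneg_nonneg[of "\<bar>x\<bar>" "\<bar>x\<bar>"] by (simp add: abs_mult_abs_self)

lemma one_nonneg: "0 \<le> (1::'a::universally_complete_f_algebra)"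
  using square_nonneg[of "1::'a"] by simp

lemma scaleR_one_nonneg: "0 \<le> r \<Longrightarrow> 0 \<le> r *\<^sub>R (1::'a::universally_complete_f_algebra)"
  by (simp add: one_nonneg scaleR_nonneg_nonneg)

text \<open>Multiplying the 1 by u makes u disjoint from itself. To show that a positive element is
  0, it is thus enough to estimate its truncation at 1.\<close>

lemma disjoint_one:
  fixes u :: "'a::universally_complete_f_algebra"
  assumes "inf u 1 = 0"
  shows "u = 0"
proof -
  have "0 \<le> u" using assms by (metis inf_le1)
  then have "inf (u * 1) u = 0"
    using assms by (intro f_algebra_left) (simp_all add: inf_commute)
  then show ?thesis by simp
qed

lemma disjoint_scaleR:
  fixes u p :: "'a::universally_complete_f_algebra"
  assumes "inf u p = 0" "0 \<le> r"
  shows "inf (r *\<^sub>R u) p = 0"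
  using f_algebra_left[OF assms(1) scaleR_one_nonneg[OF assms(2)]] by simp

lemma scaleR_inf:
  fixes x y :: "'a::universally_complete_f_algebra"
  assumes "0 \<le> r"
  shows "r *\<^sub>R inf x y = inf (r *\<^sub>R x) (r *\<^sub>R y)"
proof (cases "r = 0")
  case False
  then have r: "0 < r" using assms by simp
  show ?thesis
  proof (rule order.antisym)
    show "r *\<^sub>R inf x y \<le> inf (r *\<^sub>R x) (r *\<^sub>R y)"
      using assms by (simp add: scaleR_left_mono)
    have "(1 / r) *\<^sub>R inf (r *\<^sub>R x) (r *\<^sub>R y) \<le> inf x y"
    proof (rule inf_greatest)
      have "(1 / r) *\<^sub>R inf (r *\<^sub>R x) (r *\<^sub>R y) \<le> (1 / r) *\<^sub>R (r *\<^sub>R x)"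
        using r by (intro scaleR_left_mono) auto
      then show "(1 / r) *\<^sub>R inf (r *\<^sub>R x) (r *\<^sub>R y) \<le> x" using r by simp
      have "(1 / r) *\<^sub>R inf (r *\<^sub>R x) (r *\<^sub>R y) \<le> (1 / r) *\<^sub>R (r *\<^sub>R y)"
        using r by (intro scaleR_left_mono) auto
      then show "(1 / r) *\<^sub>R inf (r *\<^sub>R x) (r *\<^sub>R y) \<le> y" using r by simp
    qed
    then have "r *\<^sub>R ((1 / r) *\<^sub>R inf (r *\<^sub>R x) (r *\<^sub>R y)) \<le> r *\<^sub>R inf x y"
      using assms by (rule scaleR_left_mono)
    then show "inf (r *\<^sub>R x) (r *\<^sub>R y) \<le> r *\<^sub>R inf x y" using r by simp
  qed
qed simp

text \<open>If \<open>w\<close> exceeds \<open>\<delta>\<close> times the value at \<open>1\<close> on some band, then \<open>c\<close> has to jump over each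
  grid interval \<open>[k\<delta>, (k + 1)\<delta>]\<close> there, hence be larger than every real number.\<close>

lemma approx_by_scalars:
  fixes w c z :: "'a::universally_complete_f_algebra"
  assumes z: "0 \<le> z" and c: "0 \<le> c"
    and w: "\<And>t::real. 0 \<le> t \<Longrightarrow> w \<le> \<bar>c - t *\<^sub>R 1\<bar> * z + z * \<bar>c - t *\<^sub>R 1\<bar>"
  shows "w \<le> 0"
proof -
  \<comment> \<open>Products from both sides are summed because commutativity is derived from this
    very lemma.\<close>
  define f where "f x = x * z + z * x" for x :: 'a
  have f_diff: "f (x - y) = f x - f y" for x y by (simp add: f_def algebra_simps)
  have f_scale: "f (r *\<^sub>R x) = r *\<^sub>R f x" for r :: real and x
    by (simp add: f_def scaleR_add_right)
  have f_mono: "f x \<le> f y" if "x \<le> y" for x y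
    unfolding f_def using that z by (intro add_mono mult_left_mono mult_right_mono)
  have f_disj: "inf v (f x) = 0" if "inf v x = 0" for v x
    unfolding f_def using that z f_algebra_left[of x v z] f_algebra_right[of x v z]
    by (intro disjoint_add) (simp_all add: inf_commute)
  have main: "w \<le> \<delta> *\<^sub>R f 1" if \<delta>: "0 < \<delta>" for \<delta> :: real
  proof -
    \<comment> \<open>\<open>p k\<close> and \<open>q k\<close> measure how far c lies above and
      below the grid point k \<delta>; they are disjoint and add up to |c - k \<delta>|.\<close>
    define p where "p k = pprt (c - (real k * \<delta>) *\<^sub>R 1)" for k
    define q where "q k = pprt ((real k * \<delta>) *\<^sub>R 1 - c)" for k
    define u where "u = pprt (w - \<delta> *\<^sub>R f 1)"
    have pq: "inf (p k) (q k) = 0" for k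
      using inf_pprt_pprt_minus[of "c - (real k * \<delta>) *\<^sub>R 1"] by (simp add: p_def q_def)
    have nn: "0 \<le> p k" "0 \<le> q k" "0 \<le> u" for k by (simp_all add: p_def q_def u_def)
    have f0: "0 \<le> f (p k)" "0 \<le> f (q k)" for k
      using f_mono[OF nn(1)] f_mono[OF nn(2)] by (simp_all add: f_def)
    have step: "u \<le> f (p (Suc k)) + f (q k)" for k
    proof -
      have "p k - \<delta> *\<^sub>R 1 \<le> p (Suc k)"
        using pprt_diff_le[of "\<delta> *\<^sub>R 1" "c - (real k * \<delta>) *\<^sub>R 1"] \<delta> scaleR_one_nonneg[of \<delta>, where 'a = 'a]
        by (simp add: p_def distrib_right scaleR_left_distrib add.commute diff_diff_add)
      then have A: "f (p k) - \<delta> *\<^sub>R f 1 \<le> f (p (Suc k))"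
        using f_mono[of "p k - \<delta> *\<^sub>R 1"] by (simp only: f_diff f_scale)
      have W: "w \<le> f (p k) + f (q k)"
      proof -
        have "\<bar>c - (real k * \<delta>) *\<^sub>R 1\<bar> = p k + q k"
          by (simp add: abs_eq_pprt_add p_def q_def)
        then show ?thesis using w[of "real k * \<delta>"] \<delta> by (simp add: f_def algebra_simps)
      qed
      have "w - \<delta> *\<^sub>R f 1 \<le> f (p k) + f (q k) - \<delta> *\<^sub>R f 1"
        using W by (rule diff_right_mono)
      also have "\<dots> = (f (p k) - \<delta> *\<^sub>R f 1) + f (q k)" by simp
      also have "\<dots> \<le> f (p (Suc k)) + f (q k)" using A by (rule add_right_mono)
      finally have "w - \<delta> *\<^sub>R f 1 \<le> f (p (Suc k)) + f (q k)" .
      then show ?thesis using f0 by (simp add: u_def pprt_def)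
    qed
    \<comment> \<open>The part of u that meets \<open>q (Suc k)\<close> is disjoint from
      \<open>p (Suc k)\<close> and, by induction, from \<open>q k\<close>, hence from the bound on u
      in \<open>step\<close>. The base case is c \<ge> 0: nothing lies below the grid point
      0.\<close>
    have uq: "inf u (q k) = 0" for k
    proof (induction k)
      case 0
      then show ?case using c nn by (simp add: q_def pprt_def sup_absorb2 inf_absorb2)
    next
      case (Suc k)
      define v where "v = inf u (q (Suc k))"
      have v: "0 \<le> v" "v \<le> u" "v \<le> q (Suc k)" using nn by (simp_all add: v_def)
      have "inf v (p (Suc k)) = 0"
        using disjoint_mono[OF _ v(1,3) nn(1) order.refl] pq[of "Suc k"] by (simp add: inf_commute)
      moreover have "inf v (q k) = 0"
        using disjoint_mono[OF Suc.IH v(1,2) nn(2) order.refl] .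
      ultimately have "inf v (f (p (Suc k)) + f (q k)) = 0"
        by (intro disjoint_add f_disj)
      moreover have "v \<le> f (p (Suc k)) + f (q k)" using v(2) step[of k] by (rule order_trans)
      ultimately show ?case unfolding v_def[symmetric] by (simp add: inf_absorb1)
    qed
    \<comment> \<open>With r = n \<delta> one has r \<le> \<open>q n\<close> + c. As u is disjoint
      from \<open>q n\<close>, only c is left as a bound on \<open>r *\<^sub>R inf u 1\<close>,
      while r is arbitrarily large.\<close>
    have "inf u 1 \<le> 0"
    proof (rule archimedean_nat[OF _ scaleR_nonneg_nonneg[of "1 / \<delta>" c]])
      fix n :: nat assume n: "0 < n"
      define r where "r = real n * \<delta>"
      have r: "0 < r" using n \<delta> by (simp add: r_def)
      have "r *\<^sub>R inf u 1 = inf (r *\<^sub>R u) (r *\<^sub>R 1)" using r by (simp add: scaleR_inf)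
      also have "\<dots> \<le> inf (r *\<^sub>R u) (q n + c)"
        unfolding q_def r_def[symmetric]
        by (intro inf_mono order.refl) (simp add: pprt_def add_sup_distrib_right)
      also have "\<dots> \<le> inf (r *\<^sub>R u) (q n) + inf (r *\<^sub>R u) c"
        using r nn c by (intro inf_add_le) (simp_all add: scaleR_nonneg_nonneg)
      also have "inf (r *\<^sub>R u) (q n) = 0" using uq r by (intro disjoint_scaleR) auto
      also have "0 + inf (r *\<^sub>R u) c \<le> c" by simp
      finally have "(1 / r) *\<^sub>R (r *\<^sub>R inf u 1) \<le> (1 / r) *\<^sub>R c"
        using r by (intro scaleR_left_mono) auto
      then show "inf u 1 \<le> (1 / real n) *\<^sub>R ((1 / \<delta>) *\<^sub>R c)"
        using n \<delta> by (simp add: r_def)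
    qed (use c \<delta> in auto)
    then have "inf u 1 = 0" using nn(3) one_nonneg by (intro order.antisym) simp_all
    then have "u = 0" by (rule disjoint_one)
    then show ?thesis using le_zero_iff_zero_pprt[of "w - \<delta> *\<^sub>R f 1"] by (simp add: u_def)
  qed
  show ?thesis by (rule archimedean[OF main])
qed

text \<open>The commutator of x and z does not change when x is replaced by x - t, so its modulus is
  at most |x - t| z + z |x - t| for every t, which is the hypothesis of
  \<open>approx_by_scalars\<close>.\<close>

lemma mult_commute: "x * y = y * (x::'a::universally_complete_f_algebra)"
proof -
  have *: "x * z = z * x" if x: "0 \<le> x" and z: "0 \<le> z" for x z :: 'a
  proof -
    have "\<bar>x * z - z * x\<bar> \<le> 0"
    proof (rule approx_by_scalars[OF z x])
      fix t :: real
      let ?d = "x - t *\<^sub>R 1"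
      have "\<bar>x * z - z * x\<bar> = \<bar>?d * z - z * ?d\<bar>" by (simp add: algebra_simps)
      also have "\<dots> \<le> \<bar>?d * z\<bar> + \<bar>z * ?d\<bar>" by (rule abs_triangle_ineq4)
      also have "\<dots> \<le> \<bar>?d\<bar> * z + z * \<bar>?d\<bar>"
        using abs_le_mult[of ?d z] abs_le_mult[of z ?d] z by (intro add_mono) auto
      finally show "\<bar>x * z - z * x\<bar> \<le> \<bar>?d\<bar> * z + z * \<bar>?d\<bar>" .
    qed
    then show ?thesis by simp
  qed
  have "(pprt x - pprt (- x)) * (pprt y - pprt (- y)) = (pprt y - pprt (- y)) * (pprt x - pprt (- x))"
    by (simp add: algebra_simps *)
  then show ?thesis by (simp only: pprt_minus_pprt)
qed

lemma mult_left_commute: "x * (y * z) = y * (x * (z::'a::universally_complete_f_algebra))"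
  by (simp only: mult.assoc[symmetric] mult_commute[of x y])

text \<open>Equivalently, \<open>c * c\<close> is the supremum of \<open>2tc - t\<^sup>2\<close> over the real numbers \<open>t\<close>, a formula
  that any positive linear map fixing \<open>1\<close> respects in one direction.\<close>

lemma inf_square_diff_le_0:
  fixes w c :: "'a::universally_complete_f_algebra"
  assumes w: "\<And>t::real. w \<le> (c - t *\<^sub>R 1) * (c - t *\<^sub>R 1)"
  shows "w \<le> 0"
proof -
  \<comment> \<open>The truncation at 1 turns the quadratic bound on w into a bound by d = |c - t|
    itself, because \<open>inf (d * d) 1\<close> is at most d.\<close>
  let ?v = "inf (pprt w) 1"
  have le: "?v \<le> \<bar>c - t *\<^sub>R 1\<bar>" for t :: real
  proof -
    let ?d = "\<bar>c - t *\<^sub>R 1\<bar>"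
    have "pprt w \<le> ?d * ?d" using w[of t] by (simp add: pprt_def abs_mult_abs_self square_nonneg)
    then have "?v \<le> inf (?d * ?d) 1" by (intro inf_mono) auto
    also have "\<dots> \<le> ?d"
    proof -
      \<comment> \<open>(d - 1)^+ and (1 - d)^+ are disjoint, and remain so after the former is
        multiplied by d; they then dominate d^2 - d and 1 - d.\<close>
      have "inf (?d * pprt (?d - 1)) (pprt (1 - ?d)) = 0"
        using inf_pprt_pprt_minus[of "?d - 1"] by (intro f_algebra_left) auto
      moreover have "?d * ?d - ?d \<le> ?d * pprt (?d - 1)"
        using mult_left_mono[of "?d - 1" "pprt (?d - 1)" ?d]
        by (simp add: pprt_def algebra_simps)
      moreover have "1 - ?d \<le> pprt (1 - ?d)" by (simp add: pprt_def)
      ultimately have "inf (?d * ?d - ?d) (1 - ?d) \<le> 0"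
        using inf_mono[of "?d * ?d - ?d" "?d * pprt (?d - 1)" "1 - ?d" "pprt (1 - ?d)"] by simp
      moreover have "inf (?d * ?d - ?d) (1 - ?d) = inf (?d * ?d) 1 - ?d"
        using add_inf_distrib_right[of "?d * ?d" 1 "- ?d"] by simp
      ultimately show ?thesis by simp
    qed
    finally show ?thesis .
  qed
  \<comment> \<open>With z = 1/2 the two one-sided products add up to ||c| - t|.\<close>
  have "?v \<le> 0"
  proof (rule approx_by_scalars[where c = "\<bar>c\<bar>" and z = "(1 / 2) *\<^sub>R 1"])
    fix t :: real assume t: "0 \<le> t"
    have "\<bar>t *\<^sub>R 1\<bar> = t *\<^sub>R (1::'a)" using scaleR_one_nonneg[OF t] by (rule abs_of_nonneg)
    then have "?v \<le> \<bar>\<bar>c\<bar> - t *\<^sub>R 1\<bar>"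
      using abs_diff_abs_eq_inf[of c "t *\<^sub>R 1"] le[of t] le[of "- t"] by simp
    then show "?v \<le> \<bar>\<bar>c\<bar> - t *\<^sub>R 1\<bar> * ((1 / 2) *\<^sub>R 1) + ((1 / 2) *\<^sub>R 1) * \<bar>\<bar>c\<bar> - t *\<^sub>R 1\<bar>"
      by (simp flip: scaleR_add_left)
  qed (simp_all add: scaleR_one_nonneg)
  then have "?v = 0" by (intro order.antisym) (simp_all add: one_nonneg)
  then have "pprt w = 0" by (rule disjoint_one)
  then show ?thesis by (simp only: le_zero_iff_zero_pprt)
qed

lemma square_diff_scalar:
  fixes c :: "'a::universally_complete_f_algebra"
  shows "(c - t *\<^sub>R 1) * (c - t *\<^sub>R 1) = c * c - ((2 * t) *\<^sub>R c - (t * t) *\<^sub>R 1)"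
  by (simp add: algebra_simps flip: scaleR_add_left)

lemma square_ge_affine:
  fixes c :: "'a::universally_complete_f_algebra"
  shows "(2 * t) *\<^sub>R c - (t * t) *\<^sub>R 1 \<le> c * c"
  using square_nonneg[of "c - t *\<^sub>R 1"] by (simp add: square_diff_scalar)

lemma square_le_if_affine_le:
  fixes c y :: "'a::universally_complete_f_algebra"
  assumes "\<And>t::real. (2 * t) *\<^sub>R c - (t * t) *\<^sub>R 1 \<le> y"
  shows "c * c \<le> y"
proof -
  have "c * c - y \<le> 0"
    using assms by (intro inf_square_diff_le_0[where c = c]) (simp add: square_diff_scalar diff_left_mono)
  then show ?thesis by simp
qed

text \<open>The affine bound at t = 2 \<epsilon> reads 4 \<epsilon> d \<le> 4 \<epsilon>^2, so d
  lies below every positive scalar; the same applies to -d.\<close>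

lemma square_eq_0_imp_eq_0:
  fixes c :: "'a::universally_complete_f_algebra"
  assumes "c * c = 0"
  shows "c = 0"
proof -
  have *: "d \<le> 0" if "d * d = 0" for d :: 'a
  proof (rule archimedean)
    fix \<epsilon> :: real assume e: "0 < \<epsilon>"
    have "(2 * (2 * \<epsilon>)) *\<^sub>R d \<le> ((2 * \<epsilon>) * (2 * \<epsilon>)) *\<^sub>R (1::'a)"
      using square_ge_affine[of "2 * \<epsilon>" d] that by simp
    then have "(1 / (4 * \<epsilon>)) *\<^sub>R ((2 * (2 * \<epsilon>)) *\<^sub>R d) \<le> (1 / (4 * \<epsilon>)) *\<^sub>R (((2 * \<epsilon>) * (2 * \<epsilon>)) *\<^sub>R (1::'a))"
      using e by (intro scaleR_left_mono) auto
    then show "d \<le> \<epsilon> *\<^sub>R 1" using e by simp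
  qed
  show ?thesis using *[of c] *[of "- c"] assms by (intro order.antisym) simp_all
qed

section \<open>Products and lattice operations, order continuity of multiplication, square
  roots\<close>

text \<open>Subtracting the infimum makes x and y disjoint. Disjointness survives multiplication of
  both by z, and translating back gives the identity.\<close>

lemma mult_inf_distrib_left:
  fixes x y z :: "'a::universally_complete_f_algebra"
  assumes z: "0 \<le> z"
  shows "z * inf x y = inf (z * x) (z * y)"
proof -
  let ?i = "inf x y"
  have "inf (- ?i + x) (- ?i + y) = - ?i + ?i" by (simp only: add_inf_distrib_left)
  then have "inf (x - ?i) (y - ?i) = 0" by (simp only: uminus_add_conv_diff diff_self)
  then have "inf (y - ?i) (z * (x - ?i)) = 0"
    using f_algebra_left[OF _ z] by (simp only: inf_commute)
  then have "inf (z * (x - ?i)) (z * (y - ?i)) = 0"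
    using f_algebra_left[OF _ z] by (simp only: inf_commute)
  then have "z * ?i + inf (z * (x - ?i)) (z * (y - ?i)) = z * ?i" by (simp only: add_0_right)
  then have "inf (z * ?i + z * (x - ?i)) (z * ?i + z * (y - ?i)) = z * ?i"
    by (simp only: add_inf_distrib_left)
  then show ?thesis
    by (simp only: distrib_left[symmetric] add_diff_cancel_left' add_diff_eq)
qed

lemma mult_sup_distrib_left:
  fixes x y z :: "'a::universally_complete_f_algebra"
  assumes z: "0 \<le> z"
  shows "z * sup x y = sup (z * x) (z * y)"
  using mult_inf_distrib_left[OF z, of "- x" "- y"]
  by (simp only: sup_eq_neg_inf mult_minus_right)

lemma mult_abs_nonneg:
  fixes x z :: "'a::universally_complete_f_algebra"
  assumes "0 \<le> z"
  shows "z * \<bar>x\<bar> = \<bar>z * x\<bar>"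
  using mult_sup_distrib_left[OF assms, of x "- x"] by (simp add: abs_lattice)

lemma mult_pprt_nonneg:
  fixes x z :: "'a::universally_complete_f_algebra"
  assumes "0 \<le> z"
  shows "z * pprt x = pprt (z * x)"
  using mult_sup_distrib_left[OF assms, of x 0] by (simp add: pprt_def)

lemma square_mono:
  fixes x y :: "'a::universally_complete_f_algebra"
  assumes "\<bar>x\<bar> \<le> \<bar>y\<bar>"
  shows "x * x \<le> y * y"
  using mult_mono[OF assms assms] by (simp add: abs_mult_abs_self)

lemma square_add_le:
  fixes x y :: "'a::universally_complete_f_algebra"
  shows "(x + y) * (x + y) \<le> 2 *\<^sub>R (x * x) + 2 *\<^sub>R (y * y)"
proof -
  have "0 \<le> (x - y) * (x - y)" by (rule square_nonneg)
  then have "(x + y) * (x + y) \<le> (x + y) * (x + y) + (x - y) * (x - y)" by simp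
  also have "\<dots> = 2 *\<^sub>R (x * x) + 2 *\<^sub>R (y * y)"
    by (simp add: algebra_simps scaleR_2)
  finally show ?thesis .
qed

lemma abs_mult_le_squares:
  fixes x y :: "'a::universally_complete_f_algebra"
  shows "\<bar>x * y\<bar> \<le> x * x + y * y"
proof -
  have *: "u * v \<le> u * u + v * v" if "0 \<le> u" "0 \<le> v" for u v :: 'a
  proof -
    have "0 \<le> (u - v) * (u - v)" by (rule square_nonneg)
    then have "u * v + u * v \<le> u * u + v * v"
      by (simp add: algebra_simps mult_commute[of v u])
    moreover have "0 \<le> u * v" using that by simp
    then have "u * v \<le> u * v + u * v" by simp
    ultimately show ?thesis by (rule order_trans[rotated])
  qed
  have "\<bar>x * y\<bar> \<le> \<bar>x\<bar> * \<bar>y\<bar>" by (rule abs_le_mult)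
  also have "\<dots> \<le> \<bar>x\<bar> * \<bar>x\<bar> + \<bar>y\<bar> * \<bar>y\<bar>" by (rule *) simp_all
  finally show ?thesis by (simp add: abs_mult_abs_self)
qed

lemma diff_inf_eq_pprt:
  fixes a b :: "'a::lattice_ab_group_add"
  shows "a - inf a b = pprt (a - b)"
  by (simp add: pprt_def add_sup_distrib_left sup_commute)

text \<open>The affine bound at t = r, divided by r, reads 2 z - r \<le> z^2 / r, and z - r is at
  most the left side. This controls what truncation at r cuts off from z.\<close>

lemma scaled_pprt_le_square:
  fixes z :: "'a::universally_complete_f_algebra"
  assumes r: "0 < r" and z: "0 \<le> z"
  shows "pprt (z - r *\<^sub>R 1) \<le> (1 / r) *\<^sub>R (z * z)"
proof -
  have "(2 * r) *\<^sub>R z - (r * r) *\<^sub>R 1 \<le> z * z" by (rule square_ge_affine)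
  then have "(1 / r) *\<^sub>R ((2 * r) *\<^sub>R z - (r * r) *\<^sub>R 1) \<le> (1 / r) *\<^sub>R (z * z)"
    using r by (intro scaleR_left_mono) auto
  then have "2 *\<^sub>R z - r *\<^sub>R 1 \<le> (1 / r) *\<^sub>R (z * z)"
    using r by (simp add: scaleR_diff_right)
  moreover have "z - r *\<^sub>R 1 \<le> 2 *\<^sub>R z - r *\<^sub>R 1"
    using z by (simp add: scaleR_2)
  ultimately have "z - r *\<^sub>R 1 \<le> (1 / r) *\<^sub>R (z * z)" by (rule order_trans[rotated])
  moreover have "0 \<le> (1 / r) *\<^sub>R (z * z)"
    using r by (intro scaleR_nonneg_nonneg square_nonneg) auto
  ultimately show ?thesis by (simp add: pprt_def)
qed

lemma scaled_pprt_le_square_nat: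
  fixes z :: "'a::universally_complete_f_algebra"
  assumes "0 < n" and "0 \<le> z"
  shows "z - inf z (real n *\<^sub>R 1) \<le> (1 / real n) *\<^sub>R (z * z)"
  using scaled_pprt_le_square[of "real n" z] assms by (simp only: diff_inf_eq_pprt of_nat_0_less_iff)

text \<open>Order continuity of multiplication by a. As a may be unbounded, it is split into its
  truncation at n, which multiplies the gap s - d by at most n, and a tail of size a^2 / n.\<close>

lemma mult_cSup_le:
  fixes a w :: "'a::universally_complete_f_algebra"
  assumes a: "0 \<le> a" and D: "D \<noteq> {}" "bdd_above D"
    and w: "\<And>d. d \<in> D \<Longrightarrow> a * d \<le> w"
  shows "a * Sup D \<le> w"
proof -
  let ?s = "Sup D"
  obtain d0 where d0: "d0 \<in> D" using D by auto
  have nn: "0 \<le> ?s - d" if "d \<in> D" for d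
    using cSup_upper[OF that D(2)] by simp
  have "a * ?s - w \<le> 0"
  proof (rule archimedean_nat)
    fix n :: nat assume n: "0 < n"
    define y where "y = a * ?s - w"
    define c where "c = (1 / real n) *\<^sub>R ((a * a) * (?s - d0))"
    have "d \<le> ?s - (1 / real n) *\<^sub>R (y - c)" if d: "d \<in> D" for d
    proof -
      \<comment> \<open>The tail needs a bound independent of d, so the gap at d is cut down to the
        gap at the fixed element d0; this takes the place of directedness of D.\<close>
      let ?i = "inf (?s - d) (?s - d0)"
      have i: "0 \<le> ?i" using nn d d0 by simp
      have "y \<le> a * (?s - d)" "y \<le> a * (?s - d0)"
        using w[OF d] w[OF d0] by (simp_all add: y_def right_diff_distrib diff_left_mono)
      then have "y \<le> a * ?i" by (simp only: mult_inf_distrib_left[OF a] le_inf_iff simp_thms)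
      also have "a * ?i = inf a (real n *\<^sub>R 1) * ?i + (a - inf a (real n *\<^sub>R 1)) * ?i"
        by (simp only: distrib_right[symmetric] add_diff_eq add_diff_cancel_left')
      also have "\<dots> \<le> (real n *\<^sub>R 1) * (?s - d) + ((1 / real n) *\<^sub>R (a * a)) * (?s - d0)"
        using scaled_pprt_le_square_nat[OF n a] a i n nn[OF d]
        by (intro add_mono mult_mono scaleR_nonneg_nonneg square_nonneg one_nonneg) simp_all
      finally have "y - c \<le> real n *\<^sub>R (?s - d)" by (simp add: c_def diff_le_eq)
      then have "(1 / real n) *\<^sub>R (y - c) \<le> (1 / real n) *\<^sub>R (real n *\<^sub>R (?s - d))"
        by (intro scaleR_left_mono) auto
      then show ?thesis using n by (simp add: le_diff_eq add.commute)
    qed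
    then have "?s \<le> ?s - (1 / real n) *\<^sub>R (y - c)" using D(1) by (intro cSup_least)
    then have "real n *\<^sub>R ((1 / real n) *\<^sub>R (y - c)) \<le> real n *\<^sub>R 0"
      by (intro scaleR_left_mono) auto
    then show "y \<le> c" using n by simp
  next
    show "0 \<le> (a * a) * (?s - d0)"
      using nn[OF d0] by (intro mult_nonneg_nonneg square_nonneg)
  qed
  then show ?thesis by simp
qed

text \<open>The product of r + s and (r - s)^+ is (r^2 - s^2)^+, hence 0. As (r - s)^+ \<le> r + s,
  the square of (r - s)^+ is 0 as well; no division by r + s occurs.\<close>

lemma square_le_square_imp_le:
  fixes r s :: "'a::universally_complete_f_algebra"
  assumes "0 \<le> r" "0 \<le> s" "r * r \<le> s * s"
  shows "r \<le> s"
proof -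
  have "(r + s) * pprt (r - s) = pprt ((r + s) * (r - s))"
    using assms by (intro mult_pprt_nonneg) simp
  also have "(r + s) * (r - s) = r * r - s * s"
    by (simp add: algebra_simps mult_commute[of s r])
  also have "pprt (r * r - s * s) = 0" using assms by simp
  finally have 0: "(r + s) * pprt (r - s) = 0" .
  have "pprt (r - s) \<le> r + s"
  proof -
    have "r - s \<le> r" "r \<le> r + s" using assms by (simp_all add: diff_le_eq)
    then have "r - s \<le> r + s" by (rule order_trans)
    then show ?thesis using assms by (simp add: pprt_def)
  qed
  then have "pprt (r - s) * pprt (r - s) \<le> (r + s) * pprt (r - s)"
    by (rule mult_right_mono) simp
  then have "pprt (r - s) * pprt (r - s) = 0"
    using 0 square_nonneg[of "pprt (r - s)"] by (intro order.antisym) simp_all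
  then have "pprt (r - s) = 0" by (rule square_eq_0_imp_eq_0)
  then show ?thesis by (simp flip: le_zero_iff_zero_pprt)
qed

text \<open>The upper bound for \<open>r * r\<close> is the scalar formula for squares; were \<open>r * r\<close> too small
  somewhere, \<open>r\<close> could be enlarged by the element \<open>u\<close> of the proof without its square exceeding \<open>b\<close>,
  contradicting the inequality of arithmetic and geometric means.\<close>

lemma square_root_Inf:
  fixes b :: "'a::universally_complete_f_algebra"
  defines "M \<equiv> (\<lambda>t::real. (1 / (2 * t)) *\<^sub>R b + (t / 2) *\<^sub>R 1) ` {0<..}"
  assumes b: "0 \<le> b"
  shows "bdd_below M" "0 \<le> Inf M" "Inf M * Inf M = b"
proof -
  have M: "M \<noteq> {}" by (auto simp: M_def)
  \<comment> \<open>The affine bound 2 t y - t^2 \<le> y^2 \<le> b, divided by 2 t. Taking y = 0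
    shows that M is bounded below and \<open>Inf M\<close> is positive.\<close>
  have lower: "y \<le> m" if y: "y * y \<le> b" and m: "m \<in> M" for y m
  proof -
    obtain t :: real where t: "0 < t" "m = (1 / (2 * t)) *\<^sub>R b + (t / 2) *\<^sub>R 1"
      using m unfolding M_def by auto
    have "(2 * t) *\<^sub>R y - (t * t) *\<^sub>R 1 \<le> b"
      using square_ge_affine[of t y] y by (rule order_trans)
    then have "(1 / (2 * t)) *\<^sub>R ((2 * t) *\<^sub>R y - (t * t) *\<^sub>R 1) \<le> (1 / (2 * t)) *\<^sub>R b"
      using t by (intro scaleR_left_mono) auto
    then show ?thesis using t by (simp add: scaleR_diff_right diff_le_eq)
  qed
  have bdd: "bdd_below M" using lower[of 0] b by (intro bdd_belowI[of _ 0]) simp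
  let ?r = "Inf M"
  have r0: "0 \<le> ?r" using lower[of 0] b M by (intro cInf_greatest) simp_all
  have le: "?r * ?r \<le> b"
  proof (rule square_le_if_affine_le)
    fix t :: real
    show "(2 * t) *\<^sub>R ?r - (t * t) *\<^sub>R 1 \<le> b"
    proof (cases "0 < t")
      case True
      have "?r \<le> (1 / (2 * t)) *\<^sub>R b + (t / 2) *\<^sub>R 1"
        using True by (intro cInf_lower bdd) (auto simp: M_def)
      then have "(2 * t) *\<^sub>R ?r \<le> (2 * t) *\<^sub>R ((1 / (2 * t)) *\<^sub>R b + (t / 2) *\<^sub>R 1)"
        using True by (intro scaleR_left_mono) auto
      then show ?thesis using True by (simp add: scaleR_add_right diff_le_eq)
    next
      case False
      then have "(2 * t) *\<^sub>R ?r \<le> 0" using r0 by (intro scaleR_nonpos_nonneg) auto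
      moreover have "0 \<le> (t * t) *\<^sub>R (1::'a)" by (intro scaleR_one_nonneg) simp
      ultimately have "(2 * t) *\<^sub>R ?r - (t * t) *\<^sub>R 1 \<le> 0" by (meson diff_le_0_iff_le order_trans)
      then show ?thesis using b by (rule order_trans)
    qed
  qed
  \<comment> \<open>The deficit of r^2, truncated at 1 so that the quadratic term u * u below is at
    most u.\<close>
  define w where "w = inf (b - ?r * ?r) 1"
  have w: "0 \<le> w" "w \<le> 1" "w \<le> b - ?r * ?r" using le one_nonneg by (simp_all add: w_def)
  have disj: "inf w (pprt (real n *\<^sub>R 1 - 2 *\<^sub>R ?r)) = 0" for n
  proof -
    let ?g = "real n *\<^sub>R 1 - 2 *\<^sub>R ?r"
    define v where "v = inf w (pprt ?g)"
    have v: "0 \<le> v" "v \<le> w" "v \<le> pprt ?g" using w by (simp_all add: v_def)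
    \<comment> \<open>On v one has 2 r \<le> n, so the factor 1 / (n + 1) gives 2 r u + u^2 \<le> (n
      + 1) u = v, which still fits into b - r^2.\<close>
    define u where "u = (1 / (real n + 1)) *\<^sub>R v"
    have u: "0 \<le> u" "u \<le> v"
    proof -
      show "0 \<le> u" unfolding u_def using v by (intro scaleR_nonneg_nonneg) auto
      have "u \<le> 1 *\<^sub>R v" unfolding u_def using v(1) by (intro scaleR_right_mono) auto
      then show "u \<le> v" by simp
    qed
    have "inf v (pprt (- ?g)) = 0"
      by (rule disjoint_mono[OF inf_pprt_pprt_minus[of ?g] v(1,3) zero_le_pprt order.refl])
    then have 0: "pprt (- ?g) * v = 0"
      by (intro disjoint_mult_eq_0) (simp only: inf_commute)
    have rv: "(2 *\<^sub>R ?r) * v \<le> real n *\<^sub>R v"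
    proof -
      have "- ?g \<le> pprt (- ?g)" unfolding pprt_def by (rule sup_ge1)
      then have "(- ?g) * v \<le> pprt (- ?g) * v" using v(1) by (rule mult_right_mono)
      then have "(- ?g) * v \<le> 0" using 0 by simp
      then show ?thesis by (simp add: left_diff_distrib)
    qed
    have uu: "u * u \<le> u"
    proof -
      have "u \<le> 1" using u v w by (meson order_trans)
      then have "u * u \<le> 1 * u" using u(1) by (rule mult_right_mono)
      then show ?thesis by simp
    qed
    have "(?r + u) * (?r + u) = ?r * ?r + (2 *\<^sub>R ?r) * u + u * u"
      by (simp add: distrib_left distrib_right mult_commute[of u ?r] scaleR_2 add.assoc)
    also have "(2 *\<^sub>R ?r) * u = (1 / (real n + 1)) *\<^sub>R ((2 *\<^sub>R ?r) * v)"
      by (simp only: u_def mult_scaleR_right)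
    also have "?r * ?r + (1 / (real n + 1)) *\<^sub>R ((2 *\<^sub>R ?r) * v) + u * u
      \<le> ?r * ?r + (1 / (real n + 1)) *\<^sub>R (real n *\<^sub>R v) + u"
      using rv uu by (intro add_mono scaleR_left_mono) auto
    also have "\<dots> = ?r * ?r + ((1 / (real n + 1)) * real n + 1 / (real n + 1)) *\<^sub>R v"
      by (simp only: u_def scaleR_add_left scaleR_scaleR add.assoc)
    also have "(1 / (real n + 1)) * real n + 1 / (real n + 1) = 1"
      by (simp add: field_simps)
    also have "?r * ?r + 1 *\<^sub>R v \<le> ?r * ?r + w"
      using v by simp
    also have "\<dots> \<le> ?r * ?r + (b - ?r * ?r)" using w(3) by (rule add_left_mono)
    also have "\<dots> = b" by simp
    finally have sq: "(?r + u) * (?r + u) \<le> b" .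
    have "?r + u \<le> ?r" by (rule cInf_greatest[OF M]) (rule lower[OF sq])
    then have "u \<le> 0" by simp
    then have "u = 0" using u(1) by (rule order.antisym)
    then show ?thesis by (simp add: u_def flip: v_def)
  qed
  \<comment> \<open>Since w is disjoint from (n - 2 r)^+ and w \<le> 1, the multiple n w stays below
    2 r for every n.\<close>
  have "w \<le> 0"
  proof (rule archimedean_nat)
    fix n :: nat assume n: "0 < n"
    have "real n *\<^sub>R w = inf (real n *\<^sub>R w) (real n *\<^sub>R 1)"
      using w by (simp add: inf_absorb1 scaleR_left_mono)
    also have "\<dots> \<le> inf (real n *\<^sub>R w) (pprt (real n *\<^sub>R 1 - 2 *\<^sub>R ?r) + 2 *\<^sub>R ?r)"
    proof (rule inf_mono[OF order.refl])
      have "real n *\<^sub>R 1 - 2 *\<^sub>R ?r \<le> pprt (real n *\<^sub>R 1 - 2 *\<^sub>R ?r)"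
        unfolding pprt_def by (rule sup_ge1)
      then show "real n *\<^sub>R 1 \<le> pprt (real n *\<^sub>R 1 - 2 *\<^sub>R ?r) + 2 *\<^sub>R ?r"
        by (simp only: diff_le_eq)
    qed
    also have "\<dots> \<le> inf (real n *\<^sub>R w) (pprt (real n *\<^sub>R 1 - 2 *\<^sub>R ?r)) + inf (real n *\<^sub>R w) (2 *\<^sub>R ?r)"
      using w r0 by (intro inf_add_le scaleR_nonneg_nonneg) simp_all
    also have "inf (real n *\<^sub>R w) (pprt (real n *\<^sub>R 1 - 2 *\<^sub>R ?r)) = 0"
      by (intro disjoint_scaleR disj) simp
    also have "0 + inf (real n *\<^sub>R w) (2 *\<^sub>R ?r) \<le> 2 *\<^sub>R ?r" by simp
    finally have "(1 / real n) *\<^sub>R (real n *\<^sub>R w) \<le> (1 / real n) *\<^sub>R (2 *\<^sub>R ?r)"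
      by (intro scaleR_left_mono) auto
    then show "w \<le> (1 / real n) *\<^sub>R (2 *\<^sub>R ?r)" using n by simp
  qed (use r0 in \<open>simp add: scaleR_nonneg_nonneg\<close>)
  then have "w = 0" using w(1) by (rule order.antisym)
  then have "inf (b - ?r * ?r) 1 = 0" by (simp only: w_def)
  then have "b - ?r * ?r = 0" by (rule disjoint_one)
  then show "?r * ?r = b" by simp
  show "bdd_below M" by (rule bdd)
  show "0 \<le> ?r" by (rule r0)
qed

section \<open>The extended conditional expectation\<close>

text \<open>The infinite distributive law, by the translation of the binary case: adding
  \<open>inf x s - s\<close> carries every d in D below both x and d.\<close>

lemma inf_lub_le:
  fixes x m :: "'a::lattice_ab_group_add"
  assumes "lub_in (\<le>) UNIV D s" and le: "\<And>d. d \<in> D \<Longrightarrow> inf x d \<le> m"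
  shows "inf x s \<le> m"
proof -
  have s: "\<And>d. d \<in> D \<Longrightarrow> d \<le> s" "\<And>u. (\<And>d. d \<in> D \<Longrightarrow> d \<le> u) \<Longrightarrow> s \<le> u"
    using assms(1) by (auto simp: lub_in_def)
  have "d \<le> m - (inf x s - s)" if d: "d \<in> D" for d
  proof -
    have "d + (inf x s - s) \<le> inf x d"
    proof (rule inf_greatest)
      have "d + (inf x s - s) \<le> s + (inf x s - s)" using s(1)[OF d] by (rule add_right_mono)
      also have "\<dots> = inf x s" by (simp only: add_diff_eq add_diff_cancel_left')
      also have "\<dots> \<le> x" by (rule inf_le1)
      finally show "d + (inf x s - s) \<le> x" .
      have "d + (inf x s - s) \<le> d + 0"
        by (rule add_left_mono) (simp only: diff_le_0_iff_le inf_le2)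
      then show "d + (inf x s - s) \<le> d" by (simp only: add_0_right)
    qed
    then have "d + (inf x s - s) \<le> m" using le[OF d] by (rule order_trans)
    then show ?thesis by (simp only: le_diff_eq)
  qed
  then have "s \<le> m - (inf x s - s)" by (rule s(2))
  then have "s + (inf x s - s) \<le> m" by (simp only: le_diff_eq)
  then show ?thesis by (simp only: add_diff_eq add_diff_cancel_left')
qed

lemma pprt_le_abs: "pprt x \<le> \<bar>x :: 'a::lattice_ab_group_add_abs\<bar>"
  by (simp add: pprt_def abs_ge_self)

lemma pprt_eq_abs: "pprt x = (1 / 2) *\<^sub>R (x + \<bar>x\<bar>)" for x :: "'a::universally_complete_f_algebra"
proof -
  have "x + \<bar>x\<bar> = (pprt x - pprt (- x)) + (pprt x + pprt (- x))"
    by (simp only: pprt_minus_pprt abs_eq_pprt_add)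
  also have "\<dots> = 2 *\<^sub>R pprt x" by (simp add: scaleR_2)
  finally show ?thesis by simp
qed

lemma sup_eq_pprt_add: "sup x y = pprt (x - y) + y" for x y :: "'a::lattice_ab_group_add"
  by (simp add: pprt_def add_sup_distrib_right)

context riesz_conditional_expectation
begin

section \<open>T on E, and the position of E in E^u\<close>

lemma E_subspace: "subspace E"
  using E_riesz by (simp add: riesz_subspace_def)

lemmas E_0 = subspace_0[OF E_subspace]
  and E_add = subspace_add[OF E_subspace]
  and E_diff = subspace_diff[OF E_subspace]
  and E_scaleR = subspace_scale[OF E_subspace]

lemma E_sup: "x \<in> E \<Longrightarrow> y \<in> E \<Longrightarrow> sup x y \<in> E"
  using E_riesz by (simp add: riesz_subspace_def)

lemma E_one: "1 \<in> E"
  using E_unit by (simp add: weak_order_unit_def)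

lemma T_in: "x \<in> E \<Longrightarrow> T x \<in> E"
  and T_add: "x \<in> E \<Longrightarrow> y \<in> E \<Longrightarrow> T (x + y) = T x + T y"
  and T_scaleR: "x \<in> E \<Longrightarrow> T (c *\<^sub>R x) = c *\<^sub>R T x"
  and T_nonneg: "x \<in> E \<Longrightarrow> 0 \<le> x \<Longrightarrow> 0 \<le> T x"
  and T_idem: "x \<in> E \<Longrightarrow> T (T x) = T x"
  using T_cond_exp by (auto simp: conditional_expectation_on_def positive_linear_on_def)

lemma T_diff: "x \<in> E \<Longrightarrow> y \<in> E \<Longrightarrow> T (x - y) = T x - T y"
  using T_add[of "x - y" y] E_diff[of x y] by (simp add: eq_diff_eq)

lemma T_mono: "x \<in> E \<Longrightarrow> y \<in> E \<Longrightarrow> x \<le> y \<Longrightarrow> T x \<le> T y"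
  using T_nonneg[of "y - x"] T_diff[of y x] E_diff[of y x] by simp

lemma E_order_dense:
  assumes "0 < x"
  obtains y where "y \<in> E" "0 < y" "y \<le> x"
  using E_dense assms by (auto simp: order_dense_def)

text \<open>Order continuity is defined through lower bounds in E, whereas here w ranges over E^u.
  If w^+ were not 0, order density would place a nonzero positive y of E below it, a lower bound of
  all \<open>T d\<close>.\<close>

lemma T_order_continuous:
  assumes D: "D \<subseteq> E" "down_directed D" "\<And>d. d \<in> D \<Longrightarrow> 0 \<le> d"
    and inf: "\<And>v. (\<And>d. d \<in> D \<Longrightarrow> v \<le> d) \<Longrightarrow> v \<le> 0"
    and w: "\<And>d. d \<in> D \<Longrightarrow> w \<le> T d"
  shows "w \<le> 0"
proof (rule ccontr)
  assume "\<not> w \<le> 0"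
  then have "pprt w \<noteq> 0" by (simp add: le_zero_iff_zero_pprt)
  then have "0 < pprt w" using zero_le_pprt[of w] by (simp add: order.strict_iff_order)
  then obtain y where y: "y \<in> E" "0 < y" "y \<le> pprt w" by (rule E_order_dense)
  have "glb_in (\<le>) E D 0"
    using D(3) inf E_0 by (auto simp: glb_in_def lub_in_def)
  then have "glb_in (\<le>) E (T ` D) 0"
    using T_cond_exp D by (simp add: conditional_expectation_on_def order_continuous_on_def)
  moreover have "y \<le> T d" if d: "d \<in> D" for d
  proof -
    have "0 \<le> T d" using D d by (intro T_nonneg) auto
    then have "pprt w \<le> T d" using w[OF d] by (simp add: pprt_def)
    then show ?thesis using y(3) by (rule order_trans[rotated])
  qed
  ultimately have "y \<le> 0" using y(1) by (auto simp: glb_in_def lub_in_def)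
  then show False using y(2) by simp
qed

text \<open>The canonical net increasing to f. With it in place of the unspecified nets of
  \<open>ext_value\<close>, the extension at f is a single supremum.\<close>

definition lower_part :: "'a \<Rightarrow> 'a set" where
  "lower_part f = {x \<in> E. 0 \<le> x \<and> x \<le> f}"

lemma zero_in_lower_part: "0 \<le> f \<Longrightarrow> 0 \<in> lower_part f"
  by (simp add: lower_part_def E_0)

text \<open>If f exceeded the supremum s of its lower part, there would be y > 0 in E below f - s.
  Adding y maps the lower part into itself, so s could be lowered by y.\<close>

lemma le_if_lower_part_le:
  assumes f: "0 \<le> f" and h: "\<And>x. x \<in> lower_part f \<Longrightarrow> x \<le> h"
  shows "f \<le> h"
proof -
  let ?s = "Sup (lower_part f)"
  have ne: "lower_part f \<noteq> {}" using zero_in_lower_part[OF f] by auto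
  have bdd: "bdd_above (lower_part f)" by (auto simp: lower_part_def intro!: bdd_aboveI[of _ f])
  have s: "?s \<le> f" using ne by (rule cSup_least) (simp add: lower_part_def)
  have "f = ?s"
  proof (rule ccontr)
    assume "f \<noteq> ?s"
    then have "0 < f - ?s" using s by (simp add: order.strict_iff_order)
    then obtain y where y: "y \<in> E" "0 < y" "y \<le> f - ?s" by (rule E_order_dense)
    have "x \<le> ?s - y" if x: "x \<in> lower_part f" for x
    proof -
      have "x + y \<le> ?s + (f - ?s)" using cSup_upper[OF x bdd] y(3) by (rule add_mono)
      also have "\<dots> = f" by simp
      finally have "x + y \<in> lower_part f" using x y E_add by (simp add: lower_part_def)
      then have "x + y \<le> ?s" using bdd by (rule cSup_upper)
      then show ?thesis by (simp add: le_diff_eq)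
    qed
    then have "?s \<le> ?s - y" by (intro cSup_least ne)
    then show False using y(2) by simp
  qed
  also have "?s \<le> h" using ne h by (rule cSup_least)
  finally show ?thesis .
qed

text \<open>Dedekind completeness provides a supremum s, relative to E, of the lower part of u. If s
  were not u, a positive y of E below s - u would make s - y a smaller upper bound in E.\<close>

lemma E_ideal:
  assumes x: "x \<in> E" and u: "0 \<le> u" "u \<le> x"
  shows "u \<in> E"
proof -
  have "lower_part u \<subseteq> E \<and> lower_part u \<noteq> {} \<and> (\<exists>v\<in>E. \<forall>d\<in>lower_part u. d \<le> v)"
  proof (intro conjI bexI)
    show "lower_part u \<noteq> {}" using zero_in_lower_part[OF u(1)] by auto
    show "\<forall>d\<in>lower_part u. d \<le> x" using u(2) by (auto simp: lower_part_def)
  qed (use x in \<open>auto simp: lower_part_def\<close>)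
  from E_dedekind[unfolded dedekind_complete_def, rule_format, OF this]
  obtain s where s: "lub_in (\<le>) E (lower_part u) s" ..
  have us: "u \<le> s"
  proof (rule le_if_lower_part_le[OF u(1)])
    show "d \<le> s" if "d \<in> lower_part u" for d using s that by (simp add: lub_in_def)
  qed
  have "u = s"
  proof (rule ccontr)
    assume "u \<noteq> s"
    then have "0 < s - u" using us by (simp add: order.strict_iff_order)
    then obtain y where y: "y \<in> E" "0 < y" "y \<le> s - u" by (rule E_order_dense)
    have "u \<le> s - y" using y(3) by (simp add: le_diff_eq add.commute)
    then have "\<forall>d\<in>lower_part u. d \<le> s - y" by (auto simp: lower_part_def)
    moreover have "s - y \<in> E" using s y(1) by (intro E_diff) (auto simp: lub_in_def)
    ultimately have "s \<le> s - y" using s by (auto simp: lub_in_def)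
    then show False using y(2) by simp
  qed
  then show ?thesis using s by (simp add: lub_in_def)
qed

text \<open>By the infinite distributive law x - \<open>inf x d\<close> decreases to 0 along D, so
  order continuity recovers \<open>T x\<close> from the values at \<open>inf x d\<close>. D may
  leave E: each \<open>inf x d\<close> is still in E, because E is an ideal.\<close>

lemma T_le_of_directed_lub:
  assumes D: "up_directed D" "\<And>d. d \<in> D \<Longrightarrow> 0 \<le> d"
    and f: "lub_in (\<le>) UNIV D f"
    and y: "\<And>d x. d \<in> D \<Longrightarrow> x \<in> lower_part d \<Longrightarrow> T x \<le> y"
    and x: "x \<in> lower_part f"
  shows "T x \<le> y"
proof -
  have xE: "x \<in> E" "0 \<le> x" "x \<le> f" using x by (simp_all add: lower_part_def)
  have inf_low: "inf x d \<in> lower_part d" if "d \<in> D" for d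
    using E_ideal[OF xE(1), of "inf x d"] D(2)[OF that] xE by (simp add: lower_part_def)
  have infE: "inf x d \<in> E" if "d \<in> D" for d using inf_low[OF that] by (simp add: lower_part_def)
  let ?D = "(\<lambda>d. x - inf x d) ` D"
  have "T x - y \<le> 0"
  proof (rule T_order_continuous)
    show "?D \<subseteq> E" using xE infE by (auto simp del: diff_inf_eq_sup intro!: E_diff)
    show "down_directed ?D"
      unfolding down_directed_def
    proof (intro conjI ballI)
      show "?D \<noteq> {}" using D(1) by (simp add: up_directed_def)
      fix p q assume "p \<in> ?D" "q \<in> ?D"
      then obtain d e where de: "d \<in> D" "e \<in> D" "p = x - inf x d" "q = x - inf x e" by blast
      then obtain g where g: "g \<in> D" "d \<le> g" "e \<le> g"
        using D(1) by (auto simp: up_directed_def)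
      have "x - inf x g \<le> p" "x - inf x g \<le> q"
        unfolding de by (rule diff_left_mono[OF inf_mono[OF order.refl]], rule g)+
      then show "\<exists>z\<in>?D. z \<le> p \<and> z \<le> q" using g(1) by blast
    qed
    show "0 \<le> p" if "p \<in> ?D" for p using that by (auto simp del: diff_inf_eq_sup)
    show "v \<le> 0" if v: "\<And>p. p \<in> ?D \<Longrightarrow> v \<le> p" for v
    proof -
      have "inf x d \<le> x - v" if "d \<in> D" for d
      proof -
        have "v \<le> x - inf x d" using v that by blast
        then show ?thesis by (simp only: le_diff_eq add.commute)
      qed
      then have "inf x f \<le> x - v" by (rule inf_lub_le[OF f])
      then show ?thesis using xE by (simp add: inf_absorb1)
    qed
    show "T x - y \<le> T p" if p: "p \<in> ?D" for p
    proof -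
      obtain d where d: "d \<in> D" "p = x - inf x d" using p by blast
      have "T p = T x - T (inf x d)" unfolding d(2) using xE infE d by (intro T_diff)
      then show ?thesis using y[OF d(1) inf_low[OF d(1)]] by (simp add: diff_left_mono)
    qed
  qed
  then show ?thesis by simp
qed

section \<open>The extension of T on the positive cone\<close>

definition pos_domain :: "'a set" where
  "pos_domain = {f. 0 \<le> f \<and> bdd_above (T ` lower_part f)}"

definition T_pos :: "'a \<Rightarrow> 'a" where
  "T_pos f = Sup (T ` lower_part f)"

lemma pos_domain_nonneg: "f \<in> pos_domain \<Longrightarrow> 0 \<le> f"
  by (simp add: pos_domain_def)

lemma T_le_T_pos: "f \<in> pos_domain \<Longrightarrow> x \<in> lower_part f \<Longrightarrow> T x \<le> T_pos f"
  unfolding T_pos_def by (rule cSup_upper) (auto simp: pos_domain_def)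

lemma T_pos_least:
  "f \<in> pos_domain \<Longrightarrow> (\<And>x. x \<in> lower_part f \<Longrightarrow> T x \<le> y) \<Longrightarrow> T_pos f \<le> y"
  unfolding T_pos_def using zero_in_lower_part[of f]
  by (intro cSup_least) (auto simp: pos_domain_def)

lemma pos_domainI:
  assumes "0 \<le> f" "\<And>x. x \<in> lower_part f \<Longrightarrow> T x \<le> y"
  shows "f \<in> pos_domain \<and> T_pos f \<le> y"
proof -
  have "f \<in> pos_domain"
    using assms by (auto simp: pos_domain_def intro!: bdd_aboveI[of _ y])
  then show ?thesis using T_pos_least assms(2) by blast
qed

lemma lower_part_directed:
  assumes "0 \<le> f"
  shows "up_directed (lower_part f)" "lub_in (\<le>) UNIV (lower_part f) f"
proof -
  show "up_directed (lower_part f)"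
    unfolding up_directed_def
  proof (intro conjI ballI)
    show "lower_part f \<noteq> {}" using zero_in_lower_part[OF assms] by auto
    fix x y assume "x \<in> lower_part f" "y \<in> lower_part f"
    then have "sup x y \<in> lower_part f" by (simp add: lower_part_def E_sup le_supI1)
    then show "\<exists>z\<in>lower_part f. x \<le> z \<and> y \<le> z" by (rule bexI[rotated]) simp
  qed
  show "lub_in (\<le>) UNIV (lower_part f) f"
    unfolding lub_in_def using le_if_lower_part_le[OF assms] by (auto simp: lower_part_def)
qed

text \<open>Every admissible net yields the supremum of T over the whole lower part, so the value is
  independent of the net: one inequality is \<open>T_le_of_directed_lub\<close>, the other holds
  because the net lies in the lower part.\<close>

lemma ext_value_iff: "ext_value E T f y \<longleftrightarrow> f \<in> pos_domain \<and> y = T_pos f"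
proof
  assume "ext_value E T f y"
  then obtain D where D: "D \<subseteq> {x\<in>E. 0 \<le> x}" "up_directed D" "lub_in (\<le>) UNIV D f"
      "bdd_above (T ` D)" "y = Sup (T ` D)"
    by (auto simp: ext_value_def)
  obtain d0 where d0: "d0 \<in> D" using D(2) by (auto simp: up_directed_def)
  have f: "d \<le> f" if "d \<in> D" for d using D(3) that by (simp add: lub_in_def)
  have "0 \<le> d0" using D(1) d0 by auto
  then have f0: "0 \<le> f" using f[OF d0] by (rule order_trans)
  have "T x \<le> y" if "x \<in> lower_part f" for x
  proof (rule T_le_of_directed_lub[OF D(2) _ D(3) _ that])
    show "0 \<le> d" if "d \<in> D" for d using D(1) that by auto
    show "T z \<le> y" if "d \<in> D" "z \<in> lower_part d" for d z
    proof -
      have "T z \<le> T d" using that D(1) by (intro T_mono) (auto simp: lower_part_def)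
      also have "T d \<le> y" unfolding D(5) using that D(4) by (intro cSup_upper) auto
      finally show ?thesis .
    qed
  qed
  then have *: "f \<in> pos_domain" "T_pos f \<le> y" using pos_domainI[OF f0] by auto
  have "y \<le> T_pos f" unfolding D(5)
  proof (rule cSup_least)
    show "T ` D \<noteq> {}" using d0 by auto
    fix z assume "z \<in> T ` D"
    then show "z \<le> T_pos f" using D(1) f by (auto intro!: T_le_T_pos[OF *(1)] simp: lower_part_def)
  qed
  with * show "f \<in> pos_domain \<and> y = T_pos f" by (auto intro: order.antisym)
next
  assume f: "f \<in> pos_domain \<and> y = T_pos f"
  then show "ext_value E T f y"
    unfolding ext_value_def
  proof (intro exI[of _ "lower_part f"] conjI)
    show "lower_part f \<subseteq> {x \<in> E. 0 \<le> x}" by (auto simp: lower_part_def)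
  qed (simp_all add: lower_part_directed pos_domain_def T_pos_def)
qed

lemma L1_eq: "L1 E T = {f - g | f g. f \<in> pos_domain \<and> g \<in> pos_domain}"
  by (simp add: L1_def ext_value_iff)

lemma pos_domain_down:
  assumes "f \<in> pos_domain" "0 \<le> g" "g \<le> f"
  shows "g \<in> pos_domain \<and> T_pos g \<le> T_pos f"
proof (rule pos_domainI[OF assms(2)])
  fix x assume "x \<in> lower_part g"
  then have "x \<in> lower_part f" using assms(3) by (auto simp: lower_part_def)
  then show "T x \<le> T_pos f" by (rule T_le_T_pos[OF assms(1)])
qed

text \<open>Riesz decomposition: an x of E below f + g is the sum of \<open>inf x f\<close> and a
  rest below g. The reverse inequality takes the suprema over the two lower parts one after the
  other.\<close>

lemma T_pos_add:
  assumes f: "f \<in> pos_domain" and g: "g \<in> pos_domain"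
  shows "f + g \<in> pos_domain" "T_pos (f + g) = T_pos f + T_pos g"
proof -
  have nn: "0 \<le> f" "0 \<le> g" using f g by (simp_all add: pos_domain_nonneg)
  have "f + g \<in> pos_domain \<and> T_pos (f + g) \<le> T_pos f + T_pos g"
  proof (rule pos_domainI)
    show "0 \<le> f + g" using nn by simp
    fix x assume "x \<in> lower_part (f + g)"
    then have x: "x \<in> E" "0 \<le> x" "x \<le> f + g" by (simp_all add: lower_part_def)
    have i: "inf x f \<in> lower_part f"
      using E_ideal[OF x(1), of "inf x f"] x nn by (simp add: lower_part_def)
    then have iE: "inf x f \<in> E" by (simp add: lower_part_def)
    have "x - g \<le> inf x f" using x nn by (simp add: diff_le_eq)
    then have "x - inf x f \<le> g" by (simp only: diff_le_eq add.commute)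
    then have d: "x - inf x f \<in> lower_part g"
      using E_diff[OF x(1) iE] by (simp add: lower_part_def del: diff_inf_eq_sup)
    have "T x = T (inf x f) + T (x - inf x f)"
      using T_diff[OF x(1) iE] by (simp del: diff_inf_eq_sup)
    then show "T x \<le> T_pos f + T_pos g"
      using T_le_T_pos[OF f i] T_le_T_pos[OF g d] by (simp only: add_mono)
  qed
  then have fg: "f + g \<in> pos_domain" and le: "T_pos (f + g) \<le> T_pos f + T_pos g" by simp_all
  show "f + g \<in> pos_domain" by (rule fg)
  have "T_pos f \<le> T_pos (f + g) - T_pos g"
  proof (rule T_pos_least[OF f])
    fix x assume x: "x \<in> lower_part f"
    have "T_pos g \<le> T_pos (f + g) - T x"
    proof (rule T_pos_least[OF g])
      fix y assume y: "y \<in> lower_part g"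
      have "T (x + y) \<le> T_pos (f + g)"
        using x y by (intro T_le_T_pos[OF fg]) (auto simp: lower_part_def E_add intro!: add_mono)
      then show "T y \<le> T_pos (f + g) - T x"
        using x y T_add[of x y] by (simp add: lower_part_def le_diff_eq add.commute)
    qed
    then show "T x \<le> T_pos (f + g) - T_pos g" by (simp add: le_diff_eq add.commute)
  qed
  then have "T_pos f + T_pos g \<le> T_pos (f + g)" by (simp add: le_diff_eq)
  with le show "T_pos (f + g) = T_pos f + T_pos g" by (rule order.antisym)
qed

lemma T_pos_scaleR_le:
  assumes f: "f \<in> pos_domain" and r: "0 < r"
  shows "r *\<^sub>R f \<in> pos_domain \<and> T_pos (r *\<^sub>R f) \<le> r *\<^sub>R T_pos f"
proof (rule pos_domainI)
  show "0 \<le> r *\<^sub>R f" using f r by (intro scaleR_nonneg_nonneg pos_domain_nonneg) auto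
  fix x assume "x \<in> lower_part (r *\<^sub>R f)"
  then have x: "x \<in> E" "0 \<le> x" "x \<le> r *\<^sub>R f" by (simp_all add: lower_part_def)
  have "(1 / r) *\<^sub>R x \<le> (1 / r) *\<^sub>R (r *\<^sub>R f)" using x(3) r by (intro scaleR_left_mono) auto
  then have "(1 / r) *\<^sub>R x \<in> lower_part f"
    using x r by (simp add: lower_part_def E_scaleR scaleR_nonneg_nonneg)
  then have "T ((1 / r) *\<^sub>R x) \<le> T_pos f" by (rule T_le_T_pos[OF f])
  then have "r *\<^sub>R T ((1 / r) *\<^sub>R x) \<le> r *\<^sub>R T_pos f" using r by (intro scaleR_left_mono) auto
  then show "T x \<le> r *\<^sub>R T_pos f" using x(1) r by (simp add: T_scaleR)
qed

lemma zero_pos_domain: "0 \<in> pos_domain" "T_pos 0 = 0"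
proof -
  have low: "lower_part 0 = {0}" using E_0 by (auto simp: lower_part_def intro: order.antisym)
  have "T 0 = 0" using T_scaleR[OF E_0, of 0] by simp
  then show "0 \<in> pos_domain" "T_pos 0 = 0" by (simp_all add: pos_domain_def T_pos_def low)
qed

lemma T_pos_scaleR:
  assumes f: "f \<in> pos_domain" and r: "0 \<le> r"
  shows "r *\<^sub>R f \<in> pos_domain" "T_pos (r *\<^sub>R f) = r *\<^sub>R T_pos f"
proof -
  have "r *\<^sub>R f \<in> pos_domain \<and> T_pos (r *\<^sub>R f) = r *\<^sub>R T_pos f"
  proof (cases "r = 0")
    case True
    then show ?thesis by (simp add: zero_pos_domain)
  next
    case False
    then have r: "0 < r" using r by simp
    have *: "r *\<^sub>R f \<in> pos_domain" "T_pos (r *\<^sub>R f) \<le> r *\<^sub>R T_pos f"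
      using T_pos_scaleR_le[OF f r] by auto
    have "T_pos ((1 / r) *\<^sub>R (r *\<^sub>R f)) \<le> (1 / r) *\<^sub>R T_pos (r *\<^sub>R f)"
      using T_pos_scaleR_le[OF *(1), of "1 / r"] r by auto
    then have "r *\<^sub>R T_pos ((1 / r) *\<^sub>R (r *\<^sub>R f)) \<le> r *\<^sub>R ((1 / r) *\<^sub>R T_pos (r *\<^sub>R f))"
      using r by (intro scaleR_left_mono) auto
    then have "r *\<^sub>R T_pos f \<le> T_pos (r *\<^sub>R f)" using r by simp
    then show ?thesis using * by (auto intro: order.antisym)
  qed
  then show "r *\<^sub>R f \<in> pos_domain" "T_pos (r *\<^sub>R f) = r *\<^sub>R T_pos f" by simp_all
qed

text \<open>Monotone convergence for the extension, along nets in its own domain rather than in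
  E.\<close>

lemma T_pos_directed_lub:
  assumes D: "up_directed D" "D \<subseteq> pos_domain" and f: "lub_in (\<le>) UNIV D f"
    and y: "\<And>d. d \<in> D \<Longrightarrow> T_pos d \<le> y"
  shows "f \<in> pos_domain" "T_pos f \<le> y"
proof -
  have nn: "0 \<le> d" if "d \<in> D" for d using D(2) that by (auto intro: pos_domain_nonneg)
  obtain d0 where d0: "d0 \<in> D" using D(1) by (auto simp: up_directed_def)
  have "d0 \<le> f" using f d0 by (simp add: lub_in_def)
  with nn[OF d0] have f0: "0 \<le> f" by (rule order_trans)
  have "T x \<le> y" if x: "x \<in> lower_part f" for x
  proof (rule T_le_of_directed_lub[OF D(1) nn f _ x])
    fix d z assume "d \<in> D" "z \<in> lower_part d"
    then show "T z \<le> y" using D(2) T_le_T_pos[of d z] y[of d] by (meson order_trans subsetD)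
  qed
  then have "f \<in> pos_domain \<and> T_pos f \<le> y" by (rule pos_domainI[OF f0])
  then show "f \<in> pos_domain" "T_pos f \<le> y" by simp_all
qed

text \<open>The elements \<open>T x\<close> form a net in E that increases to \<open>T_pos f\<close>
  and is fixed by T, so it is an admissible net for \<open>T_pos f\<close>.\<close>

lemma T_pos_idem:
  assumes f: "f \<in> pos_domain"
  shows "T_pos f \<in> pos_domain" "T_pos (T_pos f) = T_pos f"
proof -
  let ?D = "T ` lower_part f"
  have f0: "0 \<le> f" and bdd: "bdd_above ?D" using f by (simp_all add: pos_domain_def)
  have ne: "?D \<noteq> {}" using zero_in_lower_part[OF f0] by auto
  have TT: "T ` ?D = ?D"
    by (auto simp: image_image lower_part_def T_idem intro!: image_cong)
  have "ext_value E T (T_pos f) (T_pos f)"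
    unfolding ext_value_def
  proof (intro exI[of _ ?D] conjI)
    show "?D \<subseteq> {x \<in> E. 0 \<le> x}" by (auto simp: lower_part_def T_in T_nonneg)
    show "up_directed ?D"
      unfolding up_directed_def
    proof (intro conjI ballI ne)
      fix p q assume "p \<in> ?D" "q \<in> ?D"
      then obtain x y where xy: "x \<in> lower_part f" "y \<in> lower_part f" "p = T x" "q = T y" by blast
      then obtain z where z: "z \<in> lower_part f" "x \<le> z" "y \<le> z"
        using lower_part_directed(1)[OF f0] by (auto simp: up_directed_def)
      then have "p \<le> T z" "q \<le> T z" using xy by (auto simp: lower_part_def intro!: T_mono)
      then show "\<exists>r\<in>?D. p \<le> r \<and> q \<le> r" using z(1) by blast
    qed
    show "lub_in (\<le>) UNIV ?D (T_pos f)" unfolding T_pos_def by (rule lub_in_cSup[OF ne bdd])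
    show "bdd_above (T ` ?D)" "T_pos f = Sup (T ` ?D)" unfolding TT T_pos_def by (rule bdd refl)+
  qed
  then show "T_pos f \<in> pos_domain" "T_pos (T_pos f) = T_pos f" by (simp_all add: ext_value_iff)
qed

lemma T_pos_eq_T:
  assumes "x \<in> E" "0 \<le> x"
  shows "x \<in> pos_domain" "T_pos x = T x"
proof -
  have "x \<in> pos_domain \<and> T_pos x \<le> T x"
    using assms by (intro pos_domainI T_mono) (auto simp: lower_part_def)
  moreover have "T x \<le> T_pos x"
    using assms calculation by (intro T_le_T_pos) (auto simp: lower_part_def)
  ultimately show "x \<in> pos_domain" "T_pos x = T x" by (auto intro: order.antisym)
qed

section \<open>Linear extension to the natural domain\<close>

abbreviation \<tau> :: "'a \<Rightarrow> 'a" where "\<tau> \<equiv> Text E T"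

lemma tau_diff_pos:
  assumes "f \<in> pos_domain" "g \<in> pos_domain"
  shows "\<tau> (f - g) = T_pos f - T_pos g"
  unfolding Text_def
proof (rule the_equality)
  show "\<exists>f1 f2 y1 y2. ext_value E T f1 y1 \<and> ext_value E T f2 y2 \<and> f - g = f1 - f2 \<and>
      T_pos f - T_pos g = y1 - y2"
    using assms by (auto simp: ext_value_iff)
  fix y assume "\<exists>f1 f2 y1 y2. ext_value E T f1 y1 \<and> ext_value E T f2 y2 \<and> f - g = f1 - f2 \<and> y = y1 - y2"
  then obtain f1 f2 where *: "f1 \<in> pos_domain" "f2 \<in> pos_domain" "f - g = f1 - f2"
      "y = T_pos f1 - T_pos f2"
    by (auto simp: ext_value_iff)
  have "f + f2 = f1 + g" 
  proof -
    have "f + f2 = (f - g) + (f2 + g)" by simp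
    also have "\<dots> = f1 + g" unfolding *(3) by simp
    finally show ?thesis .
  qed
  then have "T_pos f + T_pos f2 = T_pos f1 + T_pos g"
    using T_pos_add(2)[OF assms(1) *(2)] T_pos_add(2)[OF *(1) assms(2)] by simp
  moreover have "T_pos f - T_pos g = (T_pos f + T_pos f2) - (T_pos f2 + T_pos g)" by simp
  ultimately show "y = T_pos f - T_pos g" unfolding *(4) by simp
qed

lemma pos_domain_L1: "f \<in> pos_domain \<Longrightarrow> f \<in> L1 E T"
  unfolding L1_eq using zero_pos_domain(1) by force

lemma tau_pos: "f \<in> pos_domain \<Longrightarrow> \<tau> f = T_pos f"
  using tau_diff_pos[OF _ zero_pos_domain(1), of f] by (simp add: zero_pos_domain)

lemma L1_cases:
  assumes "x \<in> L1 E T"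
  obtains f g where "f \<in> pos_domain" "g \<in> pos_domain" "x = f - g"
  using assms by (auto simp: L1_eq)

lemma L1_diffI: "f \<in> pos_domain \<Longrightarrow> g \<in> pos_domain \<Longrightarrow> f - g \<in> L1 E T"
  by (auto simp: L1_eq)

lemma L1_nonneg: 
  assumes "x \<in> L1 E T" "0 \<le> x"
  shows "x \<in> pos_domain"
proof -
  obtain f g where fg: "f \<in> pos_domain" "g \<in> pos_domain" "x = f - g" using assms(1) by (rule L1_cases)
  then have "x \<le> f" by (simp add: pos_domain_nonneg diff_le_eq)
  then show ?thesis using pos_domain_down[OF fg(1) assms(2)] by simp
qed

lemma L1_add: 
  assumes "x \<in> L1 E T" "y \<in> L1 E T"
  shows "x + y \<in> L1 E T" "\<tau> (x + y) = \<tau> x + \<tau> y"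
proof -
  obtain f g where fg: "f \<in> pos_domain" "g \<in> pos_domain" "x = f - g" using assms(1) by (rule L1_cases)
  obtain h k where hk: "h \<in> pos_domain" "k \<in> pos_domain" "y = h - k" using assms(2) by (rule L1_cases)
  have eq: "x + y = (f + h) - (g + k)" using fg hk by (simp add: add_diff_add)
  show "x + y \<in> L1 E T" unfolding eq using fg hk by (intro L1_diffI T_pos_add(1))
  have "\<tau> (x + y) = T_pos (f + h) - T_pos (g + k)"
    unfolding eq using fg hk by (intro tau_diff_pos T_pos_add(1))
  also have "\<dots> = (T_pos f - T_pos g) + (T_pos h - T_pos k)"
    using fg hk by (simp add: T_pos_add(2) add_diff_add)
  finally show "\<tau> (x + y) = \<tau> x + \<tau> y"
    using fg hk by (simp add: tau_diff_pos)
qed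

lemma L1_minus:
  assumes "x \<in> L1 E T"
  shows "- x \<in> L1 E T" "\<tau> (- x) = - \<tau> x"
proof -
  obtain f g where fg: "f \<in> pos_domain" "g \<in> pos_domain" "x = f - g" using assms(1) by (rule L1_cases)
  then show "- x \<in> L1 E T" "\<tau> (- x) = - \<tau> x" by (simp_all add: L1_diffI tau_diff_pos)
qed

lemma L1_diff:
  assumes "x \<in> L1 E T" "y \<in> L1 E T"
  shows "x - y \<in> L1 E T" "\<tau> (x - y) = \<tau> x - \<tau> y"
  using L1_add[OF assms(1) L1_minus(1)[OF assms(2)]] L1_minus(2)[OF assms(2)] by simp_all

lemma L1_scaleR:
  assumes x: "x \<in> L1 E T"
  shows "c *\<^sub>R x \<in> L1 E T" "\<tau> (c *\<^sub>R x) = c *\<^sub>R \<tau> x"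
proof -
  have *: "c *\<^sub>R x \<in> L1 E T \<and> \<tau> (c *\<^sub>R x) = c *\<^sub>R \<tau> x" if x: "x \<in> L1 E T" and c: "0 \<le> c" for c x
  proof -
    obtain f g where fg: "f \<in> pos_domain" "g \<in> pos_domain" "x = f - g"
      using x by (rule L1_cases)
    then show ?thesis
      using T_pos_scaleR[OF fg(1) c] T_pos_scaleR[OF fg(2) c]
      by (simp add: scaleR_diff_right L1_diffI tau_diff_pos)
  qed
  have "c *\<^sub>R x \<in> L1 E T \<and> \<tau> (c *\<^sub>R x) = c *\<^sub>R \<tau> x"
  proof (cases "0 \<le> c")
    case False
    then show ?thesis using *[OF L1_minus(1)[OF x], of "- c"] L1_minus(2)[OF x] by simp
  qed (rule *[OF x])
  then show "c *\<^sub>R x \<in> L1 E T" "\<tau> (c *\<^sub>R x) = c *\<^sub>R \<tau> x" by simp_all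
qed

lemma tau_nonneg:
  assumes "x \<in> L1 E T" "0 \<le> x"
  shows "0 \<le> \<tau> x"
  using L1_nonneg[OF assms] T_le_T_pos[of x 0] T_nonneg[OF E_0] zero_in_lower_part[OF assms(2)]
  by (simp add: tau_pos)

lemma tau_mono: "x \<in> L1 E T \<Longrightarrow> y \<in> L1 E T \<Longrightarrow> x \<le> y \<Longrightarrow> \<tau> x \<le> \<tau> y"
  using tau_nonneg[of "y - x"] L1_diff[of y x] by simp

lemma L1_solid:
  assumes y: "y \<in> L1 E T" and le: "\<bar>x\<bar> \<le> \<bar>y\<bar>"
  shows "x \<in> L1 E T"
proof -
  obtain f g where fg: "f \<in> pos_domain" "g \<in> pos_domain" "y = f - g" using y by (rule L1_cases)
  have "\<bar>y\<bar> \<le> f + g"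
    using abs_triangle_ineq4[of f g] fg by (simp add: pos_domain_nonneg)
  with le have "\<bar>x\<bar> \<le> f + g" by (rule order_trans)
  then have "pprt x \<le> f + g" "pprt (- x) \<le> f + g"
    using pprt_le_abs[of x] pprt_le_abs[of "- x"] by simp_all
  then have "pprt x \<in> pos_domain" "pprt (- x) \<in> pos_domain"
    using pos_domain_down[OF T_pos_add(1)[OF fg(1,2)]] by simp_all
  then have "pprt x - pprt (- x) \<in> L1 E T" by (rule L1_diffI)
  then show ?thesis by (simp only: pprt_minus_pprt)
qed

lemma L1_abs: "x \<in> L1 E T \<Longrightarrow> \<bar>x\<bar> \<in> L1 E T"
  by (rule L1_solid[of x]) simp_all

lemma tau_strict:
  assumes x: "x \<in> L1 E T" "0 \<le> x" and 0: "\<tau> x = 0"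
  shows "x = 0"
proof -
  have xp: "x \<in> pos_domain" using x by (rule L1_nonneg)
  have "x \<le> 0"
  proof (rule le_if_lower_part_le[OF x(2)])
    fix d assume d: "d \<in> lower_part x"
    then have "T d \<le> 0" using T_le_T_pos[OF xp d] 0 xp by (simp add: tau_pos)
    moreover have "0 \<le> T d" using d by (auto simp: lower_part_def intro: T_nonneg)
    ultimately have "T d = 0" by (rule order.antisym)
    then show "d \<le> 0" using d T_strict[of d] by (auto simp: lower_part_def)
  qed
  then show ?thesis using x(2) by (rule order.antisym)
qed

section \<open>The range A: lattice structure, order closedness, products and roots\<close>

lemma rangeT_iff: "a \<in> rangeT E T \<longleftrightarrow> a \<in> L1 E T \<and> \<tau> a = a"
proof
  assume "a \<in> rangeT E T"
  then obtain x where x: "x \<in> L1 E T" "a = \<tau> x" by (auto simp: rangeT_def)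
  obtain f g where fg: "f \<in> pos_domain" "g \<in> pos_domain" "x = f - g" using x(1) by (rule L1_cases)
  then show "a \<in> L1 E T \<and> \<tau> a = a"
    using x(2) T_pos_idem[OF fg(1)] T_pos_idem[OF fg(2)] by (simp add: tau_diff_pos L1_diffI)
qed (auto simp: rangeT_def intro: rev_image_eqI)

lemma tau_in_rangeT: "x \<in> L1 E T \<Longrightarrow> \<tau> x \<in> rangeT E T"
  by (simp add: rangeT_def)

lemma rangeT_add: "a \<in> rangeT E T \<Longrightarrow> b \<in> rangeT E T \<Longrightarrow> a + b \<in> rangeT E T"
  and rangeT_diff: "a \<in> rangeT E T \<Longrightarrow> b \<in> rangeT E T \<Longrightarrow> a - b \<in> rangeT E T"
  and rangeT_minus: "a \<in> rangeT E T \<Longrightarrow> - a \<in> rangeT E T"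
  and rangeT_scaleR: "a \<in> rangeT E T \<Longrightarrow> c *\<^sub>R a \<in> rangeT E T"
  by (simp_all add: rangeT_iff L1_add L1_diff L1_minus L1_scaleR)

lemma rangeT_one: "1 \<in> rangeT E T"
  using T_pos_eq_T[OF E_one one_nonneg] T_one by (simp add: rangeT_iff tau_pos pos_domain_L1)

lemma rangeT_scalar: "c *\<^sub>R 1 \<in> rangeT E T"
  by (intro rangeT_scaleR rangeT_one)

lemma rangeT_zero: "0 \<in> rangeT E T"
  using rangeT_scalar[of 0] by simp

text \<open>By strict positivity, since \<open>\<tau> \<bar>a\<bar> - \<bar>a\<bar>\<close> is positive and annihilated by \<open>\<tau>\<close>.\<close>

lemma rangeT_abs:
  assumes "a \<in> rangeT E T"
  shows "\<bar>a\<bar> \<in> rangeT E T"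
proof -
  have a: "a \<in> L1 E T" "\<tau> a = a" using assms by (simp_all add: rangeT_iff)
  have a1: "\<bar>a\<bar> \<in> L1 E T" using a(1) by (rule L1_abs)
  have "a \<le> \<tau> \<bar>a\<bar>" "- a \<le> \<tau> \<bar>a\<bar>"
    using tau_mono[OF a(1) a1] tau_mono[OF L1_minus(1)[OF a(1)] a1] a L1_minus(2)[OF a(1)]
    by (simp_all add: abs_ge_self abs_ge_minus_self)
  then have "\<bar>a\<bar> \<le> \<tau> \<bar>a\<bar>" by (rule abs_leI)
  then have nn: "0 \<le> \<tau> \<bar>a\<bar> - \<bar>a\<bar>" by simp
  have t: "\<tau> \<bar>a\<bar> \<in> L1 E T" "\<tau> (\<tau> \<bar>a\<bar>) = \<tau> \<bar>a\<bar>"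
    using tau_in_rangeT[OF a1] by (simp_all add: rangeT_iff)
  have "\<tau> (\<tau> \<bar>a\<bar> - \<bar>a\<bar>) = 0" using t L1_diff[OF t(1) a1] by simp
  then have "\<tau> \<bar>a\<bar> - \<bar>a\<bar> = 0" by (rule tau_strict[OF L1_diff(1)[OF t(1) a1] nn])
  then show ?thesis using a1 by (simp add: rangeT_iff)
qed

lemma rangeT_pprt: "a \<in> rangeT E T \<Longrightarrow> pprt a \<in> rangeT E T"
  unfolding pprt_eq_abs by (intro rangeT_scaleR rangeT_add rangeT_abs)

lemma rangeT_sup: "a \<in> rangeT E T \<Longrightarrow> b \<in> rangeT E T \<Longrightarrow> sup a b \<in> rangeT E T"
  unfolding sup_eq_pprt_add by (intro rangeT_add rangeT_pprt rangeT_diff)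

lemma rangeT_inf: "a \<in> rangeT E T \<Longrightarrow> b \<in> rangeT E T \<Longrightarrow> inf a b \<in> rangeT E T"
  unfolding inf_eq_neg_sup by (intro rangeT_minus rangeT_sup)

text \<open>The elements of A between 0 and f are a directed set of fixed points, so monotone
  convergence puts f in the domain with \<open>T_pos f\<close> \<le> f. Conversely
  \<open>T_pos f\<close> majorises each of these fixed points, hence f.\<close>

lemma rangeT_order_closed:
  assumes f: "0 \<le> f"
    and lub: "\<And>h. (\<And>y. y \<in> rangeT E T \<Longrightarrow> 0 \<le> y \<Longrightarrow> y \<le> f \<Longrightarrow> y \<le> h) \<Longrightarrow> f \<le> h"
  shows "f \<in> rangeT E T"
proof -
  let ?D = "{y \<in> rangeT E T. 0 \<le> y \<and> y \<le> f}"
  have pd: "y \<in> pos_domain" "T_pos y = y" if "y \<in> ?D" for y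
    using that L1_nonneg[of y] tau_pos[of y] by (auto simp: rangeT_iff)
  have l: "lub_in (\<le>) UNIV ?D f" using lub by (auto simp: lub_in_def)
  have "up_directed ?D"
    unfolding up_directed_def
  proof (intro conjI ballI)
    show "?D \<noteq> {}" using rangeT_zero f by blast
    fix x y assume "x \<in> ?D" "y \<in> ?D"
    then have "sup x y \<in> ?D" by (auto intro: rangeT_sup le_supI1)
    then show "\<exists>z\<in>?D. x \<le> z \<and> y \<le> z" by (rule bexI[rotated]) simp
  qed
  then have fp: "f \<in> pos_domain" "T_pos f \<le> f"
    using T_pos_directed_lub[OF _ _ l, of f] pd by auto
  have "f \<le> T_pos f"
  proof (rule lub)
    fix y assume "y \<in> rangeT E T" "0 \<le> y" "y \<le> f"
    then have "T_pos y \<le> T_pos f" "T_pos y = y" using pos_domain_down[OF fp(1), of y] pd(2)[of y] by auto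
    then show "y \<le> T_pos f" by simp
  qed
  then have "T_pos f = f" using fp(2) by (intro order.antisym)
  then show ?thesis using fp(1) by (simp add: rangeT_iff pos_domain_L1 tau_pos)
qed

text \<open>The positive parts of 2 t c - t^2 are elements of A below c^2, and by the scalar formula
  any common upper bound of them is at least c^2.\<close>

lemma rangeT_square:
  assumes c: "c \<in> rangeT E T"
  shows "c * c \<in> rangeT E T"
proof (rule rangeT_order_closed[OF square_nonneg])
  fix h assume h: "\<And>y. y \<in> rangeT E T \<Longrightarrow> 0 \<le> y \<Longrightarrow> y \<le> c * c \<Longrightarrow> y \<le> h"
  show "c * c \<le> h"
  proof (rule square_le_if_affine_le)
    fix t :: real
    let ?y = "(2 * t) *\<^sub>R c - (t * t) *\<^sub>R 1"
    have "pprt ?y \<le> h"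
    proof (rule h)
      show "pprt ?y \<in> rangeT E T"
        by (intro rangeT_pprt rangeT_diff rangeT_scaleR c rangeT_one)
      show "pprt ?y \<le> c * c" using square_ge_affine[of t c] by (simp add: pprt_def square_nonneg)
    qed simp
    then show "?y \<le> h" by (simp add: pprt_def)
  qed
qed

lemma rangeT_mult:
  assumes "a \<in> rangeT E T" "b \<in> rangeT E T"
  shows "a * b \<in> rangeT E T"
proof -
  have "(a + b) * (a + b) - (a - b) * (a - b) = 4 *\<^sub>R (a * b)"
    using scaleR_add_left[of 2 2 "a * b"]
    by (simp add: algebra_simps mult_commute[of b a] scaleR_2)
  then have "a * b = (1 / 4) *\<^sub>R ((a + b) * (a + b) - (a - b) * (a - b))" by simp
  then show ?thesis
    using assms by (simp only: rangeT_scaleR rangeT_diff rangeT_square rangeT_add)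
qed

lemma rangeT_sqrt:
  assumes b: "b \<in> rangeT E T" "0 \<le> b"
  obtains r where "r \<in> rangeT E T" "0 \<le> r" "r * r = b"
proof -
  let ?m = "\<lambda>t::real. (1 / (2 * t)) *\<^sub>R b + (t / 2) *\<^sub>R 1"
  let ?M = "?m ` {0<..}"
  have sq: "bdd_below ?M" "0 \<le> Inf ?M" "Inf ?M * Inf ?M = b"
    using square_root_Inf[OF b(2)] by auto
  have mA: "?m t \<in> rangeT E T" for t by (intro rangeT_add rangeT_scaleR b(1) rangeT_one)
  have le: "Inf ?M \<le> ?m t" if "0 < t" for t using that by (intro cInf_lower sq(1)) auto
  \<comment> \<open>Order closedness concerns suprema of positive elements, so the infimum is turned
    into a supremum by subtracting from the member \<open>?m 1\<close>; the choice t = 1 is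
    arbitrary.\<close>
  have "?m 1 - Inf ?M \<in> rangeT E T"
  proof (rule rangeT_order_closed)
    show "0 \<le> ?m 1 - Inf ?M" using le[of 1] by simp
    fix h assume h: "\<And>y. y \<in> rangeT E T \<Longrightarrow> 0 \<le> y \<Longrightarrow> y \<le> ?m 1 - Inf ?M \<Longrightarrow> y \<le> h"
    have "?m 1 - h \<le> Inf ?M"
    proof (rule cInf_greatest)
      fix m assume "m \<in> ?M"
      then obtain t where t: "0 < t" "m = ?m t" by auto
      have "pprt (?m 1 - m) \<le> h"
      proof (rule h)
        show "pprt (?m 1 - m) \<in> rangeT E T" unfolding t(2) by (intro rangeT_pprt rangeT_diff mA)
        show "pprt (?m 1 - m) \<le> ?m 1 - Inf ?M"
          unfolding pprt_def
        proof (rule sup_least)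
          show "?m 1 - m \<le> ?m 1 - Inf ?M" using le[OF t(1)] unfolding t(2) by (rule diff_left_mono)
          show "0 \<le> ?m 1 - Inf ?M" using le[of 1] by simp
        qed
      qed simp
      moreover have "?m 1 - m \<le> pprt (?m 1 - m)" unfolding pprt_def by (rule sup_ge1)
      ultimately have "?m 1 - m \<le> h" by (rule order_trans[rotated])
      then show "?m 1 - h \<le> m" by (simp only: diff_le_eq add.commute)
    qed auto
    then show "?m 1 - Inf ?M \<le> h" by (simp only: diff_le_eq add.commute)
  qed
  then have "?m 1 - (?m 1 - Inf ?M) \<in> rangeT E T" by (rule rangeT_diff[OF mA])
  then have "Inf ?M \<in> rangeT E T" by (simp only: diff_diff_eq2 add_diff_cancel_left')
  then show ?thesis using sq that by blast
qed

end

section \<open>The averaging identity and the norm of \<open>L\<^sup>2(T)\<close>\<close>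

lemma le_if_le_add_scaled:
  fixes x y z :: "'a::universally_complete_f_algebra"
  assumes "\<And>\<epsilon>::real. 0 < \<epsilon> \<Longrightarrow> x \<le> y + \<epsilon> *\<^sub>R z"
  shows "x \<le> y"
proof -
  have "x - y \<le> 0"
    by (rule archimedean[of _ z]) (use assms in \<open>simp add: diff_le_eq add.commute\<close>)
  then show ?thesis by simp
qed

context riesz_conditional_expectation
begin

section \<open>L^2(T) as an ideal and the averaging identity\<close>

lemma L2_L1: "x \<in> L2 E T \<Longrightarrow> x \<in> L1 E T"
  and L2_square: "x \<in> L2 E T \<Longrightarrow> x * x \<in> L1 E T"
  and L2I: "x \<in> L1 E T \<Longrightarrow> x * x \<in> L1 E T \<Longrightarrow> x \<in> L2 E T"
  by (simp_all add: L2_def)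

lemma L1_le: "y \<in> L1 E T \<Longrightarrow> 0 \<le> x \<Longrightarrow> x \<le> y \<Longrightarrow> x \<in> L1 E T"
  by (rule L1_solid[of y]) (auto intro: order_trans)

lemma L2_mult_L1:
  assumes "x \<in> L2 E T" "y \<in> L2 E T"
  shows "x * y \<in> L1 E T"
proof (rule L1_solid)
  show "x * x + y * y \<in> L1 E T" using assms by (intro L1_add L2_square)
  show "\<bar>x * y\<bar> \<le> \<bar>x * x + y * y\<bar>"
    using abs_mult_le_squares[of x y] abs_ge_self by (rule order_trans)
qed

lemma L2_add:
  assumes "x \<in> L2 E T" "y \<in> L2 E T"
  shows "x + y \<in> L2 E T"
proof (rule L2I)
  show "x + y \<in> L1 E T" using assms by (intro L1_add L2_L1)
  have "2 *\<^sub>R (x * x) + 2 *\<^sub>R (y * y) \<in> L1 E T" using assms by (intro L1_add L1_scaleR L2_square)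
  then show "(x + y) * (x + y) \<in> L1 E T"
    using square_nonneg square_add_le by (rule L1_le)
qed

lemma L2_scaleR: "x \<in> L2 E T \<Longrightarrow> c *\<^sub>R x \<in> L2 E T"
  by (rule L2I) (simp_all add: L1_scaleR L2_L1 L2_square)

lemma L2_minus: "x \<in> L2 E T \<Longrightarrow> - x \<in> L2 E T"
  using L2_scaleR[of x "- 1"] by simp

lemma L2_diff: "x \<in> L2 E T \<Longrightarrow> y \<in> L2 E T \<Longrightarrow> x - y \<in> L2 E T"
  using L2_add[of x "- y"] L2_minus[of y] by simp

lemma L2_solid:
  assumes y: "y \<in> L2 E T" and le: "\<bar>x\<bar> \<le> \<bar>y\<bar>"
  shows "x \<in> L2 E T"
proof (rule L2I)
  show "x \<in> L1 E T" using L2_L1[OF y] le by (rule L1_solid)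
  show "x * x \<in> L1 E T" using L2_square[OF y] square_nonneg square_mono[OF le] by (rule L1_le)
qed

lemma L2_abs: "x \<in> L2 E T \<Longrightarrow> \<bar>x\<bar> \<in> L2 E T"
  by (rule L2_solid[of x]) simp_all

lemma L2_pprt: "x \<in> L2 E T \<Longrightarrow> pprt x \<in> L2 E T"
  by (rule L2_solid[of x]) (simp_all add: pprt_le_abs)

lemma L2_le: "y \<in> L2 E T \<Longrightarrow> 0 \<le> x \<Longrightarrow> x \<le> y \<Longrightarrow> x \<in> L2 E T"
  by (rule L2_solid[of y]) (auto intro: order_trans)

lemma rangeT_L1: "a \<in> rangeT E T \<Longrightarrow> a \<in> L1 E T"
  and tau_rangeT: "a \<in> rangeT E T \<Longrightarrow> \<tau> a = a"
  by (simp_all add: rangeT_iff)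

lemma rangeT_L2: "a \<in> rangeT E T \<Longrightarrow> a \<in> L2 E T"
  by (intro L2I rangeT_L1 rangeT_square)

lemma L2_zero: "0 \<in> L2 E T"
  by (intro rangeT_L2 rangeT_zero)

text \<open>Jensen's inequality: \<tau> is monotone and fixes scalars, so it carries each affine
  minorant 2 t x - t^2 of x^2 to the minorant of (\<tau> x)^2 with the same t.\<close>

lemma square_tau_le:
  assumes x: "x \<in> L2 E T"
  shows "\<tau> x * \<tau> x \<le> \<tau> (x * x)"
proof (rule square_le_if_affine_le)
  fix t :: real
  have x1: "(2 * t) *\<^sub>R x \<in> L1 E T" and t1: "(t * t) *\<^sub>R 1 \<in> L1 E T"
    using x by (simp_all add: L1_scaleR L2_L1 rangeT_L1 rangeT_scalar)
  have "(2 * t) *\<^sub>R \<tau> x - (t * t) *\<^sub>R 1 = \<tau> ((2 * t) *\<^sub>R x - (t * t) *\<^sub>R 1)"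
    using L1_scaleR(2)[OF L2_L1[OF x]] tau_rangeT[OF rangeT_scalar]
    by (simp add: L1_diff(2)[OF x1 t1])
  also have "\<dots> \<le> \<tau> (x * x)"
    using L1_diff(1)[OF x1 t1] L2_square[OF x] square_ge_affine by (rule tau_mono)
  finally show "(2 * t) *\<^sub>R \<tau> x - (t * t) *\<^sub>R 1 \<le> \<tau> (x * x)" .
qed

text \<open>The form \<open>\<tau> (x * y) - \<tau> x * \<tau> y\<close> is positive semidefinite and vanishes at \<open>(a, a)\<close>, hence
  at every \<open>(a, z)\<close>.\<close>

lemma averaging_L2:
  assumes a: "a \<in> rangeT E T" and z: "z \<in> L2 E T"
  shows "\<tau> (a * z) = a * \<tau> z"
proof -
  define g where "g = \<tau> (a * z) - a * \<tau> z"
  define V where "V = \<tau> (z * z) - \<tau> z * \<tau> z"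
  have aH: "a \<in> L2 E T" using a by (rule rangeT_L2)
  have az: "a * z \<in> L1 E T" using aH z by (rule L2_mult_L1)
  \<comment> \<open>At z + t a the terms in t^2 cancel, because \<tau> fixes a and a^2. What remains
    is affine in t and positive for all real t, which forces the slope g to vanish.\<close>
  have pos: "0 \<le> V + (2 * t) *\<^sub>R g" for t :: real
  proof -
    have ta: "t *\<^sub>R a \<in> L2 E T" using aH by (rule L2_scaleR)
    have "\<tau> (z + t *\<^sub>R a) * \<tau> (z + t *\<^sub>R a) \<le> \<tau> ((z + t *\<^sub>R a) * (z + t *\<^sub>R a))"
      using L2_add[OF z ta] by (rule square_tau_le)
    also have "(z + t *\<^sub>R a) * (z + t *\<^sub>R a) = z * z + ((2 * t) *\<^sub>R (a * z) + (t * t) *\<^sub>R (a * a))"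
      using scaleR_add_left[of t t "a * z"] by (simp add: algebra_simps mult_commute[of z a])
    also have "\<tau> \<dots> = \<tau> (z * z) + ((2 * t) *\<^sub>R \<tau> (a * z) + (t * t) *\<^sub>R (a * a))"
      using L2_square[OF z] L2_square[OF aH] az tau_rangeT[OF rangeT_square[OF a]]
      by (simp add: L1_add L1_scaleR)
    also have "\<tau> (z + t *\<^sub>R a) = \<tau> z + t *\<^sub>R a"
      using L1_add(2)[OF L2_L1[OF z] L2_L1[OF ta]] L1_scaleR(2)[OF L2_L1[OF aH]] tau_rangeT[OF a]
      by simp
    also have "(\<tau> z + t *\<^sub>R a) * (\<tau> z + t *\<^sub>R a)
        = \<tau> z * \<tau> z + ((2 * t) *\<^sub>R (a * \<tau> z) + (t * t) *\<^sub>R (a * a))"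
      using scaleR_add_left[of t t "a * \<tau> z"] by (simp add: algebra_simps mult_commute[of "\<tau> z" a])
    finally have "\<tau> z * \<tau> z + (2 * t) *\<^sub>R (a * \<tau> z) \<le> \<tau> (z * z) + (2 * t) *\<^sub>R \<tau> (a * z)"
      by (simp add: add.assoc[symmetric])
    then show ?thesis by (simp add: g_def V_def scaleR_diff_right algebra_simps)
  qed
  have "- g \<le> 0"
  proof (rule archimedean)
    fix \<epsilon> :: real assume e: "0 < \<epsilon>"
    have "0 \<le> V - (- ((1 / \<epsilon>) *\<^sub>R g))" using pos[of "1 / (2 * \<epsilon>)"] e by simp
    then have "- ((1 / \<epsilon>) *\<^sub>R g) \<le> V" by (simp only: diff_ge_0_iff_ge)
    then have "\<epsilon> *\<^sub>R (- ((1 / \<epsilon>) *\<^sub>R g)) \<le> \<epsilon> *\<^sub>R V"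
      using e by (intro scaleR_left_mono) simp_all
    then show "- g \<le> \<epsilon> *\<^sub>R V" using e by simp
  qed
  moreover have "g \<le> 0"
  proof (rule archimedean)
    fix \<epsilon> :: real assume e: "0 < \<epsilon>"
    have "0 \<le> V - (1 / \<epsilon>) *\<^sub>R g" using pos[of "- (1 / (2 * \<epsilon>))"] e by simp
    then have "\<epsilon> *\<^sub>R ((1 / \<epsilon>) *\<^sub>R g) \<le> \<epsilon> *\<^sub>R V"
      using e by (intro scaleR_left_mono) simp_all
    then show "g \<le> \<epsilon> *\<^sub>R V" using e by simp
  qed
  ultimately have "g = 0" by (intro order.antisym) simp_all
  then show ?thesis by (simp add: g_def)
qed

text \<open>\<open>averaging_L2\<close> applies to the truncations of z at n, which are dominated by
  scalars and so lie in L^2; monotone convergence passes to the limit on both sides.\<close>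

lemma averaging_pos:
  assumes a: "a \<in> rangeT E T" "0 \<le> a" and z: "z \<in> pos_domain"
  shows "a * z \<in> pos_domain" "T_pos (a * z) = a * T_pos z"
proof -
  let ?z = "\<lambda>n::nat. inf z (real n *\<^sub>R 1)"
  have z0: "0 \<le> z" using z by (rule pos_domain_nonneg)
  have nn: "0 \<le> ?z n" for n using z0 by (simp add: scaleR_one_nonneg)
  have zH: "?z n \<in> L2 E T" for n
    using rangeT_L2[OF rangeT_scalar] nn inf_le2 by (rule L2_le)
  have zp: "?z n \<in> pos_domain" for n using L2_L1[OF zH] nn by (rule L1_nonneg)
  have ap: "a * ?z n \<in> pos_domain" for n
    using L2_mult_L1[OF rangeT_L2[OF a(1)] zH] a(2) nn by (intro L1_nonneg mult_nonneg_nonneg)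
  have avg: "T_pos (a * ?z n) = a * T_pos (?z n)" for n
    using averaging_L2[OF a(1) zH] by (simp add: tau_pos ap zp)
  have zle: "T_pos (?z n) \<le> T_pos z" for n using pos_domain_down[OF z nn] by simp
  have z_mono: "?z n \<le> ?z m" if "n \<le> m" for n m
    using that by (intro inf_mono order.refl scaleR_right_mono one_nonneg) simp
  have dir: "up_directed (range (\<lambda>n. b * ?z n))" if b: "0 \<le> b" for b
    unfolding up_directed_def
  proof (intro conjI ballI)
    fix x y assume "x \<in> range (\<lambda>n. b * ?z n)" "y \<in> range (\<lambda>n. b * ?z n)"
    then obtain n m where nm: "x = b * ?z n" "y = b * ?z m" by blast
    have "x \<le> b * ?z (max n m)" "y \<le> b * ?z (max n m)"
      unfolding nm by (rule mult_left_mono[OF z_mono b], simp)+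
    then show "\<exists>w\<in>range (\<lambda>n. b * ?z n). x \<le> w \<and> y \<le> w" by blast
  qed simp
  \<comment> \<open>The truncation error is at most b z^2 / n. The statement is used with b = a and
    with b = 1.\<close>
  have lub: "lub_in (\<le>) UNIV (range (\<lambda>n. b * ?z n)) (b * z)" if b: "0 \<le> b" for b
    unfolding lub_in_def
  proof (intro conjI ballI impI)
    fix d assume "d \<in> range (\<lambda>n. b * ?z n)"
    then obtain n where n: "d = b * ?z n" by blast
    show "d \<le> b * z" unfolding n by (rule mult_left_mono[OF inf_le1 b])
  next
    fix u assume "\<forall>d\<in>range (\<lambda>n. b * ?z n). d \<le> u"
    then have u: "b * ?z n \<le> u" for n by blast
    have "b * z - u \<le> 0"
    proof (rule archimedean_nat)
      fix n :: nat assume n: "0 < n"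
      have "b * z - u \<le> b * z - b * ?z n" using u by (rule diff_left_mono)
      also have "\<dots> = b * (z - ?z n)" by (simp only: right_diff_distrib)
      also have "\<dots> \<le> b * ((1 / real n) *\<^sub>R (z * z))"
        using scaled_pprt_le_square_nat[OF n z0] b by (rule mult_left_mono)
      finally show "b * z - u \<le> (1 / real n) *\<^sub>R (b * (z * z))" by (simp only: mult_scaleR_right)
    qed (use b in \<open>simp add: square_nonneg\<close>)
    then show "b * z \<le> u" by simp
  qed simp
  have le: "a * z \<in> pos_domain" "T_pos (a * z) \<le> a * T_pos z"
  proof -
    have *: "T_pos d \<le> a * T_pos z" if d: "d \<in> range (\<lambda>n. a * ?z n)" for d
    proof -
      obtain n where n: "d = a * ?z n" using d by blast
      show ?thesis unfolding n avg by (rule mult_left_mono[OF zle a(2)])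
    qed
    have sub: "range (\<lambda>n. a * ?z n) \<subseteq> pos_domain" using ap by blast
    show "a * z \<in> pos_domain" "T_pos (a * z) \<le> a * T_pos z"
      by (rule T_pos_directed_lub[OF dir[OF a(2)] sub lub[OF a(2)] *], assumption)+
  qed
  let ?R = "range (\<lambda>n. T_pos (?z n))"
  have bdd: "bdd_above ?R" using zle by (intro bdd_aboveI[of _ "T_pos z"]) auto
  have "T_pos z \<le> Sup ?R"
  proof -
    have *: "T_pos d \<le> Sup ?R" if d: "d \<in> range (\<lambda>n. 1 * ?z n)" for d
    proof -
      obtain n where n: "d = ?z n" using d by auto
      show ?thesis unfolding n by (rule cSup_upper[OF _ bdd]) blast
    qed
    have sub: "range (\<lambda>n. 1 * ?z n) \<subseteq> pos_domain" using zp by auto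
    have "T_pos (1 * z) \<le> Sup ?R"
      by (rule T_pos_directed_lub(2)[OF dir[OF one_nonneg] sub lub[OF one_nonneg] *])
    then show ?thesis by simp
  qed
  then have "a * T_pos z \<le> a * Sup ?R" using a(2) by (rule mult_left_mono)
  also have "\<dots> \<le> T_pos (a * z)"
  proof (rule mult_cSup_le[OF a(2) _ bdd])
    fix d assume "d \<in> ?R"
    then obtain n where n: "d = T_pos (?z n)" by blast
    have "a * ?z n \<le> a * z" by (rule mult_left_mono[OF inf_le1 a(2)])
    then have "T_pos (a * ?z n) \<le> T_pos (a * z)"
      using pos_domain_down[OF le(1) pos_domain_nonneg[OF ap]] by simp
    then show "a * d \<le> T_pos (a * z)" by (simp only: n avg)
  qed simp
  finally show "T_pos (a * z) = a * T_pos z" using le(2) by (rule order.antisym[rotated])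
  show "a * z \<in> pos_domain" by (rule le(1))
qed

lemma averaging:
  assumes a: "a \<in> rangeT E T" and z: "z \<in> L1 E T"
  shows "a * z \<in> L1 E T" "\<tau> (a * z) = a * \<tau> z"
proof -
  obtain f g where fg: "f \<in> pos_domain" "g \<in> pos_domain" "z = f - g" using z by (rule L1_cases)
  have *: "b * z \<in> L1 E T \<and> \<tau> (b * z) = b * \<tau> z" if b: "b \<in> rangeT E T" "0 \<le> b" for b
    using averaging_pos[OF b fg(1)] averaging_pos[OF b fg(2)] fg
    by (simp add: right_diff_distrib L1_diffI tau_diff_pos)
  have p: "pprt a \<in> rangeT E T" "pprt (- a) \<in> rangeT E T"
    using a by (simp_all add: rangeT_pprt rangeT_minus)
  have eq: "a * y = pprt a * y - pprt (- a) * y" for y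
    by (simp only: left_diff_distrib[symmetric] pprt_minus_pprt)
  show "a * z \<in> L1 E T" "\<tau> (a * z) = a * \<tau> z"
    unfolding eq[of z] eq[of "\<tau> z"]
    using *[OF p(1)] *[OF p(2)] by (simp_all add: L1_diff)
qed

lemma L2_module:
  assumes a: "a \<in> rangeT E T" and x: "x \<in> L2 E T"
  shows "a * x \<in> L2 E T"
proof (rule L2I)
  show "a * x \<in> L1 E T" using a L2_L1[OF x] by (rule averaging)
  have "(a * x) * (a * x) = (a * a) * (x * x)"
    by (simp only: mult.assoc mult_left_commute[of x a])
  then show "(a * x) * (a * x) \<in> L1 E T"
    using averaging(1)[OF rangeT_square[OF a] L2_square[OF x]] by simp
qed

section \<open>The A-valued norm\<close>

abbreviation nrm :: "'a \<Rightarrow> 'a" where "nrm \<equiv> normT2 E T"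

lemma nrm_eqI:
  assumes "r \<in> rangeT E T" "0 \<le> r" "r * r = \<tau> (x * x)"
  shows "nrm x = r"
  unfolding normT2_def
proof (rule the_equality)
  show "s = r" if "s \<in> rangeT E T \<and> 0 \<le> s \<and> s * s = \<tau> (x * x)" for s
    using that assms square_le_square_imp_le[of r s] square_le_square_imp_le[of s r]
    by (intro order.antisym) simp_all
qed (use assms in simp)

lemma nrm:
  assumes x: "x \<in> L2 E T"
  shows nrm_rangeT: "nrm x \<in> rangeT E T" and nrm_nonneg: "0 \<le> nrm x"
    and nrm_square: "nrm x * nrm x = \<tau> (x * x)"
proof -
  have "0 \<le> \<tau> (x * x)" using L2_square[OF x] square_nonneg by (rule tau_nonneg)
  with tau_in_rangeT[OF L2_square[OF x]]
  obtain r where r: "r \<in> rangeT E T" "0 \<le> r" "r * r = \<tau> (x * x)" by (rule rangeT_sqrt)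
  then show "nrm x \<in> rangeT E T" "0 \<le> nrm x" "nrm x * nrm x = \<tau> (x * x)"
    using nrm_eqI[OF r] by simp_all
qed

lemma nrm_mono:
  assumes y: "y \<in> L2 E T" and le: "\<bar>x\<bar> \<le> \<bar>y\<bar>"
  shows "nrm x \<le> nrm y"
proof (rule square_le_square_imp_le)
  have x: "x \<in> L2 E T" using y le by (rule L2_solid)
  show "0 \<le> nrm x" "0 \<le> nrm y" using x y by (simp_all add: nrm_nonneg)
  have "\<tau> (x * x) \<le> \<tau> (y * y)"
    using L2_square[OF x] L2_square[OF y] square_mono[OF le] by (rule tau_mono)
  then show "nrm x * nrm x \<le> nrm y * nrm y" using x y by (simp add: nrm_square)
qed

lemma nrm_abs: "x \<in> L2 E T \<Longrightarrow> nrm \<bar>x\<bar> = nrm x"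
  by (intro order.antisym nrm_mono L2_abs) simp_all

lemma nrm_scaleR:
  assumes x: "x \<in> L2 E T"
  shows "nrm (c *\<^sub>R x) = \<bar>c\<bar> *\<^sub>R nrm x"
proof (rule nrm_eqI)
  show "\<bar>c\<bar> *\<^sub>R nrm x \<in> rangeT E T" by (intro rangeT_scaleR nrm_rangeT x)
  show "0 \<le> \<bar>c\<bar> *\<^sub>R nrm x" by (intro scaleR_nonneg_nonneg nrm_nonneg x) simp
  show "(\<bar>c\<bar> *\<^sub>R nrm x) * (\<bar>c\<bar> *\<^sub>R nrm x) = \<tau> ((c *\<^sub>R x) * (c *\<^sub>R x))"
    using L1_scaleR(2)[OF L2_square[OF x]] by (simp add: nrm_square[OF x])
qed

text \<open>The classical proof divides by the norms, which need not be invertible in A. They are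
  raised by \<epsilon> to \<alpha> and \<beta>, whose product p is at least \<epsilon>^2, and the
  error is removed at the end by the Archimedean property.\<close>

lemma Cauchy_Schwarz:
  assumes x: "x \<in> L2 E T" and y: "y \<in> L2 E T"
  shows "\<tau> (x * y) \<le> nrm x * nrm y"
proof (rule le_if_le_add_scaled)
  fix \<delta> :: real assume \<delta>: "0 < \<delta>"
  \<comment> \<open>The cap at 1 lets the error factor \<open>nrm x + nrm y + ?e\<close> be bounded
    independently of \<epsilon>.\<close>
  define \<epsilon> where "\<epsilon> = min 1 \<delta>"
  have \<epsilon>: "0 < \<epsilon>" "\<epsilon> \<le> 1" "\<epsilon> \<le> \<delta>" using \<delta> by (simp_all add: \<epsilon>_def)
  let ?e = "\<epsilon> *\<^sub>R (1::'a)"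
  define \<alpha> where "\<alpha> = nrm x + ?e"
  define \<beta> where "\<beta> = nrm y + ?e"
  have e0: "0 \<le> ?e" using \<epsilon> by (intro scaleR_one_nonneg) simp
  have A: "\<alpha> \<in> rangeT E T" "\<beta> \<in> rangeT E T"
    unfolding \<alpha>_def \<beta>_def using x y by (simp_all add: rangeT_add nrm_rangeT rangeT_scalar)
  have ge: "?e \<le> \<alpha>" "?e \<le> \<beta>" using nrm_nonneg x y by (simp_all add: \<alpha>_def \<beta>_def)
  then have nn: "0 \<le> \<alpha>" "0 \<le> \<beta>" using e0 by (blast intro: order_trans)+
  define p where "p = \<alpha> * \<beta>"
  define v where "v = \<tau> (x * y)"
  have xx: "\<tau> (x * x) \<le> \<alpha> * \<alpha>"
    unfolding nrm_square[OF x, symmetric] using nrm_nonneg[OF x] e0 nn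
    by (intro mult_mono) (simp_all add: \<alpha>_def)
  have yy: "\<tau> (y * y) \<le> \<beta> * \<beta>"
    unfolding nrm_square[OF y, symmetric] using nrm_nonneg[OF y] e0 nn
    by (intro mult_mono) (simp_all add: \<beta>_def)
  have H: "\<beta> * x \<in> L2 E T" "\<alpha> * y \<in> L2 E T" using A x y by (simp_all add: L2_module)
  \<comment> \<open>The weights are crossed so that both square terms are at most p^2 while the
    mixed term is 2 p v; hence p (p - v) \<ge> 0.\<close>
  let ?u = "\<beta> * x - \<alpha> * y"
  have xyL: "x * y \<in> L1 E T" using x y by (rule L2_mult_L1)
  have "0 \<le> \<tau> (?u * ?u)"
    using L2_square[OF L2_diff[OF H]] square_nonneg by (rule tau_nonneg)
  also have "?u * ?u = (\<beta> * \<beta>) * (x * x) + (\<alpha> * \<alpha>) * (y * y) - 2 *\<^sub>R (p * (x * y))"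
    by (simp only: p_def left_diff_distrib right_diff_distrib scaleR_2 mult.assoc
        mult_left_commute[of x \<beta>] mult_left_commute[of y \<alpha>] mult_left_commute[of y \<beta>]
        mult_left_commute[of x \<alpha>] mult_left_commute[of \<beta> \<alpha>] mult_commute[of y x]) simp
  also have "\<tau> \<dots> = (\<beta> * \<beta>) * \<tau> (x * x) + (\<alpha> * \<alpha>) * \<tau> (y * y) - 2 *\<^sub>R (p * v)"
  proof -
    have pA: "p \<in> rangeT E T" unfolding p_def using A by (rule rangeT_mult)
    note bx = averaging[OF rangeT_square[OF A(2)] L2_square[OF x]]
      and ay = averaging[OF rangeT_square[OF A(1)] L2_square[OF y]]
      and pv = averaging[OF pA xyL]
    show ?thesis
      using L1_diff(2)[OF L1_add(1)[OF bx(1) ay(1)] L1_scaleR(1)[OF pv(1), of 2]]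
        L1_add(2)[OF bx(1) ay(1)] L1_scaleR(2)[OF pv(1), of 2] bx(2) ay(2) pv(2)
      by (simp add: v_def)
  qed
  also have "\<dots> \<le> (\<beta> * \<beta>) * (\<alpha> * \<alpha>) + (\<alpha> * \<alpha>) * (\<beta> * \<beta>) - 2 *\<^sub>R (p * v)"
    using xx yy by (intro diff_right_mono add_mono mult_left_mono square_nonneg)
  also have "\<dots> = 2 *\<^sub>R (p * (p - v))"
    by (simp only: p_def right_diff_distrib scaleR_diff_right scaleR_2 mult.assoc
        mult_left_commute[of \<beta> \<alpha>] mult_commute[of \<beta> \<alpha>])
  finally have "(1 / 2) *\<^sub>R 0 \<le> (1 / 2) *\<^sub>R (2 *\<^sub>R (p * (p - v)))"
    by (rule scaleR_left_mono) simp
  then have "p * (v - p) \<le> 0" by (simp add: right_diff_distrib)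
  \<comment> \<open>As p is at least the scalar \<epsilon>^2, it can be cancelled from this
    equation.\<close>
  then have "p * pprt (v - p) = 0"
    using mult_pprt_nonneg[of p "v - p"] nn by (simp add: p_def)
  moreover have "?e * ?e \<le> p" unfolding p_def using ge nn e0 by (intro mult_mono)
  ultimately have "(?e * ?e) * pprt (v - p) \<le> 0"
    using mult_right_mono[of "?e * ?e" p "pprt (v - p)"] by simp
  then have "(1 / (\<epsilon> * \<epsilon>)) *\<^sub>R ((\<epsilon> * \<epsilon>) *\<^sub>R pprt (v - p)) \<le> (1 / (\<epsilon> * \<epsilon>)) *\<^sub>R 0"
    by (intro scaleR_left_mono) simp_all
  then have "pprt (v - p) \<le> 0" using \<epsilon> by simp
  then have "v \<le> p" by (simp add: pprt_def)
  also have "p = nrm x * nrm y + \<epsilon> *\<^sub>R (nrm x + nrm y + ?e)"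
    by (simp add: p_def \<alpha>_def \<beta>_def algebra_simps)
  also have "\<dots> \<le> nrm x * nrm y + \<delta> *\<^sub>R (nrm x + nrm y + 1)"
  proof -
    have "?e \<le> 1 *\<^sub>R (1::'a)" using \<epsilon> by (intro scaleR_right_mono one_nonneg)
    then have "nrm x + nrm y + ?e \<le> nrm x + nrm y + 1" by simp
    moreover have "0 \<le> nrm x + nrm y + ?e"
      using nrm_nonneg x y e0 by simp
    ultimately have "\<epsilon> *\<^sub>R (nrm x + nrm y + ?e) \<le> \<delta> *\<^sub>R (nrm x + nrm y + 1)"
      using \<epsilon> \<delta> by (intro scaleR_mono) simp_all
    then show ?thesis by simp
  qed
  finally show "\<tau> (x * y) \<le> nrm x * nrm y + \<delta> *\<^sub>R (nrm x + nrm y + 1)" by (simp add: v_def)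
qed

lemma nrm_triangle:
  assumes x: "x \<in> L2 E T" and y: "y \<in> L2 E T"
  shows "nrm (x + y) \<le> nrm x + nrm y"
proof (rule square_le_square_imp_le)
  show "0 \<le> nrm (x + y)" using L2_add[OF x y] by (rule nrm_nonneg)
  show "0 \<le> nrm x + nrm y" using nrm_nonneg x y by simp
  have xy: "x * y \<in> L1 E T" using x y by (rule L2_mult_L1)
  have "nrm (x + y) * nrm (x + y) = \<tau> ((x + y) * (x + y))"
    using L2_add[OF x y] by (rule nrm_square)
  also have "(x + y) * (x + y) = (x * x + y * y) + (x * y + x * y)"
    by (simp add: algebra_simps mult_commute[of y x])
  also have "\<tau> \<dots> = (\<tau> (x * x) + \<tau> (y * y)) + (\<tau> (x * y) + \<tau> (x * y))"
    using L2_square[OF x] L2_square[OF y] xy by (simp add: L1_add)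
  also have "\<dots> \<le> (nrm x * nrm x + nrm y * nrm y) + (nrm x * nrm y + nrm x * nrm y)"
    using Cauchy_Schwarz[OF x y] by (simp add: nrm_square x y add_mono)
  also have "\<dots> = (nrm x + nrm y) * (nrm x + nrm y)"
    by (simp add: algebra_simps mult_commute[of "nrm y" "nrm x"])
  finally show "nrm (x + y) * nrm (x + y) \<le> (nrm x + nrm y) * (nrm x + nrm y)" .
qed

end

section \<open>Operators on \<open>L\<^sup>2(T)\<close>\<close>

lemma diff_eq_diffI:
  fixes a b c d :: "'a::ab_group_add"
  assumes "a + d = c + b"
  shows "a - b = c - d"
proof -
  have "a - b = (a + d) - (b + d)" by simp
  also have "\<dots> = c - d" unfolding assms by simp
  finally show ?thesis .
qed

lemma half_le_iff:
  fixes u v :: "'a::ordered_real_vector"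
  shows "(1 / 2) *\<^sub>R u \<le> v \<longleftrightarrow> u \<le> v + v" "v \<le> (1 / 2) *\<^sub>R u \<longleftrightarrow> v + v \<le> u"
  using pos_divideR_le_eq[of 2 u v] pos_le_divideR_eq[of 2 v u]
  by (simp_all add: scaleR_2 inverse_eq_divide)

context riesz_conditional_expectation
begin

section \<open>The algebra of T-strongly bounded operators and its regular part\<close>

lemma
  assumes "S \<in> A_linear_ops E T"
  shows op_in: "x \<in> L2 E T \<Longrightarrow> S x \<in> L2 E T"
    and op_outside: "x \<notin> L2 E T \<Longrightarrow> S x = 0"
    and op_add: "x \<in> L2 E T \<Longrightarrow> y \<in> L2 E T \<Longrightarrow> S (x + y) = S x + S y"
    and op_hom: "a \<in> rangeT E T \<Longrightarrow> x \<in> L2 E T \<Longrightarrow> S (a * x) = a * S x"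
  using assms by (simp_all add: A_linear_ops_def)

lemma op_scaleR:
  assumes S: "S \<in> A_linear_ops E T" and x: "x \<in> L2 E T"
  shows "S (c *\<^sub>R x) = c *\<^sub>R S x"
  using op_hom[OF S rangeT_scalar x, of c] by simp

lemma op_zero: "S \<in> A_linear_ops E T \<Longrightarrow> S 0 = 0"
  using op_scaleR[OF _ L2_zero, of S 0] by simp

lemma op_diff:
  assumes S: "S \<in> A_linear_ops E T" and x: "x \<in> L2 E T" and y: "y \<in> L2 E T"
  shows "S (x - y) = S x - S y"
  using op_add[OF S L2_diff[OF x y] y] by (simp add: eq_diff_eq)

lemma A_linear_ops_combine:
  assumes P: "P \<in> A_linear_ops E T" and N: "N \<in> A_linear_ops E T"
  shows "P + N \<in> A_linear_ops E T" "P - N \<in> A_linear_ops E T"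
    "(\<lambda>x. c *\<^sub>R P x) \<in> A_linear_ops E T" "P \<circ> N \<in> A_linear_ops E T"
  using P N op_zero[OF P]
  by (auto simp: A_linear_ops_def L2_add L2_diff L2_scaleR algebra_simps)

lemma BT_A_linear: "S \<in> BT E T \<Longrightarrow> S \<in> A_linear_ops E T"
  by (simp add: BT_def)

lemma BT_obtain:
  assumes "S \<in> BT E T"
  obtains k where "k \<in> rangeT E T" "0 \<le> k" "\<And>x. x \<in> L2 E T \<Longrightarrow> nrm (S x) \<le> k * nrm x"
  using assms by (auto simp: BT_def strong_bound_def)

lemma BT_I:
  assumes "S \<in> A_linear_ops E T" "k \<in> rangeT E T" "0 \<le> k"
    and "\<And>x. x \<in> L2 E T \<Longrightarrow> nrm (S x) \<le> k * nrm x"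
  shows "S \<in> BT E T"
  using assms by (auto simp: BT_def strong_bound_def)

lemma BT_add:
  assumes P: "P \<in> BT E T" and N: "N \<in> BT E T"
  shows "P + N \<in> BT E T"
proof -
  note PA = BT_A_linear[OF P] and NA = BT_A_linear[OF N]
  obtain k where k: "k \<in> rangeT E T" "0 \<le> k" "\<And>x. x \<in> L2 E T \<Longrightarrow> nrm (P x) \<le> k * nrm x"
    using P by (rule BT_obtain) blast
  obtain l where l: "l \<in> rangeT E T" "0 \<le> l" "\<And>x. x \<in> L2 E T \<Longrightarrow> nrm (N x) \<le> l * nrm x"
    using N by (rule BT_obtain) blast
  show ?thesis
  proof (rule BT_I)
    show "P + N \<in> A_linear_ops E T" using PA NA by (rule A_linear_ops_combine)
    show "k + l \<in> rangeT E T" using k(1) l(1) by (rule rangeT_add)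
    show "0 \<le> k + l" using k(2) l(2) by simp
    fix x assume x: "x \<in> L2 E T"
    have "nrm (P x + N x) \<le> nrm (P x) + nrm (N x)"
      using op_in[OF PA x] op_in[OF NA x] by (rule nrm_triangle)
    also have "\<dots> \<le> k * nrm x + l * nrm x" using k(3)[OF x] l(3)[OF x] by (rule add_mono)
    finally show "nrm ((P + N) x) \<le> (k + l) * nrm x" by (simp add: distrib_right)
  qed
qed

lemma BT_scaleR:
  assumes P: "P \<in> BT E T"
  shows "(\<lambda>x. c *\<^sub>R P x) \<in> BT E T"
proof -
  note PA = BT_A_linear[OF P]
  obtain k where k: "k \<in> rangeT E T" "0 \<le> k" "\<And>x. x \<in> L2 E T \<Longrightarrow> nrm (P x) \<le> k * nrm x"
    using P by (rule BT_obtain) blast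
  show ?thesis
  proof (rule BT_I)
    show "(\<lambda>x. c *\<^sub>R P x) \<in> A_linear_ops E T" using PA PA by (rule A_linear_ops_combine)
    show "\<bar>c\<bar> *\<^sub>R k \<in> rangeT E T" using k(1) by (rule rangeT_scaleR)
    show "0 \<le> \<bar>c\<bar> *\<^sub>R k" using k(2) by (simp add: scaleR_nonneg_nonneg)
    fix x assume x: "x \<in> L2 E T"
    have "nrm (c *\<^sub>R P x) = \<bar>c\<bar> *\<^sub>R nrm (P x)" using op_in[OF PA x] by (rule nrm_scaleR)
    also have "\<dots> \<le> \<bar>c\<bar> *\<^sub>R (k * nrm x)" using k(3)[OF x] by (rule scaleR_left_mono) simp
    finally show "nrm (c *\<^sub>R P x) \<le> (\<bar>c\<bar> *\<^sub>R k) * nrm x" by simp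
  qed
qed

lemma BT_diff:
  assumes P: "P \<in> BT E T" and N: "N \<in> BT E T"
  shows "P - N \<in> BT E T"
proof -
  have "P + (\<lambda>x. (- 1) *\<^sub>R N x) = P - N" by (rule ext) simp
  then show ?thesis using BT_add[OF P BT_scaleR[OF N, of "- 1"]] by simp
qed

lemma BT_comp:
  assumes P: "P \<in> BT E T" and N: "N \<in> BT E T"
  shows "P \<circ> N \<in> BT E T"
proof -
  note PA = BT_A_linear[OF P] and NA = BT_A_linear[OF N]
  obtain k where k: "k \<in> rangeT E T" "0 \<le> k" "\<And>x. x \<in> L2 E T \<Longrightarrow> nrm (P x) \<le> k * nrm x"
    using P by (rule BT_obtain) blast
  obtain l where l: "l \<in> rangeT E T" "0 \<le> l" "\<And>x. x \<in> L2 E T \<Longrightarrow> nrm (N x) \<le> l * nrm x"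
    using N by (rule BT_obtain) blast
  show ?thesis
  proof (rule BT_I)
    show "P \<circ> N \<in> A_linear_ops E T" using PA NA by (rule A_linear_ops_combine)
    show "k * l \<in> rangeT E T" using k(1) l(1) by (rule rangeT_mult)
    show "0 \<le> k * l" using k(2) l(2) by simp
    fix x assume x: "x \<in> L2 E T"
    have "nrm (P (N x)) \<le> k * nrm (N x)" using op_in[OF NA x] by (rule k(3))
    also have "\<dots> \<le> k * (l * nrm x)" using l(3)[OF x] k(2) by (rule mult_left_mono)
    finally show "nrm ((P \<circ> N) x) \<le> (k * l) * nrm x" by (simp add: mult.assoc)
  qed
qed

lemma BT_posI:
  "S \<in> BT E T \<Longrightarrow> (\<And>x. x \<in> L2 E T \<Longrightarrow> 0 \<le> x \<Longrightarrow> 0 \<le> S x) \<Longrightarrow> S \<in> BT_pos E T"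
  by (simp add: BT_pos_def order_positive_def)

lemma BT_pos_BT: "S \<in> BT_pos E T \<Longrightarrow> S \<in> BT E T"
  and BT_pos_nonneg: "S \<in> BT_pos E T \<Longrightarrow> x \<in> L2 E T \<Longrightarrow> 0 \<le> x \<Longrightarrow> 0 \<le> S x"
  by (simp_all add: BT_pos_def order_positive_def)

lemma BT_pos_A_linear: "S \<in> BT_pos E T \<Longrightarrow> S \<in> A_linear_ops E T"
  by (intro BT_A_linear BT_pos_BT)

lemma BT_pos_add: "P \<in> BT_pos E T \<Longrightarrow> N \<in> BT_pos E T \<Longrightarrow> P + N \<in> BT_pos E T"
  by (rule BT_posI) (simp_all add: BT_add BT_pos_BT BT_pos_nonneg)

lemma BT_pos_scaleR: "P \<in> BT_pos E T \<Longrightarrow> 0 \<le> c \<Longrightarrow> (\<lambda>x. c *\<^sub>R P x) \<in> BT_pos E T"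
  by (rule BT_posI) (simp_all add: BT_scaleR BT_pos_BT BT_pos_nonneg scaleR_nonneg_nonneg)

lemma BT_pos_comp: "P \<in> BT_pos E T \<Longrightarrow> N \<in> BT_pos E T \<Longrightarrow> P \<circ> N \<in> BT_pos E T"
  by (rule BT_posI) (simp_all add: BT_comp BT_pos_BT BT_pos_nonneg op_in[OF BT_pos_A_linear])

lemma BT_pos_id: "op_id (L2 E T) \<in> BT_pos E T"
proof (rule BT_posI[OF BT_I[where k = 1]])
  show "op_id (L2 E T) \<in> A_linear_ops E T"
    by (simp add: A_linear_ops_def op_id_def L2_add L2_module)
qed (simp_all add: op_id_def rangeT_one one_nonneg)

lemma BT_pos_zero: "0 \<in> BT_pos E T"
proof -
  have "(\<lambda>x. 0 *\<^sub>R op_id (L2 E T) x) = 0" by (rule ext) simp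
  then show ?thesis using BT_pos_scaleR[OF BT_pos_id, of 0] by simp
qed

lemma BT_regI: "P \<in> BT_pos E T \<Longrightarrow> N \<in> BT_pos E T \<Longrightarrow> P - N \<in> BT_reg E T"
  by (auto simp: BT_reg_def)

lemma BT_reg_cases:
  assumes "R \<in> BT_reg E T"
  obtains P N where "P \<in> BT_pos E T" "N \<in> BT_pos E T" "R = P - N"
  using assms by (auto simp: BT_reg_def)

lemma BT_pos_reg: "P \<in> BT_pos E T \<Longrightarrow> P \<in> BT_reg E T"
  using BT_regI[OF _ BT_pos_zero, of P] by simp

lemma BT_reg_add:
  assumes "R \<in> BT_reg E T" "Q \<in> BT_reg E T"
  shows "R + Q \<in> BT_reg E T"
proof -
  obtain P N where PN: "P \<in> BT_pos E T" "N \<in> BT_pos E T" "R = P - N"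
    using assms(1) by (rule BT_reg_cases)
  obtain P' N' where PN': "P' \<in> BT_pos E T" "N' \<in> BT_pos E T" "Q = P' - N'"
    using assms(2) by (rule BT_reg_cases)
  have "R + Q = (P + P') - (N + N')" unfolding PN(3) PN'(3) by (rule add_diff_add[symmetric])
  then show ?thesis using PN PN' by (simp only: BT_regI BT_pos_add)
qed

lemma BT_reg_scaleR:
  assumes "R \<in> BT_reg E T"
  shows "(\<lambda>x. c *\<^sub>R R x) \<in> BT_reg E T"
proof -
  obtain P N where PN: "P \<in> BT_pos E T" "N \<in> BT_pos E T" "R = P - N"
    using assms by (rule BT_reg_cases)
  show ?thesis
  proof (cases "0 \<le> c")
    case True
    have "(\<lambda>x. c *\<^sub>R R x) = (\<lambda>x. c *\<^sub>R P x) - (\<lambda>x. c *\<^sub>R N x)"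
      by (rule ext) (simp add: PN(3) scaleR_diff_right)
    then show ?thesis using PN True by (simp only: BT_regI BT_pos_scaleR)
  next
    case False
    have "(\<lambda>x. c *\<^sub>R R x) = (\<lambda>x. (- c) *\<^sub>R N x) - (\<lambda>x. (- c) *\<^sub>R P x)"
      by (rule ext) (simp add: PN(3) scaleR_diff_right)
    moreover have "0 \<le> - c" using False by simp
    ultimately show ?thesis using PN by (simp only: BT_regI BT_pos_scaleR)
  qed
qed

lemma BT_reg_diff:
  assumes "R \<in> BT_reg E T" "Q \<in> BT_reg E T"
  shows "R - Q \<in> BT_reg E T"
proof -
  have "R + (\<lambda>x. (- 1) *\<^sub>R Q x) = R - Q" by (rule ext) simp
  then show ?thesis using BT_reg_add[OF assms(1) BT_reg_scaleR[OF assms(2), of "- 1"]] by simp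
qed

lemma BT_reg_BT: "R \<in> BT_reg E T \<Longrightarrow> R \<in> BT E T"
  by (erule BT_reg_cases) (simp add: BT_diff BT_pos_BT)

lemma BT_reg_A_linear: "R \<in> BT_reg E T \<Longrightarrow> R \<in> A_linear_ops E T"
  by (intro BT_A_linear BT_reg_BT)

lemma BT_reg_comp:
  assumes "R \<in> BT_reg E T" "Q \<in> BT_reg E T"
  shows "R \<circ> Q \<in> BT_reg E T"
proof -
  obtain P N where PN: "P \<in> BT_pos E T" "N \<in> BT_pos E T" "R = P - N"
    using assms(1) by (rule BT_reg_cases)
  obtain P' N' where PN': "P' \<in> BT_pos E T" "N' \<in> BT_pos E T" "Q = P' - N'"
    using assms(2) by (rule BT_reg_cases)
  have "R \<circ> Q = ((P \<circ> P') + (N \<circ> N')) - ((P \<circ> N') + (N \<circ> P'))"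
  proof (rule ext)
    fix x
    show "(R \<circ> Q) x = (((P \<circ> P') + (N \<circ> N')) - ((P \<circ> N') + (N \<circ> P'))) x"
    proof (cases "x \<in> L2 E T")
      case True
      then show ?thesis
        using op_diff[OF BT_pos_A_linear[OF PN(1)]] op_diff[OF BT_pos_A_linear[OF PN(2)]]
          op_in[OF BT_pos_A_linear[OF PN'(1)]] op_in[OF BT_pos_A_linear[OF PN'(2)]]
        by (simp add: PN(3) PN'(3))
    next
      case False
      then show ?thesis
        using op_outside[OF BT_pos_A_linear[OF PN'(1)]] op_outside[OF BT_pos_A_linear[OF PN'(2)]]
          op_zero[OF BT_pos_A_linear[OF PN(1)]] op_zero[OF BT_pos_A_linear[OF PN(2)]]
        by (simp add: PN(3) PN'(3))
    qed
  qed
  then show ?thesis using PN PN' by (simp only: BT_regI BT_pos_add BT_pos_comp)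
qed

section \<open>Operator order and domination\<close>

lemma op_le_iff: "op_le (L2 E T) R Q \<longleftrightarrow> (\<forall>x\<in>L2 E T. 0 \<le> x \<longrightarrow> R x \<le> Q x)"
  by (simp add: op_le_def order_positive_def)

text \<open>Splitting u into positive and negative parts gives the bound D |u|; and D is positive on
  the cone, since it dominates a modulus there, so D |u| \<le> D x. A general D serves both for P +
  N and for the minimality of |S|.\<close>

lemma abs_op_le:
  assumes S: "S \<in> A_linear_ops E T" and D: "D \<in> A_linear_ops E T"
    and dom: "\<And>x. x \<in> L2 E T \<Longrightarrow> 0 \<le> x \<Longrightarrow> \<bar>S x\<bar> \<le> D x"
    and u: "u \<in> L2 E T" "\<bar>u\<bar> \<le> x" and x: "x \<in> L2 E T"
  shows "\<bar>S u\<bar> \<le> D x"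
proof -
  have p: "pprt u \<in> L2 E T" "pprt (- u) \<in> L2 E T" using u by (simp_all add: L2_pprt L2_minus)
  have xu: "x - \<bar>u\<bar> \<in> L2 E T" "0 \<le> x - \<bar>u\<bar>" using u x by (simp_all add: L2_diff L2_abs)
  have "S u = S (pprt u) - S (pprt (- u))"
    using op_diff[OF S p] by (simp only: pprt_minus_pprt)
  then have "\<bar>S u\<bar> \<le> \<bar>S (pprt u)\<bar> + \<bar>S (pprt (- u))\<bar>" by (simp only: abs_triangle_ineq4)
  also have "\<dots> \<le> D (pprt u) + D (pprt (- u))" by (intro add_mono dom p) simp_all
  also have "\<dots> = D \<bar>u\<bar>" using op_add[OF D p] by (simp only: abs_eq_pprt_add)
  also have "\<dots> \<le> D \<bar>u\<bar> + D (x - \<bar>u\<bar>)"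
    using order_trans[OF abs_ge_zero dom[OF xu]] by simp
  also have "\<dots> = D x" using op_add[OF D L2_abs[OF u(1)] xu(1)] by simp
  finally show ?thesis .
qed

lemma abs_diff_op_le:
  assumes "P \<in> BT_pos E T" "N \<in> BT_pos E T" "u \<in> L2 E T" "\<bar>u\<bar> \<le> x" "x \<in> L2 E T"
  shows "\<bar>(P - N) u\<bar> \<le> (P + N) x"
proof (rule abs_op_le[where S = "P - N" and D = "P + N"])
  show "P - N \<in> A_linear_ops E T" "P + N \<in> A_linear_ops E T"
    using assms by (simp_all add: A_linear_ops_combine BT_pos_A_linear)
  fix y assume y: "y \<in> L2 E T" "0 \<le> y"
  then show "\<bar>(P - N) y\<bar> \<le> (P + N) y"
    using abs_triangle_ineq4[of "P y" "N y"] BT_pos_nonneg assms by simp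
qed (use assms in simp_all)

lemma BT_reg_LbA: "BT_reg E T \<subseteq> LbA E T"
proof
  fix R assume R: "R \<in> BT_reg E T"
  then obtain P N where PN: "P \<in> BT_pos E T" "N \<in> BT_pos E T" "R = P - N" by (rule BT_reg_cases)
  show "R \<in> LbA E T"
    unfolding LbA_def
  proof (intro CollectI conjI ballI BT_reg_A_linear[OF R])
    fix u v assume uv: "u \<in> L2 E T" "v \<in> L2 E T"
    let ?y = "\<bar>u\<bar> + \<bar>v\<bar>"
    have y: "?y \<in> L2 E T" using uv by (intro L2_add L2_abs)
    have b: "(P + N) ?y \<in> L2 E T"
      using op_in[OF BT_pos_A_linear[OF BT_pos_add[OF PN(1,2)]] y] .
    have "- (P + N) ?y \<le> R x \<and> R x \<le> (P + N) ?y" if x: "x \<in> L2 E T" "u \<le> x \<and> x \<le> v" for x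
    proof -
      have "x \<le> \<bar>v\<bar>" "- x \<le> \<bar>u\<bar>"
        using x(2) abs_ge_self[of v] order_trans[of "- x" "- u" "\<bar>u\<bar>"]
        by (auto intro: order_trans abs_ge_minus_self)
      then have "\<bar>x\<bar> \<le> ?y"
        by (intro abs_leI) (simp_all add: add_increasing add_increasing2)
      then have "\<bar>R x\<bar> \<le> (P + N) ?y"
        unfolding PN(3) using PN x(1) y by (intro abs_diff_op_le)
      then have "R x \<le> (P + N) ?y" "- R x \<le> (P + N) ?y" by (simp_all only: abs_le_iff)
      then show ?thesis using minus_le_iff[of "R x" "(P + N) ?y"] by blast
    qed
    then show "\<exists>a\<in>L2 E T. \<exists>b\<in>L2 E T. \<forall>x\<in>L2 E T. u \<le> x \<and> x \<le> v \<longrightarrow> a \<le> R x \<and> R x \<le> b"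
      using b L2_minus[OF b] by blast
  qed
qed

section \<open>The Riesz-Kantorovich modulus of P - N\<close>

context
  fixes P N S :: "'a \<Rightarrow> 'a"
  assumes P: "P \<in> BT_pos E T" and N: "N \<in> BT_pos E T" and S: "S = P - N"
begin

abbreviation (input) RK :: "'a \<Rightarrow> 'a" where "RK \<equiv> RK_abs (L2 E T) S"
abbreviation (input) absS :: "'a \<Rightarrow> 'a" where "absS \<equiv> ord_abs (L2 E T) S"

lemma S_A_linear: "S \<in> A_linear_ops E T"
  and PN_A_linear: "P + N \<in> A_linear_ops E T"
  using P N by (simp_all add: S A_linear_ops_combine BT_pos_A_linear)

lemma abs_S_le: "u \<in> L2 E T \<Longrightarrow> \<bar>u\<bar> \<le> x \<Longrightarrow> x \<in> L2 E T \<Longrightarrow> \<bar>S u\<bar> \<le> (P + N) x"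
  unfolding S using P N by (rule abs_diff_op_le)

text \<open>The elements |S u| are bounded by (P + N) x. Their supremum in E^u lies between 0 and
  this element of the ideal H, so it belongs to H and is the supremum relative to H that
  \<open>RK_abs\<close> describes.\<close>

lemma
  assumes x: "x \<in> L2 E T" "0 \<le> x"
  shows RK_in: "RK x \<in> L2 E T" and RK_nonneg: "0 \<le> RK x" and RK_le: "RK x \<le> (P + N) x"
    and RK_upper: "u \<in> L2 E T \<Longrightarrow> \<bar>u\<bar> \<le> x \<Longrightarrow> \<bar>S u\<bar> \<le> RK x"
    and RK_least: "(\<And>u. u \<in> L2 E T \<Longrightarrow> \<bar>u\<bar> \<le> x \<Longrightarrow> \<bar>S u\<bar> \<le> m) \<Longrightarrow> RK x \<le> m"
proof -
  let ?K = "{\<bar>S u\<bar> | u. u \<in> L2 E T \<and> \<bar>u\<bar> \<le> x}"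
  have 0: "0 \<in> ?K" using op_zero[OF S_A_linear] L2_zero x(2) by force
  then have ne: "?K \<noteq> {}" by blast
  have bdd: "bdd_above ?K" using abs_S_le x(1) by (intro bdd_aboveI[of _ "(P + N) x"]) auto
  have le: "Sup ?K \<le> (P + N) x" using abs_S_le x(1) by (intro cSup_least ne) auto
  have nn: "0 \<le> Sup ?K" using 0 bdd by (rule cSup_upper)
  have inH: "Sup ?K \<in> L2 E T" using op_in[OF PN_A_linear x(1)] nn le by (rule L2_le)
  have "RK x = Sup ?K"
    unfolding RK_abs_def
  proof (rule the_equality)
    show lub: "lub_in (\<le>) (L2 E T) ?K (Sup ?K)"
      using inH lub_in_cSup[OF ne bdd] by (simp add: lub_in_def)
    fix s assume "lub_in (\<le>) (L2 E T) ?K s"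
    with lub show "s = Sup ?K" unfolding lub_in_def by (intro order.antisym) simp_all
  qed
  then show "RK x \<in> L2 E T" "0 \<le> RK x" "RK x \<le> (P + N) x"
    "u \<in> L2 E T \<Longrightarrow> \<bar>u\<bar> \<le> x \<Longrightarrow> \<bar>S u\<bar> \<le> RK x"
    "(\<And>u. u \<in> L2 E T \<Longrightarrow> \<bar>u\<bar> \<le> x \<Longrightarrow> \<bar>S u\<bar> \<le> m) \<Longrightarrow> RK x \<le> m"
    using inH nn le cSup_upper[OF _ bdd] cSup_least[OF ne, of m] by auto
qed

lemma RK_add:
  assumes x: "x \<in> L2 E T" "0 \<le> x" and y: "y \<in> L2 E T" "0 \<le> y"
  shows "RK (x + y) = RK x + RK y"
proof (rule order.antisym)
  have xy: "x + y \<in> L2 E T" "0 \<le> x + y" using x y by (simp_all add: L2_add)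
  show "RK (x + y) \<le> RK x + RK y"
  proof (rule RK_least[OF xy])
    fix u assume u: "u \<in> L2 E T" "\<bar>u\<bar> \<le> x + y"
    \<comment> \<open>u clipped to the order interval from -x to x; the rest u - v is then at most y
      in modulus.\<close>
    define v where "v = sup (inf u x) (- x)"
    have u_le: "u \<le> x + y" "- u \<le> x + y" using u(2) by (simp_all add: abs_le_iff)
    have v1: "\<bar>v\<bar> \<le> x"
    proof (rule abs_leI)
      show "v \<le> x" using x(2) by (simp add: v_def minus_le_self_iff)
      have "- x \<le> v" unfolding v_def by (rule sup_ge2)
      then show "- v \<le> x" by (simp only: minus_le_iff)
    qed
    have v: "v \<in> L2 E T" using x(1) by (rule L2_solid) (use v1 x(2) in simp)
    have "u - y \<le> v"
    proof -
      have "u - y \<le> inf u x" using u_le y(2) by (simp add: diff_le_eq)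
      then show ?thesis unfolding v_def by (rule le_supI1)
    qed
    moreover have "v \<le> u + y"
    proof -
      have "- u + (u - x) \<le> (x + y) + (u - x)" using u_le(2) by (rule add_right_mono)
      then have "- x \<le> u + y" by (simp add: algebra_simps)
      moreover have "inf u x \<le> u + y" using y(2) by (intro le_infI1) simp
      ultimately show ?thesis by (simp add: v_def)
    qed
    ultimately have uv: "\<bar>u - v\<bar> \<le> y" by (intro abs_leI) (simp_all add: algebra_simps)
    have "S u = S v + S (u - v)"
      using op_add[OF S_A_linear v L2_diff[OF u(1) v]] by simp
    then have "\<bar>S u\<bar> \<le> \<bar>S v\<bar> + \<bar>S (u - v)\<bar>" by (simp only: abs_triangle_ineq)
    also have "\<dots> \<le> RK x + RK y"
      using RK_upper[OF x v v1] RK_upper[OF y L2_diff[OF u(1) v] uv] by (rule add_mono)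
    finally show "\<bar>S u\<bar> \<le> RK x + RK y" .
  qed
  have "RK x \<le> RK (x + y) - RK y"
  proof (rule RK_least[OF x])
    fix u assume u: "u \<in> L2 E T" "\<bar>u\<bar> \<le> x"
    have "RK y \<le> RK (x + y) - \<bar>S u\<bar>"
    proof (rule RK_least[OF y])
      fix v assume v: "v \<in> L2 E T" "\<bar>v\<bar> \<le> y"
      \<comment> \<open>Both signs are needed, since |S u| + |S v| is the supremum of S u + S v, S u
        - S v and their negatives.\<close>
      have uv: "\<bar>u + v\<bar> \<le> x + y" "\<bar>u - v\<bar> \<le> x + y"
        using abs_triangle_ineq[of u v] abs_triangle_ineq4[of u v] add_mono[OF u(2) v(2)]
        by (auto intro: order_trans)
      have *: "\<bar>S (u + v)\<bar> \<le> RK (x + y)" "\<bar>S (u - v)\<bar> \<le> RK (x + y)"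
        using RK_upper[OF xy] uv u v by (simp_all add: L2_add L2_diff)
      then have "S u + S v \<le> RK (x + y)" "S u - S v \<le> RK (x + y)"
        "- (S u + S v) \<le> RK (x + y)" "- (S u - S v) \<le> RK (x + y)"
        unfolding op_add[OF S_A_linear u(1) v(1)] op_diff[OF S_A_linear u(1) v(1)] abs_le_iff
        by simp_all
      then have "\<bar>S u\<bar> \<le> RK (x + y) - S v" "\<bar>S u\<bar> \<le> RK (x + y) + S v"
        by (intro abs_leI; simp add: algebra_simps)+
      then have "S v \<le> RK (x + y) - \<bar>S u\<bar>" "- S v \<le> RK (x + y) - \<bar>S u\<bar>"
        by (simp_all add: algebra_simps)
      then show "\<bar>S v\<bar> \<le> RK (x + y) - \<bar>S u\<bar>" by (rule abs_leI)
    qed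
    then show "\<bar>S u\<bar> \<le> RK (x + y) - RK y" by (simp add: le_diff_eq add.commute)
  qed
  then show "RK x + RK y \<le> RK (x + y)" by (simp add: le_diff_eq)
qed

text \<open>Multiplication by a maps the u with |u| \<le> x into those with |u| \<le> a x and passes
  through suprema. As a may have no inverse, the image need not be all of the latter set, hence only
  an inequality at this point.\<close>

lemma RK_mult_ge:
  assumes a: "a \<in> rangeT E T" "0 \<le> a" and x: "x \<in> L2 E T" "0 \<le> x"
  shows "a * RK x \<le> RK (a * x)"
proof -
  have ax: "a * x \<in> L2 E T" "0 \<le> a * x" using a x by (simp_all add: L2_module)
  let ?K = "{\<bar>S u\<bar> | u. u \<in> L2 E T \<and> \<bar>u\<bar> \<le> x}"
  have ne: "?K \<noteq> {}" using L2_zero x(2) by force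
  have bdd: "bdd_above ?K" using RK_upper[OF x] by (intro bdd_aboveI[of _ "RK x"]) auto
  have "RK x \<le> Sup ?K"
    using RK_least[OF x] cSup_upper[OF _ bdd] by blast
  then have "a * RK x \<le> a * Sup ?K" using a(2) by (rule mult_left_mono)
  also have "\<dots> \<le> RK (a * x)"
  proof (rule mult_cSup_le[OF a(2) ne bdd])
    fix d assume "d \<in> ?K"
    then obtain u where u: "d = \<bar>S u\<bar>" "u \<in> L2 E T" "\<bar>u\<bar> \<le> x" by blast
    have "\<bar>a * u\<bar> \<le> a * x"
      using mult_left_mono[OF u(3) a(2)] by (simp only: mult_abs_nonneg[OF a(2)])
    then have "\<bar>S (a * u)\<bar> \<le> RK (a * x)" by (rule RK_upper[OF ax L2_module[OF a(1) u(2)]])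
    then show "a * d \<le> RK (a * x)"
      by (simp only: u(1) mult_abs_nonneg[OF a(2)] op_hom[OF S_A_linear a(1) u(2)])
  qed
  finally show ?thesis .
qed

lemma RK_mono:
  assumes "x \<in> L2 E T" "0 \<le> x" "y \<in> L2 E T" "x \<le> y"
  shows "RK x \<le> RK y"
  using RK_add[of x "y - x"] RK_nonneg[of "y - x"] assms by (simp add: L2_diff)

lemma RK_scaleR:
  assumes x: "x \<in> L2 E T" "0 \<le> x" and c: "0 < c"
  shows "RK (c *\<^sub>R x) = c *\<^sub>R RK x"
proof -
  have ge: "d *\<^sub>R RK y \<le> RK (d *\<^sub>R y)" if "y \<in> L2 E T" "0 \<le> y" "0 < d" for d y
    using RK_mult_ge[OF rangeT_scalar scaleR_one_nonneg that(1,2), of d] that(3) by simp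
  have cx: "c *\<^sub>R x \<in> L2 E T" "0 \<le> c *\<^sub>R x"
    using x c by (simp_all add: L2_scaleR scaleR_nonneg_nonneg)
  have "(1 / c) *\<^sub>R RK (c *\<^sub>R x) \<le> RK x" using ge[OF cx, of "1 / c"] c by simp
  then have "c *\<^sub>R ((1 / c) *\<^sub>R RK (c *\<^sub>R x)) \<le> c *\<^sub>R RK x"
    using c by (intro scaleR_left_mono) simp_all
  then show ?thesis using ge[OF x c] c by (intro order.antisym) simp_all
qed

text \<open>For \<open>a\<close> bounded by \<open>n\<close>, additivity turns the inequality for \<open>a\<close> and \<open>n - a\<close> into an
  equality; the unbounded part \<open>a - inf a n\<close> is at most \<open>a * a / n\<close>.\<close>

lemma RK_mult:
  assumes a: "a \<in> rangeT E T" "0 \<le> a" and x: "x \<in> L2 E T" "0 \<le> x"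
  shows "RK (a * x) = a * RK x"
proof (rule order.antisym[OF _ RK_mult_ge[OF a x]])
  have "RK (a * x) - a * RK x \<le> 0"
  proof (rule archimedean_nat)
    fix n :: nat assume n: "0 < n"
    let ?n = "real n *\<^sub>R (1::'a)"
    define b where "b = inf a ?n"
    have n0: "0 \<le> ?n" by (rule scaleR_one_nonneg) simp
    have b: "b \<in> rangeT E T" "0 \<le> b" "b \<le> a"
      using a n0 unfolding b_def by (simp_all add: rangeT_inf rangeT_scalar)
    have nb: "?n - b \<in> rangeT E T" "0 \<le> ?n - b"
      unfolding b_def using b(1)[unfolded b_def] by (intro rangeT_diff rangeT_scalar) (simp_all del: diff_inf_eq_sup)
    have ab: "a - b \<in> rangeT E T" "0 \<le> a - b" using a b by (simp_all add: rangeT_diff)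
    have bx: "b * x \<in> L2 E T" "0 \<le> b * x" using b x by (simp_all add: L2_module)
    have nbx: "(?n - b) * x \<in> L2 E T" "0 \<le> (?n - b) * x"
      using nb x by (simp_all add: L2_module del: left_diff_distrib)
    have abx: "(a - b) * x \<in> L2 E T" "0 \<le> (a - b) * x" using ab x by (simp_all add: L2_module)
    have aax: "(a * a) * x \<in> L2 E T" "0 \<le> (a * a) * x"
      using a x by (simp_all add: L2_module rangeT_square)
    have "RK (b * x) + (?n - b) * RK x \<le> RK (b * x) + RK ((?n - b) * x)"
      using RK_mult_ge[OF nb x] by (rule add_left_mono)
    also have "\<dots> = RK (b * x + (?n - b) * x)" by (rule RK_add[OF bx nbx, symmetric])
    also have "b * x + (?n - b) * x = real n *\<^sub>R x" by (simp add: left_diff_distrib)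
    also have "RK (real n *\<^sub>R x) = ?n * RK x" using RK_scaleR[OF x] n by simp
    finally have le_b: "RK (b * x) \<le> b * RK x" by (simp add: left_diff_distrib)
    have "(a - b) * x \<le> ((1 / real n) *\<^sub>R (a * a)) * x"
      using scaled_pprt_le_square_nat[OF n a(2)] x(2) unfolding b_def by (rule mult_right_mono)
    then have "RK ((a - b) * x) \<le> RK ((1 / real n) *\<^sub>R ((a * a) * x))"
      using aax by (intro RK_mono[OF abx]) (simp_all add: L2_scaleR)
    also have "\<dots> = (1 / real n) *\<^sub>R RK ((a * a) * x)" using RK_scaleR[OF aax] n by simp
    finally have le_ab: "RK ((a - b) * x) \<le> (1 / real n) *\<^sub>R RK ((a * a) * x)" .
    have "RK (a * x) = RK (b * x) + RK ((a - b) * x)"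
      using RK_add[OF bx abx] by (simp add: left_diff_distrib)
    also have "\<dots> \<le> b * RK x + (1 / real n) *\<^sub>R RK ((a * a) * x)" using le_b le_ab by (rule add_mono)
    also have "\<dots> \<le> a * RK x + (1 / real n) *\<^sub>R RK ((a * a) * x)"
      using b(3) RK_nonneg[OF x] by (intro add_right_mono mult_right_mono)
    finally show "RK (a * x) - a * RK x \<le> (1 / real n) *\<^sub>R RK ((a * a) * x)"
      by (simp add: diff_le_eq add.commute)
  next
    show "0 \<le> RK ((a * a) * x)" using a x by (intro RK_nonneg) (simp_all add: L2_module rangeT_square)
  qed
  then show "RK (a * x) \<le> a * RK x" by simp
qed

text \<open>Additivity of RK on the cone makes the value independent of how an element is written as
  a difference of positive ones, so linearity can be checked on any convenient
  decomposition.\<close>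

lemma ord_abs_diff:
  assumes p: "p \<in> L2 E T" "0 \<le> p" and q: "q \<in> L2 E T" "0 \<le> q"
  shows "absS (p - q) = RK p - RK q"
proof -
  let ?x = "p - q"
  have x: "?x \<in> L2 E T" using p q by (intro L2_diff)
  have xp: "pprt ?x \<in> L2 E T" "0 \<le> pprt ?x" "pprt (- ?x) \<in> L2 E T" "0 \<le> pprt (- ?x)"
    using L2_pprt[OF x] L2_pprt[OF L2_minus[OF x]] by (simp_all only: zero_le_pprt)
  have "pprt ?x + q = p + pprt (- ?x)"
    using pprt_minus_pprt[of ?x] by (simp add: algebra_simps)
  then have "RK (pprt ?x) + RK q = RK p + RK (pprt (- ?x))"
    using RK_add[OF xp(1,2) q] RK_add[OF p xp(3,4)] by simp
  then have "RK (pprt ?x) - RK (pprt (- ?x)) = RK p - RK q" by (rule diff_eq_diffI)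
  then show ?thesis using x by (simp only: ord_abs_def pprt_def if_True)
qed

lemma ord_abs_nonneg:
  assumes x: "x \<in> L2 E T" "0 \<le> x"
  shows "absS x = RK x"
proof -
  have "RK 0 = 0" using RK_add[OF L2_zero _ L2_zero] by simp
  then show ?thesis using ord_abs_diff[OF x L2_zero] by simp
qed

lemma ord_abs_A_linear: "absS \<in> A_linear_ops E T"
  unfolding A_linear_ops_def
proof (intro CollectI conjI ballI allI impI)
  have parts: "pprt x \<in> L2 E T" "pprt (- x) \<in> L2 E T" if "x \<in> L2 E T" for x
    using that by (simp_all add: L2_pprt L2_minus)
  have absS: "absS x = RK (pprt x) - RK (pprt (- x))" if "x \<in> L2 E T" for x
    using ord_abs_diff[OF parts(1)[OF that] _ parts(2)[OF that]] by (simp add: pprt_minus_pprt)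
  show "absS x \<in> L2 E T" if "x \<in> L2 E T" for x
    unfolding absS[OF that] using parts[OF that] by (intro L2_diff RK_in) simp_all
  show "absS x = 0" if "x \<notin> L2 E T" for x using that by (simp add: ord_abs_def)
  fix x assume x: "x \<in> L2 E T"
  note xp = parts[OF x]
  show "absS (x + y) = absS x + absS y" if y: "y \<in> L2 E T" for y
  proof -
    note yp = parts[OF y]
    have "x + y = (pprt x + pprt y) - (pprt (- x) + pprt (- y))"
      by (simp only: add_diff_add pprt_minus_pprt)
    then have "absS (x + y) = RK (pprt x + pprt y) - RK (pprt (- x) + pprt (- y))"
      using ord_abs_diff[OF L2_add[OF xp(1) yp(1)] _ L2_add[OF xp(2) yp(2)]] by (simp only: add_nonneg_nonneg zero_le_pprt)
    then show ?thesis
      using RK_add[OF xp(1) _ yp(1)] RK_add[OF xp(2) _ yp(2)] absS[OF x] absS[OF y]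
      by (simp add: add_diff_add)
  qed
  show "absS (a * x) = a * absS x" if a: "a \<in> rangeT E T" for a
  proof -
    have ap: "pprt a \<in> rangeT E T" "pprt (- a) \<in> rangeT E T"
      using a by (simp_all add: rangeT_pprt rangeT_minus)
    define p where "p b y = pprt b * pprt y" for b y :: 'a
    have m: "p b y \<in> L2 E T" "0 \<le> p b y" "RK (p b y) = pprt b * RK (pprt y)"
      if "pprt b \<in> rangeT E T" "pprt y \<in> L2 E T" for b y
      unfolding p_def using that by (simp_all add: L2_module RK_mult)
    \<comment> \<open>The four products of parts are positive; regrouped by sign they decompose a x
      in a form to which \<open>ord_abs_diff\<close> applies.\<close>
    have "a * x = (pprt a - pprt (- a)) * (pprt x - pprt (- x))" by (simp only: pprt_minus_pprt)
    also have "\<dots> = (p a x + p (- a) (- x)) - (p (- a) x + p a (- x))"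
      by (simp add: p_def algebra_simps)
    finally have "absS (a * x) = RK (p a x + p (- a) (- x)) - RK (p (- a) x + p a (- x))"
      using m ap xp by (simp only: ord_abs_diff L2_add add_nonneg_nonneg)
    also have "\<dots> = (pprt a - pprt (- a)) * (RK (pprt x) - RK (pprt (- x)))"
      using m ap xp by (simp add: RK_add algebra_simps)
    finally show ?thesis by (simp only: pprt_minus_pprt absS[OF x])
  qed
qed

text \<open>The norm is monotone in the modulus and equal at x and |x|, so the estimate is made at
  |x|, where P |x| + N |x| is the dominating element.\<close>

lemma ord_abs_nrm_le:
  assumes k: "\<And>x. x \<in> L2 E T \<Longrightarrow> nrm (P x) \<le> kP * nrm x"
    and l: "\<And>x. x \<in> L2 E T \<Longrightarrow> nrm (N x) \<le> kN * nrm x"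
    and x: "x \<in> L2 E T"
  shows "nrm (absS x) \<le> (kP + kN) * nrm x"
proof -
  have xa: "\<bar>x\<bar> \<in> L2 E T" using x by (rule L2_abs)
  have inP: "P \<bar>x\<bar> \<in> L2 E T" and inN: "N \<bar>x\<bar> \<in> L2 E T"
    using P N xa by (simp_all add: op_in[OF BT_pos_A_linear])
  have "\<bar>absS x\<bar> \<le> RK \<bar>x\<bar>"
  proof -
    have p: "pprt x \<in> L2 E T" "pprt (- x) \<in> L2 E T" using x by (simp_all add: L2_pprt L2_minus)
    have "absS x = RK (pprt x) - RK (pprt (- x))"
      using ord_abs_diff[OF p(1) _ p(2)] by (simp add: pprt_minus_pprt)
    then have "\<bar>absS x\<bar> \<le> \<bar>RK (pprt x)\<bar> + \<bar>RK (pprt (- x))\<bar>" by (simp only: abs_triangle_ineq4)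
    also have "\<dots> = RK (pprt x) + RK (pprt (- x))" using RK_nonneg p by simp
    also have "\<dots> = RK \<bar>x\<bar>" using RK_add[OF p(1) _ p(2)] by (simp add: abs_eq_pprt_add)
    finally show ?thesis .
  qed
  also have "\<dots> \<le> P \<bar>x\<bar> + N \<bar>x\<bar>" using RK_le[OF xa] by simp
  also have "\<dots> \<le> \<bar>P \<bar>x\<bar> + N \<bar>x\<bar>\<bar>" by (rule abs_ge_self)
  finally have "nrm (absS x) \<le> nrm (P \<bar>x\<bar> + N \<bar>x\<bar>)" by (rule nrm_mono[OF L2_add[OF inP inN]])
  also have "\<dots> \<le> nrm (P \<bar>x\<bar>) + nrm (N \<bar>x\<bar>)" using inP inN by (rule nrm_triangle)
  also have "\<dots> \<le> kP * nrm \<bar>x\<bar> + kN * nrm \<bar>x\<bar>" using k[OF xa] l[OF xa] by (rule add_mono)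
  also have "\<dots> = (kP + kN) * nrm x" by (simp add: nrm_abs[OF x] distrib_right)
  finally show ?thesis .
qed

lemma ord_abs_BT_pos: "absS \<in> BT_pos E T"
proof (rule BT_posI)
  obtain k where k: "k \<in> rangeT E T" "0 \<le> k" "\<And>x. x \<in> L2 E T \<Longrightarrow> nrm (P x) \<le> k * nrm x"
    using BT_pos_BT[OF P] by (rule BT_obtain) blast
  obtain l where l: "l \<in> rangeT E T" "0 \<le> l" "\<And>x. x \<in> L2 E T \<Longrightarrow> nrm (N x) \<le> l * nrm x"
    using BT_pos_BT[OF N] by (rule BT_obtain) blast
  show "absS \<in> BT E T"
    using ord_abs_A_linear rangeT_add[OF k(1) l(1)] add_nonneg_nonneg[OF k(2) l(2)]
      ord_abs_nrm_le[OF k(3) l(3)] by (rule BT_I)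
  show "0 \<le> absS x" if "x \<in> L2 E T" "0 \<le> x" for x
    using that by (simp add: ord_abs_nonneg RK_nonneg)
qed

lemma abs_S_le_ord_abs:
  assumes x: "x \<in> L2 E T" "0 \<le> x"
  shows "\<bar>S x\<bar> \<le> absS x"
  using RK_upper[OF x x(1)] x by (simp add: ord_abs_nonneg)

text \<open>Minimality of the modulus: by \<open>abs_op_le\<close> each |S u| with |u| \<le> x is
  below D x. This yields least upper bounds among the regular operators.\<close>

lemma ord_abs_le:
  assumes D: "D \<in> A_linear_ops E T" "\<And>y. y \<in> L2 E T \<Longrightarrow> 0 \<le> y \<Longrightarrow> \<bar>S y\<bar> \<le> D y"
    and x: "x \<in> L2 E T" "0 \<le> x"
  shows "absS x \<le> D x"
proof -
  have "RK x \<le> D x"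
    by (rule RK_least[OF x]) (rule abs_op_le[OF S_A_linear D _ _ x(1)])
  then show ?thesis by (simp add: ord_abs_nonneg x)
qed

lemma ord_pos_neg_BT_pos: "ord_pos (L2 E T) S \<in> BT_pos E T" "ord_neg (L2 E T) S \<in> BT_pos E T"
proof -
  have SB: "S \<in> BT E T" unfolding S using P N by (intro BT_diff BT_pos_BT)
  have QB: "absS \<in> BT E T" using ord_abs_BT_pos by (rule BT_pos_BT)
  have eq: "ord_pos (L2 E T) S = (\<lambda>x. (1 / 2) *\<^sub>R (absS + S) x)"
    "ord_neg (L2 E T) S = (\<lambda>x. (1 / 2) *\<^sub>R (absS - S) x)"
    by (simp_all add: fun_eq_iff ord_pos_def ord_neg_def)
  have nn: "0 \<le> absS x + S x" "0 \<le> absS x - S x" if x: "x \<in> L2 E T" "0 \<le> x" for x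
  proof -
    have "- S x + S x \<le> absS x + S x"
      using abs_S_le_ord_abs[OF x] by (intro add_right_mono) (simp only: abs_le_iff)
    then show "0 \<le> absS x + S x" by simp
    show "0 \<le> absS x - S x"
      using abs_S_le_ord_abs[OF x] by (simp only: diff_ge_0_iff_ge abs_le_iff)
  qed
  show "ord_pos (L2 E T) S \<in> BT_pos E T"
    unfolding eq(1)
  proof (rule BT_posI)
    show "(\<lambda>x. (1 / 2) *\<^sub>R (absS + S) x) \<in> BT E T" using QB SB by (intro BT_scaleR BT_add)
    show "0 \<le> (1 / 2) *\<^sub>R (absS + S) x" if "x \<in> L2 E T" "0 \<le> x" for x
      using nn(1)[OF that] by (simp add: scaleR_nonneg_nonneg)
  qed
  show "ord_neg (L2 E T) S \<in> BT_pos E T"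
    unfolding eq(2)
  proof (rule BT_posI)
    show "(\<lambda>x. (1 / 2) *\<^sub>R (absS - S) x) \<in> BT E T" using QB SB by (intro BT_scaleR BT_diff)
    show "0 \<le> (1 / 2) *\<^sub>R (absS - S) x" if "x \<in> L2 E T" "0 \<le> x" for x
      using nn(2)[OF that] by (intro scaleR_nonneg_nonneg) simp_all
  qed
qed

end

section \<open>The vector lattice of regular operators\<close>

text \<open>The supremum and infimum are (R + Q + |R - Q|) / 2 and (R + Q - |R - Q|) / 2; since R -
  Q is regular, so is its modulus.\<close>

lemma BT_reg_lattice:
  assumes R: "R \<in> BT_reg E T" and Q: "Q \<in> BT_reg E T"
  shows "\<exists>M. lub_in (op_le (L2 E T)) (BT_reg E T) {R, Q} M"
    "\<exists>M. glb_in (op_le (L2 E T)) (BT_reg E T) {R, Q} M"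
proof -
  let ?V = "BT_reg E T" and ?H = "L2 E T"
  let ?A = "ord_abs ?H (R - Q)"
  obtain P N where PN: "P \<in> BT_pos E T" "N \<in> BT_pos E T" "R - Q = P - N"
    using BT_reg_diff[OF R Q] by (rule BT_reg_cases)
  have A: "?A \<in> ?V" using ord_abs_BT_pos[OF PN] by (rule BT_pos_reg)
  have dom: "R x - Q x \<le> ?A x" "Q x - R x \<le> ?A x" if "x \<in> ?H" "0 \<le> x" for x
    using abs_S_le_ord_abs[OF PN that] by (simp_all add: abs_le_iff)
  have least: "?A x \<le> D x"
    if D: "D \<in> ?V" and le: "\<And>y. y \<in> ?H \<Longrightarrow> 0 \<le> y \<Longrightarrow> R y - Q y \<le> D y \<and> Q y - R y \<le> D y"
      and x: "x \<in> ?H" "0 \<le> x" for D x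
    using BT_reg_A_linear[OF D] _ x
    by (rule ord_abs_le[OF PN]) (use le in \<open>simp add: abs_le_iff\<close>)
  show "\<exists>M. lub_in (op_le ?H) ?V {R, Q} M"
  proof (rule exI)
    let ?M = "\<lambda>x. (1 / 2) *\<^sub>R ((R + Q) + ?A) x"
    show "lub_in (op_le ?H) ?V {R, Q} ?M"
      unfolding lub_in_def
    proof (intro conjI ballI impI)
      show "?M \<in> ?V" using R Q A by (intro BT_reg_scaleR BT_reg_add)
      show "op_le ?H d ?M" if "d \<in> {R, Q}" for d
        using that dom by (auto simp: op_le_iff half_le_iff algebra_simps simp del: scaleR_right_distrib scaleR_right_diff_distrib)
      fix U assume U: "U \<in> ?V" "\<forall>d\<in>{R, Q}. op_le ?H d U"
      \<comment> \<open>The operator 2 U - (R + Q) dominates both R - Q and Q - R on the cone, hence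
        |R - Q| by minimality.\<close>
      have "?A x \<le> ((U - R) + (U - Q)) x" if "x \<in> ?H" "0 \<le> x" for x
      proof (rule least[OF _ _ that])
        show "(U - R) + (U - Q) \<in> ?V" using U R Q by (intro BT_reg_add BT_reg_diff)
        fix y assume y: "y \<in> ?H" "0 \<le> y"
        then have "R y \<le> U y" "Q y \<le> U y" using U(2) by (simp_all add: op_le_iff)
        then have "R y + R y \<le> U y + U y" "Q y + Q y \<le> U y + U y" by (simp_all add: add_mono)
        then show "R y - Q y \<le> ((U - R) + (U - Q)) y \<and> Q y - R y \<le> ((U - R) + (U - Q)) y"
          by (simp add: algebra_simps)
      qed
      then show "op_le ?H ?M U" by (simp add: op_le_iff half_le_iff algebra_simps del: scaleR_right_distrib scaleR_right_diff_distrib)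
    qed
  qed
  show "\<exists>M. glb_in (op_le ?H) ?V {R, Q} M"
  proof (rule exI)
    let ?M = "\<lambda>x. (1 / 2) *\<^sub>R ((R + Q) - ?A) x"
    show "glb_in (op_le ?H) ?V {R, Q} ?M"
      unfolding glb_in_def lub_in_def
    proof (intro conjI ballI impI)
      show "?M \<in> ?V" using R Q A by (intro BT_reg_scaleR BT_reg_add BT_reg_diff)
      show "op_le ?H ?M d" if "d \<in> {R, Q}" for d
        using that dom by (auto simp: op_le_iff half_le_iff algebra_simps simp del: scaleR_right_distrib scaleR_right_diff_distrib)
      fix U assume U: "U \<in> ?V" "\<forall>d\<in>{R, Q}. op_le ?H U d"
      have "?A x \<le> ((R - U) + (Q - U)) x" if "x \<in> ?H" "0 \<le> x" for x
      proof (rule least[OF _ _ that])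
        show "(R - U) + (Q - U) \<in> ?V" using U R Q by (intro BT_reg_add BT_reg_diff)
        fix y assume y: "y \<in> ?H" "0 \<le> y"
        then have "U y \<le> R y" "U y \<le> Q y" using U(2) by (simp_all add: op_le_iff)
        then have "U y + U y \<le> R y + R y" "U y + U y \<le> Q y + Q y" by (simp_all add: add_mono)
        then show "R y - Q y \<le> ((R - U) + (Q - U)) y \<and> Q y - R y \<le> ((R - U) + (Q - U)) y"
          by (simp add: algebra_simps)
      qed
      then show "op_le ?H U ?M" by (simp add: op_le_iff half_le_iff algebra_simps del: scaleR_right_distrib scaleR_right_diff_distrib)
    qed
  qed
qed

lemma BT_reg_subspace: "op_subspace (BT_reg E T)"
  unfolding op_subspace_def
  using BT_pos_reg[OF BT_pos_zero] BT_reg_add BT_reg_scaleR by blast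

lemma op_le_antisym:
  assumes R: "R \<in> BT_reg E T" and Q: "Q \<in> BT_reg E T"
    and le: "op_le (L2 E T) R Q" "op_le (L2 E T) Q R"
  shows "R = Q"
proof (rule ext)
  fix x
  note RA = BT_reg_A_linear[OF R] and QA = BT_reg_A_linear[OF Q]
  have nn: "R y = Q y" if "y \<in> L2 E T" "0 \<le> y" for y
    using le that by (intro order.antisym) (simp_all add: op_le_iff)
  show "R x = Q x"
  proof (cases "x \<in> L2 E T")
    case True
    then have p: "pprt x \<in> L2 E T" "pprt (- x) \<in> L2 E T" by (simp_all add: L2_pprt L2_minus)
    have "R (pprt x - pprt (- x)) = Q (pprt x - pprt (- x))"
      using op_diff[OF RA p] op_diff[OF QA p] nn p by simp
    then show ?thesis by (simp only: pprt_minus_pprt)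
  qed (simp add: op_outside[OF RA] op_outside[OF QA])
qed

lemma BT_reg_vector_lattice: "op_vector_lattice (BT_reg E T) (op_le (L2 E T))"
  unfolding op_vector_lattice_def
proof (intro conjI ballI impI allI BT_reg_subspace)
  show "R = Q" if "R \<in> BT_reg E T" "Q \<in> BT_reg E T" "op_le (L2 E T) R Q \<and> op_le (L2 E T) Q R" for R Q
    using that op_le_antisym by blast
  show "op_le (L2 E T) R M" if "op_le (L2 E T) R Q \<and> op_le (L2 E T) Q M" for R Q M
    using that by (auto simp: op_le_iff intro: order_trans)
  show "op_le (L2 E T) (\<lambda>x. c *\<^sub>R R x) (\<lambda>x. c *\<^sub>R Q x)" if "0 \<le> c" "op_le (L2 E T) R Q" for c R Q
    using that by (auto simp: op_le_iff intro: scaleR_left_mono)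
qed (simp_all add: op_le_iff BT_reg_lattice)

lemma BT_reg_subalgebra: "op_subalgebra (op_id (L2 E T)) (BT_reg E T) (BT E T)"
  unfolding op_subalgebra_def
  using BT_reg_subspace BT_reg_BT BT_pos_reg[OF BT_pos_id] BT_reg_comp by blast

end

theorem theorem9p9:
  fixes E :: "'a::universally_complete_f_algebra set" and T :: "'a \<Rightarrow> 'a"
  assumes "riesz_conditional_expectation E T"
  shows "BT_reg E T \<subseteq> LbA E T \<and>
    op_vector_lattice (BT_reg E T) (op_le (L2 E T)) \<and>
    op_subalgebra (op_id (L2 E T)) (BT_reg E T) (BT E T) \<and>
    (\<forall>S P N. P \<in> BT_pos E T \<and> N \<in> BT_pos E T \<and> S = P - N \<longrightarrow>
      ord_abs (L2 E T) S \<in> BT_pos E T \<and>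
      op_le (L2 E T) 0 (ord_abs (L2 E T) S) \<and>
      op_le (L2 E T) (ord_abs (L2 E T) S) (P + N) \<and>
      ord_pos (L2 E T) S \<in> BT_pos E T \<and>
      ord_neg (L2 E T) S \<in> BT_pos E T \<and>
      (\<forall>kP\<in>rangeT E T. \<forall>kN\<in>rangeT E T.
        0 \<le> kP \<and> 0 \<le> kN \<and>
        (\<forall>x\<in>L2 E T. normT2 E T (P x) \<le> kP * normT2 E T x) \<and>
        (\<forall>x\<in>L2 E T. normT2 E T (N x) \<le> kN * normT2 E T x) \<longrightarrow>
        (\<forall>x\<in>L2 E T. normT2 E T (ord_abs (L2 E T) S x) \<le> (kP + kN) * normT2 E T x)))"
proof -
  interpret riesz_conditional_expectation E T by (rule assms)
  show ?thesis
  proof (intro conjI allI impI ballI BT_reg_LbA BT_reg_vector_lattice BT_reg_subalgebra)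
    fix S P N assume *: "P \<in> BT_pos E T \<and> N \<in> BT_pos E T \<and> S = P - N"
    then have P: "P \<in> BT_pos E T" and N: "N \<in> BT_pos E T" and S: "S = P - N" by simp_all
    show "ord_abs (L2 E T) S \<in> BT_pos E T" "ord_pos (L2 E T) S \<in> BT_pos E T"
      "ord_neg (L2 E T) S \<in> BT_pos E T"
      using ord_abs_BT_pos[OF P N S] ord_pos_neg_BT_pos[OF P N S] by simp_all
    show "op_le (L2 E T) 0 (ord_abs (L2 E T) S)" "op_le (L2 E T) (ord_abs (L2 E T) S) (P + N)"
      using RK_nonneg[OF P N S] RK_le[OF P N S]
      by (simp_all add: op_le_iff ord_abs_nonneg[OF P N S])
    fix kP kN x
    assume "0 \<le> kP \<and> 0 \<le> kN \<and>
        (\<forall>x\<in>L2 E T. normT2 E T (P x) \<le> kP * normT2 E T x) \<and>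
        (\<forall>x\<in>L2 E T. normT2 E T (N x) \<le> kN * normT2 E T x)" and "x \<in> L2 E T"
    then show "normT2 E T (ord_abs (L2 E T) S x) \<le> (kP + kN) * normT2 E T x"
      using ord_abs_nrm_le[OF P N S, of kP kN x] by blast
  qed
qed

end
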